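(* For each $n$ let $n_1=n_1(n)\ge n$ and $n_2=n_2(n)\ge n$ be integers, let $X_n\in\mathbb R^{n\times n_1}$ and $Y_n\in\mathbb R^{n\times n_2}$ be random matrices whose entries are independent standard normal random variables (all defined on a common probability space), let $F_n=(\frac1{n_1}X_nX_n^T)(\frac1{n_2}Y_nY_n^T)^{-1}$, and let $\lambda_1^F\le\dots\le\lambda_n^F$ be its eigenvalues. Suppose $$\lim_{n\to\infty}\frac n{n_1}=0,\qquad\lim_{n\to\infty}\frac n{n_2}=y'\in(0,1],$$ and $n_1=O(n^{1+\nu})$ for some $\nu\in(0,1/3)$. Then the empirical distribution function of the scaled eigenvalues $$\mu_i=\frac{n}{2(n_1-n)}\Big(\lambda_i^F\frac{n_1}{n_2}+1\Big),\qquad i=1,\dots,n,$$ converges almost surely to the distribution function with density $$f_{y'}(x)=\frac1{4\pi}\frac{\sqrt{(xs_2-1)(1-xs_1)}}{x^2}\,I_{(s_2^{-1},s_1^{-1})}(x),$$ where $s_1=2(y'^{-1}+1)-4\sqrt{y'^{-1}}$ and $s_2=2(y'^{-1}+1)+4\sqrt{y'^{-1}}$.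
   Context: The empirical distribution function of real numbers $\mu_1,\dots,\mu_n$ is $\xi\mapsto\frac1n\sum_{i=1}^nI\{\mu_i\le\xi\}$. *)

theory Defs
  imports "HOL-Probability.Probability" "HOL-Library.Landau_Symbols"
    "Jordan_Normal_Form.Char_Poly" "Jordan_Normal_Form.Gauss_Jordan_Elimination"
begin

definition emp_df :: "nat \<Rightarrow> (nat \<Rightarrow> real) \<Rightarrow> real \<Rightarrow> real" where
  "emp_df n mu xi = (1 / real n) * (\<Sum>i<n. if mu i \<le> xi then 1 else 0)"

definition eig_mset :: "real mat \<Rightarrow> real multiset" where
  "eig_mset A = (\<Sum>r\<in>{r. poly (char_poly A) r = 0}. replicate_mset (order r (char_poly A)) r)"

definition eigs_sorted :: "real mat \<Rightarrow> real list" where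
  "eigs_sorted A = sorted_list_of_multiset (eig_mset A)"

definition F_mat :: "nat \<Rightarrow> nat \<Rightarrow> nat \<Rightarrow> (nat \<Rightarrow> nat \<Rightarrow> real) \<Rightarrow> (nat \<Rightarrow> nat \<Rightarrow> real) \<Rightarrow> real mat" where
  "F_mat n n1 n2 X Y =
     (let Xm = mat n n1 (\<lambda>(i,j). X i j); Ym = mat n n2 (\<lambda>(i,j). Y i j);
          A = (1 / real n1) \<cdot>\<^sub>m (Xm * transpose_mat Xm);
          B = (1 / real n2) \<cdot>\<^sub>m (Ym * transpose_mat Ym)
      in A * the (mat_inverse B))"

text \<open>Limiting density f_{y'}.  The indicator of (1/s2, 1/s1) is written as
  1/s2 < x and x s1 < 1, which is the same for s1 > 0 and is (1/s2, infinity) for s1 = 0 (y' = 1).\<close>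
definition s1 :: "real \<Rightarrow> real" where "s1 y = 2 * (1/y + 1) - 4 * sqrt (1/y)"
definition s2 :: "real \<Rightarrow> real" where "s2 y = 2 * (1/y + 1) + 4 * sqrt (1/y)"

definition f_dens :: "real \<Rightarrow> real \<Rightarrow> real" where
  "f_dens y x = (if 1 / s2 y < x \<and> x * s1 y < 1
      then 1 / (4 * pi) * sqrt ((x * s2 y - 1) * (1 - x * s1 y)) / x^2 else 0)"

definition G_lim :: "real \<Rightarrow> real \<Rightarrow> real" where
  "G_lim y xi = (LBINT x:{..xi}. f_dens y x)"

end

theory Submission
  imports Defs "Jordan_Normal_Form.Schur_Decomposition" "HOL-Real_Asymp.Real_Asymp"
begin

text \<open>
  The eigenvalues \<open>l\<close> of \<open>F = A B\<^sup>-\<^sup>1\<close> enter only through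
  \<open>h(t) = 1/n \<Sum> 1/(1 + t l) = 1/n tr (B (B + t A)\<^sup>-\<^sup>1)\<close> for \<open>t > 0\<close>, which determines their
  distribution. A rank-one update of \<open>A\<close> or \<open>B\<close> changes \<open>n h(t)\<close> by at most 1, so replacing one column
  of \<open>X\<close> or \<open>Y\<close> does too, and McDiarmid's bounded differences inequality shows that \<open>h(t)\<close> stays
  within \<open>\<delta>\<close> of its mean except with probability \<open>2 exp (-2 \<delta>\<^sup>2 n\<^sup>2 / (n\<^sub>1 + n\<^sub>2))\<close>; the growth
  condition on \<open>n\<^sub>1\<close> makes this summable. For the mean, \<open>A\<close> may be replaced by the identity, because
  \<open>1/n \<parallel>A - I\<parallel>\<^sup>2\<close> (Frobenius norm) has expectation of order \<open>n / n\<^sub>1\<close>, and leaving out one column of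
  \<open>Y\<close> gives the quadratic equation for the resolvent trace that characterises the Marchenko-Pastur law.
  No operator norm bound and no spectral theorem is needed.
\<close>

section \<open>Positive definite matrices and rank-one updates\<close>

no_notation inner (infix "\<bullet>" 70)

text \<open>Three obstacles shape the proof. For y' = 1 the limit law has unbounded support and no
  finite mean, so moments of the eigenvalues are of no use; \<open>w = l / (1 + l)\<close> maps the
  spectrum into [0,1], where all moments exist and polynomials are dense. Next, \<open>A\<close> is
  close to the identity only in the averaged Frobenius sense and may still have eigenvalues near 0,
  where the resolvent identity gives no bound; a few rank-one updates, each costing at most 1 in the
  trace, lift \<open>A\<close> above 1/2 beforehand. Finally, bounded differences must hold at every
  point of the product space, whereas \<open>B\<close> is invertible only almost surely; in the form
  tr (B (B + t W)^-1) with \<open>W\<close> positive definite the inverse of \<open>B\<close> itself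
  has disappeared. The scaled eigenvalues are a l + b with a tending to y'/2 and b to 0. The
  eigenvalue that corresponds to a point x of the limit law is therefore 2 x / y', which is why this
  quantity stands in every transform of the limit density.\<close>

definition mtrace :: "real mat \<Rightarrow> real" where
  "mtrace S = (\<Sum>i<dim_row S. S $$ (i,i))"

definition outer :: "real vec \<Rightarrow> real mat" where
  "outer u = mat (dim_vec u) (dim_vec u) (\<lambda>(i,k). u $ i * u $ k)"

definition fro2 :: "real mat \<Rightarrow> real" where
  "fro2 S = (\<Sum>i<dim_row S. \<Sum>k<dim_col S. (S $$ (i,k))\<^sup>2)"

definition symm :: "nat \<Rightarrow> real mat \<Rightarrow> bool" where
  "symm n S \<longleftrightarrow> S \<in> carrier_mat n n \<and> transpose_mat S = S"

definition psd :: "nat \<Rightarrow> real mat \<Rightarrow> bool" where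
  "psd n S \<longleftrightarrow> symm n S \<and> (\<forall>v\<in>carrier_vec n. 0 \<le> v \<bullet> (S *\<^sub>v v))"

definition pd :: "nat \<Rightarrow> real mat \<Rightarrow> bool" where
  "pd n S \<longleftrightarrow> symm n S \<and> (\<forall>v\<in>carrier_vec n. v \<noteq> 0\<^sub>v n \<longrightarrow> 0 < v \<bullet> (S *\<^sub>v v))"

text \<open>Cramer's formula gives a total function whose entries are quotients of polynomials in
  the entries of the matrix; measurability and continuity follow from this. It is the inverse
  whenever the determinant is nonzero.\<close>

definition minv :: "real mat \<Rightarrow> real mat" where
  "minv S = (1 / det S) \<cdot>\<^sub>m adj_mat S"

section \<open>Scalar products, symmetric and definite matrices\<close>

lemma sprod_self: "(v::real vec) \<bullet> v = (\<Sum>i<dim_vec v. (v $ i)\<^sup>2)"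
  by (simp add: scalar_prod_def power2_eq_square lessThan_atLeast0)

lemma sprod_self_nonneg: "0 \<le> (v::real vec) \<bullet> v"
  by (simp add: sprod_self sum_nonneg)

lemma sprod_self_pos: "(v::real vec) \<in> carrier_vec n \<Longrightarrow> v \<noteq> 0\<^sub>v n \<Longrightarrow> 0 < v \<bullet> v"
proof -
  assume v: "v \<in> carrier_vec n" "v \<noteq> 0\<^sub>v n"
  then obtain i where i: "i < n" "v $ i \<noteq> 0" by (metis carrier_vecD eq_vecI index_zero_vec)
  have "0 < (\<Sum>i<dim_vec v. (v $ i)\<^sup>2)"
    by (rule sum_pos2[of _ i]) (use i v in auto)
  then show ?thesis by (simp add: sprod_self)
qed

lemma sprod_cauchy:
  assumes "(v::real vec) \<in> carrier_vec n" "w \<in> carrier_vec n"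
  shows "(v \<bullet> w)\<^sup>2 \<le> (v \<bullet> v) * (w \<bullet> w)"
  using Cauchy_Schwarz_ineq_sum[of "\<lambda>i. v $ i" "\<lambda>i. w $ i" "{0..<n}"] assms
  by (simp add: scalar_prod_def power2_eq_square)

lemma symmD: "symm n S \<Longrightarrow> S \<in> carrier_mat n n" by (simp add: symm_def)

lemma symm_sprod:
  assumes "symm n S" "x \<in> carrier_vec n" "y \<in> carrier_vec n"
  shows "(S *\<^sub>v x) \<bullet> y = x \<bullet> (S *\<^sub>v y)"
  using transpose_vec_mult_scalar[of S n n y x] assms by (simp add: symm_def)

lemma sprod_minus_smult:
  assumes "(u::real vec) \<in> carrier_vec n" "z \<in> carrier_vec n" "w \<in> carrier_vec n"
  shows "u \<bullet> (z - c \<cdot>\<^sub>v w) = u \<bullet> z - c * (u \<bullet> w)"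
  using assms by (simp add: scalar_prod_def sum_subtractf sum_distrib_left right_diff_distrib mult.left_commute)

lemma symm_entry: "symm n S \<Longrightarrow> i < n \<Longrightarrow> k < n \<Longrightarrow> S $$ (i,k) = S $$ (k,i)"
  unfolding symm_def by (metis carrier_matD index_transpose_mat(1))

lemma symmI: "S \<in> carrier_mat n n \<Longrightarrow> (\<And>i k. i < n \<Longrightarrow> k < n \<Longrightarrow> S $$ (i,k) = S $$ (k,i)) \<Longrightarrow> symm n S"
  unfolding symm_def by (auto intro!: eq_matI)

lemma symm_add: "symm n A \<Longrightarrow> symm n B \<Longrightarrow> symm n (A + B)"
  using symmD[of n A] symmD[of n B] by (intro symmI) (auto simp: symm_entry[of n A] symm_entry[of n B])

lemma symm_smult: "symm n A \<Longrightarrow> symm n (c \<cdot>\<^sub>m A)"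
  using symmD[of n A] by (intro symmI) (auto simp: symm_entry[of n A])

lemma smult_mat_vec: "A \<in> carrier_mat n n \<Longrightarrow> v \<in> carrier_vec n \<Longrightarrow> (c \<cdot>\<^sub>m A) *\<^sub>v v = c \<cdot>\<^sub>v (A *\<^sub>v (v::real vec))"
  by (intro eq_vecI) (auto simp: scalar_prod_def sum_distrib_left algebra_simps)

lemma qf_add:
  assumes "A \<in> carrier_mat n n" "B \<in> carrier_mat n n" "v \<in> carrier_vec n" "w \<in> carrier_vec n"
  shows "(w::real vec) \<bullet> ((A + B) *\<^sub>v v) = w \<bullet> (A *\<^sub>v v) + w \<bullet> (B *\<^sub>v v)"
  using assms by (simp add: add_mult_distrib_mat_vec[of _ n n] scalar_prod_add_distrib[of _ n])

lemma qf_smult: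
  assumes "A \<in> carrier_mat n n" "v \<in> carrier_vec n" "w \<in> carrier_vec n"
  shows "(w::real vec) \<bullet> ((c \<cdot>\<^sub>m A) *\<^sub>v v) = c * (w \<bullet> (A *\<^sub>v v))"
  using assms by (simp add: smult_mat_vec scalar_prod_smult_distrib[of _ n])

lemma outer_carrier[simp]: "u \<in> carrier_vec n \<Longrightarrow> outer u \<in> carrier_mat n n"
  by (auto simp: outer_def)

lemma symm_outer: "u \<in> carrier_vec n \<Longrightarrow> symm n (outer u)"
  by (rule symmI) (auto simp: outer_def)

lemma outer_mult_vec:
  assumes "u \<in> carrier_vec n" "v \<in> carrier_vec n"
  shows "outer u *\<^sub>v v = (u \<bullet> v) \<cdot>\<^sub>v u"
  using assms by (intro eq_vecI) (auto simp: outer_def scalar_prod_def sum_distrib_left sum_distrib_right algebra_simps intro!: sum.cong)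

lemma outer_smult: "outer (c \<cdot>\<^sub>v u) = c\<^sup>2 \<cdot>\<^sub>m outer u"
  by (intro eq_matI) (auto simp: outer_def power2_eq_square)

lemma psd_outer: assumes "u \<in> carrier_vec n" shows "psd n (outer u)"
  unfolding psd_def
proof (intro conjI ballI)
  fix v :: "real vec" assume v: "v \<in> carrier_vec n"
  show "0 \<le> v \<bullet> (outer u *\<^sub>v v)"
    using assms v comm_scalar_prod[of u n v] by (simp add: outer_mult_vec scalar_prod_smult_distrib[of _ n])
qed (use assms symm_outer in auto)

lemma psdD: "psd n S \<Longrightarrow> S \<in> carrier_mat n n" by (simp add: psd_def symm_def)
lemma pdD: "pd n S \<Longrightarrow> S \<in> carrier_mat n n" by (simp add: pd_def symm_def)
lemma psd_symm: "psd n S \<Longrightarrow> symm n S" by (simp add: psd_def)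
lemma pd_symm: "pd n S \<Longrightarrow> symm n S" by (simp add: pd_def)
lemma psd_ge: "psd n S \<Longrightarrow> v \<in> carrier_vec n \<Longrightarrow> 0 \<le> v \<bullet> (S *\<^sub>v v)" by (simp add: psd_def)

lemma pd_psd: assumes "pd n S" shows "psd n S"
  unfolding psd_def
proof (intro conjI ballI)
  fix v :: "real vec" assume v: "v \<in> carrier_vec n"
  show "0 \<le> v \<bullet> (S *\<^sub>v v)"
  proof (cases "v = 0\<^sub>v n")
    case True
    have "S *\<^sub>v v \<in> carrier_vec n" using v pdD[OF assms] by auto
    then show ?thesis using True by simp
  qed (use assms v in \<open>auto simp: pd_def intro: less_imp_le\<close>)
qed (use assms pd_symm in auto)

lemma psd_add: "psd n A \<Longrightarrow> psd n B \<Longrightarrow> psd n (A + B)"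
  unfolding psd_def by (auto simp: symm_add qf_add[of _ n] symmD)

lemma pd_add_psd: "pd n A \<Longrightarrow> psd n B \<Longrightarrow> pd n (A + B)"
  unfolding psd_def pd_def by (auto simp: symm_add qf_add[of _ n] symmD intro!: add_pos_nonneg)

lemma psd_add_pd: "psd n A \<Longrightarrow> pd n B \<Longrightarrow> pd n (A + B)"
  unfolding psd_def pd_def by (auto simp: symm_add qf_add[of _ n] symmD intro!: add_nonneg_pos)

lemma psd_smult: "psd n A \<Longrightarrow> 0 \<le> c \<Longrightarrow> psd n (c \<cdot>\<^sub>m A)"
  unfolding psd_def by (auto simp: symm_smult qf_smult[of _ n] symmD)

lemma pd_smult: "pd n A \<Longrightarrow> 0 < c \<Longrightarrow> pd n (c \<cdot>\<^sub>m A)"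
  unfolding pd_def by (auto simp: symm_smult qf_smult[of _ n] symmD)

lemma symm_one: "symm n (1\<^sub>m n)" by (simp add: symm_def)

lemma pd_one: "pd n (1\<^sub>m n)"
  unfolding pd_def by (auto simp: symm_one sprod_self_pos)

lemma pd_det: assumes "pd n S" shows "det S \<noteq> 0"
proof
  assume "det S = 0"
  then obtain v where v: "v \<in> carrier_vec n" "v \<noteq> 0\<^sub>v n" "S *\<^sub>v v = 0\<^sub>v n"
    using det_0_iff_vec_prod_zero_field[OF pdD[OF assms]] by auto
  with assms have "0 < v \<bullet> (0\<^sub>v n :: real vec)" by (auto simp: pd_def dest: bspec[of _ _ v])
  with v show False by simp
qed

section \<open>Inverses\<close>

lemma minv_carrier[simp]: "S \<in> carrier_mat n n \<Longrightarrow> minv S \<in> carrier_mat n n"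
  by (simp add: minv_def adj_mat(1))

lemma mult_sq_carrier[simp]: "(A::real mat) \<in> carrier_mat n n \<Longrightarrow> B \<in> carrier_mat n n \<Longrightarrow> A * B \<in> carrier_mat n n"
  by (rule mult_carrier_mat)

lemma minv_right: assumes "S \<in> carrier_mat n n" "det S \<noteq> 0" shows "S * minv S = 1\<^sub>m n"
proof -
  have "S * minv S = (1 / det S) \<cdot>\<^sub>m (S * adj_mat S)"
    unfolding minv_def by (rule mult_smult_distrib[OF assms(1) adj_mat(1)[OF assms(1)]])
  then show ?thesis using assms by (auto simp: adj_mat(2) intro!: eq_matI)
qed

lemma minv_left: assumes "S \<in> carrier_mat n n" "det S \<noteq> 0" shows "minv S * S = 1\<^sub>m n"
proof -
  have "minv S * S = (1 / det S) \<cdot>\<^sub>m (adj_mat S * S)"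
    unfolding minv_def by (rule mult_smult_assoc_mat[OF adj_mat(1)[OF assms(1)] assms(1)])
  then show ?thesis using assms by (auto simp: adj_mat(3) intro!: eq_matI)
qed

text \<open>A one-sided inverse suffices, since multiplicativity of the determinant already makes
  \<open>S\<close> invertible.\<close>

lemma minv_unique:
  assumes S: "S \<in> carrier_mat n n" and T: "T \<in> carrier_mat n n" and ST: "S * T = 1\<^sub>m n"
  shows "T = minv S"
proof -
  have "det S * det T = 1" using det_mult[OF S T] ST by simp
  then have d: "det S \<noteq> 0" by auto
  have "minv S * (S * T) = T"
    using S T d by (simp add: assoc_mult_mat[of _ n n _ n _ n, symmetric] minv_left)
  then show ?thesis unfolding ST using right_mult_one_mat[OF minv_carrier[OF S]] by simp
qed

lemma minv_vec:
  assumes "pd n S" "v \<in> carrier_vec n"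
  shows "minv S *\<^sub>v v \<in> carrier_vec n" "S *\<^sub>v (minv S *\<^sub>v v) = v" "minv S *\<^sub>v (S *\<^sub>v v) = v"
proof -
  note S = pdD[OF assms(1)] and d = pd_det[OF assms(1)]
  show "minv S *\<^sub>v v \<in> carrier_vec n" using S assms(2) by (intro mult_mat_vec_carrier[of _ n n]) auto
  show "S *\<^sub>v (minv S *\<^sub>v v) = v"
    using S assms d by (simp add: assoc_mult_mat_vec[of _ n n _ n, symmetric] minv_right del: assoc_mult_mat_vec)
  show "minv S *\<^sub>v (S *\<^sub>v v) = v"
    using S assms d by (simp add: assoc_mult_mat_vec[of _ n n _ n, symmetric] minv_left del: assoc_mult_mat_vec)
qed

lemma minv_vec_eqI:
  assumes "pd n S" "v \<in> carrier_vec n" "S *\<^sub>v v = w"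
  shows "minv S *\<^sub>v w = v"
  using minv_vec(3)[OF assms(1,2)] assms(3) by simp

section \<open>Traces under rank-one updates\<close>

lemma mat_mult_unit: "(S::real mat) \<in> carrier_mat n n \<Longrightarrow> i < n \<Longrightarrow> S *\<^sub>v unit_vec n i = col S i"
  by (intro eq_vecI) auto

lemma mtrace_mult:
  assumes "K \<in> carrier_mat n n" "S \<in> carrier_mat n n"
  shows "mtrace (K * S) = (\<Sum>i<n. \<Sum>k<n. K $$ (i,k) * S $$ (k,i))"
  using assms by (auto simp: mtrace_def scalar_prod_def lessThan_atLeast0 intro!: sum.cong)

lemma mtrace_mult_unit:
  assumes "K \<in> carrier_mat n n" "S \<in> carrier_mat n n"
  shows "mtrace (K * S) = (\<Sum>i<n. (K *\<^sub>v (S *\<^sub>v unit_vec n i)) $ i)"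
  using assms by (auto simp: mtrace_def mat_mult_unit intro!: sum.cong)

lemma mtrace_comm:
  assumes "K \<in> carrier_mat n n" "S \<in> carrier_mat n n"
  shows "mtrace (K * S) = mtrace (S * K)"
  unfolding mtrace_mult[OF assms] mtrace_mult[OF assms(2,1)]
  by (subst sum.swap) (auto intro!: sum.cong)

lemma mtrace_add: "A \<in> carrier_mat n n \<Longrightarrow> B \<in> carrier_mat n n \<Longrightarrow> mtrace (A + B) = mtrace A + mtrace B"
  by (auto simp: mtrace_def sum.distrib)

lemma mtrace_minus: "A \<in> carrier_mat n n \<Longrightarrow> B \<in> carrier_mat n n \<Longrightarrow> mtrace (A - B) = mtrace A - mtrace B"
  by (auto simp: mtrace_def sum_subtractf)

lemma mtrace_smult: "mtrace (c \<cdot>\<^sub>m A) = c * mtrace A" if "A \<in> carrier_mat n n"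
  using that by (auto simp: mtrace_def sum_distrib_left)

lemma mtrace_one: "mtrace (1\<^sub>m n) = real n"
  by (simp add: mtrace_def)

text \<open>The Sherman-Morrison formula applied to a vector \<open>e\<close>, proved by checking
  that the right-hand side solves the linear system. By the last claim the denominator is at least
  1, so the division is always legitimate.\<close>

lemma minv_outer_vec:
  assumes M: "pd n M" and u: "u \<in> carrier_vec n" and e: "e \<in> carrier_vec n"
  defines "w \<equiv> minv M *\<^sub>v u"
  shows "minv (M + outer u) *\<^sub>v e = minv M *\<^sub>v e - ((w \<bullet> e) / (1 + u \<bullet> w)) \<cdot>\<^sub>v w"
    and "u \<bullet> w = w \<bullet> (M *\<^sub>v w)" and "0 \<le> u \<bullet> w"
proof -
  note Mc = pdD[OF M]
  have wc: "w \<in> carrier_vec n" unfolding w_def using minv_vec(1)[OF M u] .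
  have Mw: "M *\<^sub>v w = u" unfolding w_def using minv_vec(2)[OF M u] .
  show uw: "u \<bullet> w = w \<bullet> (M *\<^sub>v w)" using Mw comm_scalar_prod[OF u wc] by simp
  show uw0: "0 \<le> u \<bullet> w" unfolding uw using psd_ge[OF pd_psd[OF M] wc] .
  define z where "z = minv M *\<^sub>v e"
  have zc: "z \<in> carrier_vec n" unfolding z_def using minv_vec(1)[OF M e] .
  have Mz: "M *\<^sub>v z = e" unfolding z_def using minv_vec(2)[OF M e] .
  have we: "w \<bullet> e = u \<bullet> z" using symm_sprod[OF pd_symm[OF M] wc zc] Mz Mw by simp
  define c where "c = (w \<bullet> e) / (1 + u \<bullet> w)"
  \<comment> \<open>\<open>c\<close> is determined by this fixed point condition: the rank-one term
    then contributes \<open>c\<close> times \<open>u\<close>, which cancels the correction coming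
    from \<open>M\<close>.\<close>
  have ceq: "c = u \<bullet> (z - c \<cdot>\<^sub>v w)"
  proof -
    have "u \<bullet> (z - c \<cdot>\<^sub>v w) = u \<bullet> z - c * (u \<bullet> w)"
      by (rule sprod_minus_smult[OF u zc wc])
    also have "\<dots> = c" using uw0 unfolding c_def we by (simp add: field_simps)
    finally show ?thesis by simp
  qed
  have "(M + outer u) *\<^sub>v (z - c \<cdot>\<^sub>v w) = M *\<^sub>v (z - c \<cdot>\<^sub>v w) + c \<cdot>\<^sub>v u"
    using Mc u zc wc ceq by (simp add: add_mult_distrib_mat_vec[of _ n n] outer_mult_vec[of _ n])
  also have "M *\<^sub>v (z - c \<cdot>\<^sub>v w) = e - c \<cdot>\<^sub>v u"
    using Mc zc wc Mz Mw by (simp add: mult_minus_distrib_mat_vec[of _ n n] mult_mat_vec[of _ n n])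
  also have "e - c \<cdot>\<^sub>v u + c \<cdot>\<^sub>v u = e" using e u by auto
  finally have "(M + outer u) *\<^sub>v (z - c \<cdot>\<^sub>v w) = e" .
  then have "minv (M + outer u) *\<^sub>v e = z - c \<cdot>\<^sub>v w"
    using zc wc by (intro minv_vec_eqI[of n] pd_add_psd M psd_outer u) auto
  then show "minv (M + outer u) *\<^sub>v e = minv M *\<^sub>v e - ((w \<bullet> e) / (1 + u \<bullet> w)) \<cdot>\<^sub>v w"
    by (simp add: z_def c_def)
qed

text \<open>With \<open>q\<close> the form of \<open>minv M\<close> at \<open>u\<close>, the choice
  \<open>e = u\<close> in Sherman-Morrison gives \<open>q - q^2 / (1 + q)\<close>. This fraction
  later becomes the nonlinearity of the fixed point equation.\<close>

lemma qf_minv_outer: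
  assumes M: "pd n M" and u: "u \<in> carrier_vec n"
  shows "u \<bullet> (minv (M + outer u) *\<^sub>v u) = (u \<bullet> (minv M *\<^sub>v u)) / (1 + u \<bullet> (minv M *\<^sub>v u))"
proof -
  define w where "w = minv M *\<^sub>v u"
  have wc: "w \<in> carrier_vec n" unfolding w_def using minv_vec(1)[OF M u] .
  have nn: "0 \<le> u \<bullet> w" unfolding w_def by (rule minv_outer_vec(3)[OF M u u])
  have "u \<bullet> (minv (M + outer u) *\<^sub>v u) = u \<bullet> (w - ((w \<bullet> u) / (1 + u \<bullet> w)) \<cdot>\<^sub>v w)"
    using minv_outer_vec(1)[OF M u u] by (simp add: w_def)
  also have "\<dots> = u \<bullet> w - (w \<bullet> u) / (1 + u \<bullet> w) * (u \<bullet> w)"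
    by (rule sprod_minus_smult[OF u wc wc])
  also have "\<dots> = (u \<bullet> w) / (1 + u \<bullet> w)"
    using nn comm_scalar_prod[OF u wc] by (simp add: field_simps)
  finally show ?thesis by (simp add: w_def)
qed

text \<open>The trace drops by \<open>w \<bullet> K w / (1 + u \<bullet> w)\<close> with
  \<open>w = minv M u\<close>. Since \<open>0 \<le> K \<le> M\<close> as quadratic forms, the
  numerator lies between 0 and \<open>w \<bullet> M w = u \<bullet> w\<close>, so the drop is at
  most 1 however large \<open>u\<close> is.\<close>

lemma mtrace_rank_one:
  assumes M: "pd n M" and K: "psd n K" and MK: "psd n (M - K)" and u: "u \<in> carrier_vec n"
  shows "mtrace (K * minv (M + outer u)) \<le> mtrace (K * minv M)"
    and "mtrace (K * minv M) \<le> mtrace (K * minv (M + outer u)) + 1"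
proof -
  define w where "w = minv M *\<^sub>v u"
  note Mc = pdD[OF M] and Kc = psdD[OF K]
  have wc: "w \<in> carrier_vec n" unfolding w_def using minv_vec(1)[OF M u] .
  have nn: "0 \<le> u \<bullet> w" and uw: "u \<bullet> w = w \<bullet> (M *\<^sub>v w)" unfolding w_def by (rule minv_outer_vec[OF M u u])+
  define a where "a = u \<bullet> w"
  have M'c: "M + outer u \<in> carrier_mat n n" using Mc u by simp
  have Kwc: "K *\<^sub>v w \<in> carrier_vec n" using Kc wc by auto
  have "mtrace (K * minv (M + outer u)) = (\<Sum>i<n. (K *\<^sub>v (minv M *\<^sub>v unit_vec n i)) $ i - (w $ i * (K *\<^sub>v w) $ i) / (1 + a))"
    unfolding mtrace_mult_unit[OF Kc minv_carrier[OF M'c]]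
  proof (intro sum.cong refl)
    fix i assume "i \<in> {..<n}"
    then have i: "i < n" by simp
    have zc: "minv M *\<^sub>v unit_vec n i \<in> carrier_vec n" using minv_vec(1)[OF M] by simp
    have wi: "w \<bullet> unit_vec n i = w $ i" using i wc by simp
    have "K *\<^sub>v (minv (M + outer u) *\<^sub>v unit_vec n i) = K *\<^sub>v (minv M *\<^sub>v unit_vec n i - (w $ i / (1 + a)) \<cdot>\<^sub>v w)"
      using minv_outer_vec(1)[OF M u, of "unit_vec n i"] wi by (simp add: w_def a_def)
    also have "\<dots> = K *\<^sub>v (minv M *\<^sub>v unit_vec n i) - (w $ i / (1 + a)) \<cdot>\<^sub>v (K *\<^sub>v w)"
      using Kc wc zc by (simp add: mult_minus_distrib_mat_vec[of _ n n] mult_mat_vec[of _ n n])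
    finally have *: "K *\<^sub>v (minv (M + outer u) *\<^sub>v unit_vec n i) = \<dots>" .
    show "(K *\<^sub>v (minv (M + outer u) *\<^sub>v unit_vec n i)) $ i =
      (K *\<^sub>v (minv M *\<^sub>v unit_vec n i)) $ i - (w $ i * (K *\<^sub>v w) $ i) / (1 + a)"
      unfolding * using i Kc Kwc by (simp add: carrier_vecD[OF Kwc] del: index_mult_mat_vec)
  qed
  also have "\<dots> = mtrace (K * minv M) - (\<Sum>i<n. w $ i * (K *\<^sub>v w) $ i) / (1 + a)"
    unfolding mtrace_mult_unit[OF Kc minv_carrier[OF Mc]] by (simp add: sum_subtractf sum_divide_distrib)
  also have "(\<Sum>i<n. w $ i * (K *\<^sub>v w) $ i) = w \<bullet> (K *\<^sub>v w)"
    using carrier_vecD[OF Kwc] unfolding scalar_prod_def by (simp only: lessThan_atLeast0)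
  finally have eq: "mtrace (K * minv (M + outer u)) = mtrace (K * minv M) - (w \<bullet> (K *\<^sub>v w)) / (1 + a)" .
  have "0 \<le> w \<bullet> (K *\<^sub>v w)" using psd_ge[OF K wc] .
  moreover have "w \<bullet> (K *\<^sub>v w) \<le> a"
  proof -
    have "0 \<le> w \<bullet> ((M - K) *\<^sub>v w)" using psd_ge[OF MK wc] .
    also have "\<dots> = w \<bullet> (M *\<^sub>v w - K *\<^sub>v w)" using Mc Kc wc by (simp add: minus_mult_distrib_mat_vec[of _ n n])
    also have "\<dots> = w \<bullet> (M *\<^sub>v w) - w \<bullet> (K *\<^sub>v w)"
      using Mc Kc wc by (simp add: scalar_prod_def sum_subtractf algebra_simps)
    finally show ?thesis using uw by (simp add: a_def)
  qed
  ultimately have "0 \<le> (w \<bullet> (K *\<^sub>v w)) / (1 + a)" "(w \<bullet> (K *\<^sub>v w)) / (1 + a) \<le> 1"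
    by (simp_all add: field_simps)
  with eq show "mtrace (K * minv (M + outer u)) \<le> mtrace (K * minv M)"
    and "mtrace (K * minv M) \<le> mtrace (K * minv (M + outer u)) + 1" by simp_all
qed

section \<open>Frobenius norm and the replacement of \<open>A\<close> by the identity\<close>

lemma fro2_nonneg: "0 \<le> fro2 S"
  by (simp add: fro2_def sum_nonneg)

lemma fro2_unit:
  assumes "S \<in> carrier_mat n n"
  shows "fro2 S = (\<Sum>k<n. (S *\<^sub>v unit_vec n k) \<bullet> (S *\<^sub>v unit_vec n k))"
  using assms unfolding fro2_def by (subst sum.swap) (auto simp: mat_mult_unit sprod_self intro!: sum.cong)

text \<open>Cauchy-Schwarz for the entries of \<open>X\<close> against those of the transpose of
  \<open>Y\<close>.\<close>

lemma mtrace_mult_le: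
  assumes "X \<in> carrier_mat n n" "Y \<in> carrier_mat n n"
  shows "\<bar>mtrace (X * Y)\<bar> \<le> sqrt (fro2 X) * sqrt (fro2 Y)"
proof -
  let ?I = "{..<n} \<times> {..<n}"
  have X: "fro2 X = (\<Sum>p\<in>?I. (X $$ p)\<^sup>2)"
    using assms by (simp add: fro2_def sum.cartesian_product case_prod_beta)
  have Y: "fro2 Y = (\<Sum>p\<in>?I. (Y $$ (snd p, fst p))\<^sup>2)"
    using assms unfolding fro2_def by (subst sum.swap) (simp add: sum.cartesian_product case_prod_beta)
  have "(mtrace (X * Y))\<^sup>2 = (\<Sum>p\<in>?I. X $$ p * Y $$ (snd p, fst p))\<^sup>2"
    by (simp add: mtrace_mult[OF assms] sum.cartesian_product case_prod_beta)
  also have "\<dots> \<le> fro2 X * fro2 Y"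
    unfolding X Y by (rule Cauchy_Schwarz_ineq_sum)
  finally show ?thesis
    by (metis real_sqrt_abs real_sqrt_le_iff real_sqrt_mult)
qed

text \<open>Read \<open>a\<close>, \<open>b\<close>, \<open>t\<close> as |x|^2, |z|^2 and the scalar
  product of x and z: a coercivity estimate is combined with Cauchy-Schwarz, and one factor |x| is
  cancelled.\<close>

lemma sq_le_mult_imp_le:
  fixes a b c :: real
  assumes "0 \<le> a" "0 \<le> b" "0 < c" "c * a \<le> t" "t\<^sup>2 \<le> a * b"
  shows "c\<^sup>2 * a \<le> b"
proof (cases "a = 0")
  case False
  have "(c * a)\<^sup>2 \<le> t\<^sup>2" using assms by (intro power_mono) auto
  then have "a * (c\<^sup>2 * a) \<le> a * b" using assms by (simp add: power2_eq_square algebra_simps)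
  then show ?thesis using False assms by simp
qed (use assms in simp)

text \<open>Coercivity bounds \<open>minv S\<close> applied to a column z of \<open>C\<close> by |z|
  / c, as in the Lax-Milgram lemma; the squared column norms are then summed.\<close>

lemma fro2_minv_mult_le:
  assumes S: "pd n S" and C: "C \<in> carrier_mat n n" and c: "0 < c"
    and ge: "\<And>v. v \<in> carrier_vec n \<Longrightarrow> c * (v \<bullet> v) \<le> v \<bullet> (S *\<^sub>v v)"
  shows "fro2 (minv S * C) \<le> fro2 C / c\<^sup>2"
proof -
  note Sc = pdD[OF S]
  have "c\<^sup>2 * fro2 (minv S * C) = (\<Sum>k<n. c\<^sup>2 * (((minv S * C) *\<^sub>v unit_vec n k) \<bullet> ((minv S * C) *\<^sub>v unit_vec n k)))"
    using Sc C by (subst fro2_unit[of _ n]) (auto simp: sum_distrib_left)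
  also have "\<dots> \<le> (\<Sum>k<n. (C *\<^sub>v unit_vec n k) \<bullet> (C *\<^sub>v unit_vec n k))"
  proof (intro sum_mono)
    fix k assume "k \<in> {..<n}"
    define z where "z = C *\<^sub>v unit_vec n k"
    have z: "z \<in> carrier_vec n" unfolding z_def using C by (intro mult_mat_vec_carrier[of _ n n]) auto
    define x where "x = minv S *\<^sub>v z"
    have x: "x \<in> carrier_vec n" "S *\<^sub>v x = z" unfolding x_def using minv_vec[OF S z] by auto
    have "(minv S * C) *\<^sub>v unit_vec n k = x"
      unfolding x_def z_def by (rule assoc_mult_mat_vec[OF minv_carrier[OF Sc] C]) simp
    moreover have "c\<^sup>2 * (x \<bullet> x) \<le> z \<bullet> z"
      by (rule sq_le_mult_imp_le[of _ _ _ "x \<bullet> z"])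
        (use sprod_self_nonneg c ge[OF x(1)] x sprod_cauchy[OF x(1) z] in auto)
    ultimately show "c\<^sup>2 * (((minv S * C) *\<^sub>v unit_vec n k) \<bullet> ((minv S * C) *\<^sub>v unit_vec n k)) \<le> (C *\<^sub>v unit_vec n k) \<bullet> (C *\<^sub>v unit_vec n k)"
      by (simp add: z_def)
  qed
  also have "\<dots> = fro2 C" using fro2_unit[OF C] by simp
  finally show ?thesis using c by (simp add: field_simps)
qed

lemma qf_shift:
  assumes "B \<in> carrier_mat n n" "v \<in> carrier_vec n"
  shows "(B + t \<cdot>\<^sub>m 1\<^sub>m n) *\<^sub>v v = B *\<^sub>v v + t \<cdot>\<^sub>v (v::real vec)"
  using assms by (simp add: add_mult_distrib_mat_vec[of _ n n] smult_mat_vec[of _ n])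

text \<open>\<open>minv (B + t) B\<close> is a contraction, so its Frobenius norm is at most that of
  the identity.\<close>

lemma fro2_minv_shift_mult_le:
  assumes B: "psd n B" and t: "0 < t"
  shows "fro2 (minv (B + t \<cdot>\<^sub>m 1\<^sub>m n) * B) \<le> real n"
proof -
  define S where "S = B + t \<cdot>\<^sub>m 1\<^sub>m n"
  have S: "pd n S" unfolding S_def using B t by (intro psd_add_pd pd_smult pd_one)
  note Sc = pdD[OF S] and Bc = psdD[OF B]
  have "fro2 (minv S * B) = (\<Sum>k<n. ((minv S * B) *\<^sub>v unit_vec n k) \<bullet> ((minv S * B) *\<^sub>v unit_vec n k))"
    using Sc Bc by (intro fro2_unit) auto
  also have "\<dots> \<le> (\<Sum>k<n. 1)"
  proof (intro sum_mono)
    fix k assume "k \<in> {..<n}"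
    then have k: "k < n" by simp
    define e where "e = (unit_vec n k :: real vec)"
    have e: "e \<in> carrier_vec n" "e \<bullet> e = 1" using k by (auto simp: e_def)
    define z where "z = B *\<^sub>v e"
    have z: "z \<in> carrier_vec n" unfolding z_def using Bc e by (intro mult_mat_vec_carrier[of _ n n]) auto
    define x where "x = minv S *\<^sub>v z"
    have x: "x \<in> carrier_vec n" "S *\<^sub>v x = z" unfolding x_def using minv_vec[OF S z] by auto
    have Bx: "B *\<^sub>v x \<in> carrier_vec n" using Bc x(1) by (intro mult_mat_vec_carrier[of _ n n]) auto
    \<comment> \<open>\<open>d\<close> equals \<open>t\<close> times \<open>minv S\<close> applied
      to \<open>e\<close>. The relation \<open>B d = t x\<close> makes \<open>d \<bullet> x\<close>
      nonnegative, so the decomposition \<open>e = x + d\<close> gives |x| \<le> |e|.\<close>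
    define d where "d = e - x"
    have d: "d \<in> carrier_vec n" using e x by (simp add: d_def)
    have xed: "e = x + d" using e x by (auto simp: d_def)
    have Bd: "B *\<^sub>v d \<in> carrier_vec n" using Bc d(1) by (intro mult_mat_vec_carrier[of _ n n]) auto
    have "B *\<^sub>v x + t \<cdot>\<^sub>v x = B *\<^sub>v x + B *\<^sub>v d"
      using x(2) Bc x(1) d unfolding S_def qf_shift[OF Bc x(1)] z_def xed
      by (simp add: mult_add_distrib_mat_vec[of _ n n])
    then have *: "(B *\<^sub>v x + t \<cdot>\<^sub>v x) $ i = (B *\<^sub>v x + B *\<^sub>v d) $ i" for i by simp
    have "B *\<^sub>v d = t \<cdot>\<^sub>v x"
    proof (rule eq_vecI)
      fix i assume "i < dim_vec (t \<cdot>\<^sub>v x)"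
      then show "(B *\<^sub>v d) $ i = (t \<cdot>\<^sub>v x) $ i"
        using *[of i] carrier_vecD[OF Bx] carrier_vecD[OF Bd] carrier_vecD[OF x(1)]
        by (simp del: index_mult_mat_vec)
    qed (use Bc x in auto)
    then have "t * (d \<bullet> x) = d \<bullet> (B *\<^sub>v d)" using d x by (simp add: scalar_prod_smult_distrib[of _ n])
    then have "0 \<le> d \<bullet> x" using psd_ge[OF B d] t by (metis zero_le_mult_iff not_less)
    moreover have "e \<bullet> e = x \<bullet> x + 2 * (d \<bullet> x) + d \<bullet> d"
      using x d comm_scalar_prod[OF d x(1)] unfolding xed
      by (simp add: add_scalar_prod_distrib[of _ n] scalar_prod_add_distrib[of _ n])
    ultimately have "x \<bullet> x \<le> e \<bullet> e" using sprod_self_nonneg[of d] by linarith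
    moreover have "(minv S * B) *\<^sub>v e = x"
      unfolding x_def z_def by (rule assoc_mult_mat_vec[OF minv_carrier[OF Sc] Bc e(1)])
    ultimately show "((minv S * B) *\<^sub>v unit_vec n k) \<bullet> ((minv S * B) *\<^sub>v unit_vec n k) \<le> 1"
      using e by (simp add: e_def)
  qed
  finally show ?thesis by (simp add: S_def)
qed

lemma minv_diff:
  assumes "S \<in> carrier_mat n n" "det S \<noteq> 0" "T \<in> carrier_mat n n" "det T \<noteq> 0"
  shows "minv S - minv T = minv S * ((T - S) * minv T)"
proof -
  note c = minv_carrier[OF assms(1)] minv_carrier[OF assms(3)] assms(1,3)
  have "minv S * ((T - S) * minv T) = minv S * (T * minv T - S * minv T)"
    using minus_mult_distrib_mat[OF assms(3,1) minv_carrier[OF assms(3)]] by simp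
  also have "\<dots> = minv S * (1\<^sub>m n - S * minv T)" using assms by (simp add: minv_right)
  also have "\<dots> = minv S * 1\<^sub>m n - minv S * (S * minv T)"
    using c by (intro mult_minus_distrib_mat[of _ n n]) auto
  also have "minv S * (S * minv T) = (minv S * S) * minv T" using c by (intro assoc_mult_mat[symmetric, of _ n n _ n _ n]) auto
  also have "\<dots> = minv T" using assms c by (simp add: minv_left[of _ n] left_mult_one_mat[of _ n n])
  finally show ?thesis using c by simp
qed

text \<open>The resolvent identity turns the difference into \<open>- t\<close> times the trace of
  \<open>(minv S D) (minv T B)\<close>. Coercivity \<open>S \<ge> t/2\<close> bounds the first
  factor and the contraction property the second; the powers of \<open>t\<close> cancel, so the
  estimate is uniform in \<open>t\<close>.\<close>

lemma mtrace_resolvent_le: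
  assumes B: "psd n B" and A: "symm n A" and t: "0 < t"
    and ge: "\<And>v. v \<in> carrier_vec n \<Longrightarrow> (v \<bullet> v) / 2 \<le> v \<bullet> (A *\<^sub>v v)"
  shows "\<bar>mtrace (B * minv (B + t \<cdot>\<^sub>m A)) - mtrace (B * minv (B + t \<cdot>\<^sub>m 1\<^sub>m n))\<bar>
    \<le> 2 * sqrt n * sqrt (fro2 (A - 1\<^sub>m n))"
proof -
  note Bc = psdD[OF B] and Ac = symmD[OF A]
  have pdA: "pd n A" unfolding pd_def using A ge sprod_self_pos by (fastforce intro: less_le_trans[of 0 "(v \<bullet> v)/2" for v])
  define S where "S = B + t \<cdot>\<^sub>m A"
  define T where "T = B + t \<cdot>\<^sub>m 1\<^sub>m n"
  have S: "pd n S" unfolding S_def using B t pdA by (intro psd_add_pd pd_smult)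
  have T: "pd n T" unfolding T_def using B t by (intro psd_add_pd pd_smult pd_one)
  note c = pdD[OF S] pdD[OF T] minv_carrier[OF pdD[OF S]] minv_carrier[OF pdD[OF T]] Bc Ac
  define D where "D = A - 1\<^sub>m n"
  have Dc: "D \<in> carrier_mat n n" unfolding D_def by (intro minus_carrier_mat one_carrier_mat)
  have SD: "minv S * D \<in> carrier_mat n n" "minv T * B \<in> carrier_mat n n" using c Dc by auto
  have ST: "T - S = (-t) \<cdot>\<^sub>m D" unfolding S_def T_def D_def using Bc Ac
    by (intro eq_matI) (auto simp: algebra_simps)
  have "mtrace (B * minv S) - mtrace (B * minv T) = mtrace (minv S * B) - mtrace (minv T * B)"
    using c by (simp add: mtrace_comm[of B n])
  also have "\<dots> = mtrace ((minv S - minv T) * B)"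
    using c by (simp add: minus_mult_distrib_mat[of _ n n] mtrace_minus[of _ n])
  also have "(minv S - minv T) * B = minv S * ((T - S) * minv T) * B"
    using c by (simp add: minv_diff[OF pdD[OF S] pd_det[OF S] pdD[OF T] pd_det[OF T]])
  also have "\<dots> = (-t) \<cdot>\<^sub>m ((minv S * D) * (minv T * B))"
    unfolding ST using c Dc
    by (simp add: assoc_mult_mat[of _ n n _ n _ n] mult_smult_assoc_mat[of _ n n _ n] mult_smult_distrib[of _ n n _ n])
  also have "mtrace \<dots> = - t * mtrace ((minv S * D) * (minv T * B))"
    using SD by (intro mtrace_smult[of _ n]) auto
  finally have "\<bar>mtrace (B * minv S) - mtrace (B * minv T)\<bar> = t * \<bar>mtrace ((minv S * D) * (minv T * B))\<bar>"
    using t by (simp add: abs_mult)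
  also have "\<dots> \<le> t * (sqrt (fro2 (minv S * D)) * sqrt (fro2 (minv T * B)))"
    using t by (intro mult_left_mono mtrace_mult_le[of _ n] SD) auto
  also have "\<dots> \<le> t * (sqrt (fro2 D / (t/2)\<^sup>2) * sqrt n)"
  proof (intro mult_left_mono mult_mono real_sqrt_le_mono)
    show "fro2 (minv S * D) \<le> fro2 D / (t/2)\<^sup>2"
    proof (rule fro2_minv_mult_le[OF S Dc])
      fix v :: "real vec" assume v: "v \<in> carrier_vec n"
      have "v \<bullet> (S *\<^sub>v v) = v \<bullet> (B *\<^sub>v v) + t * (v \<bullet> (A *\<^sub>v v))"
        unfolding S_def using Bc Ac v by (simp add: qf_add[of _ n] qf_smult[of _ n])
      moreover have "t * ((v \<bullet> v) / 2) \<le> t * (v \<bullet> (A *\<^sub>v v))" using ge[OF v] t by simp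
      ultimately show "t / 2 * (v \<bullet> v) \<le> v \<bullet> (S *\<^sub>v v)" using psd_ge[OF B v] by simp
    qed (use t in simp)
    show "fro2 (minv T * B) \<le> real n" unfolding T_def by (rule fro2_minv_shift_mult_le[OF B t])
  qed (use t fro2_nonneg in auto)
  also have "\<dots> = 2 * sqrt n * sqrt (fro2 D)" using t by (simp add: real_sqrt_divide)
  finally show ?thesis by (simp add: S_def T_def D_def)
qed

text \<open>An exact second-order expansion along a rank-one direction; the linear term makes the
  norm drop when \<open>D\<close> is sufficiently negative at \<open>u\<close>.\<close>

lemma fro2_add_outer:
  assumes D: "D \<in> carrier_mat n n" and u: "u \<in> carrier_vec n"
  shows "fro2 (D + c \<cdot>\<^sub>m outer u) = fro2 D + 2 * c * (u \<bullet> (D *\<^sub>v u)) + c\<^sup>2 * (u \<bullet> u)\<^sup>2"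
proof -
  have "fro2 (D + c \<cdot>\<^sub>m outer u) = (\<Sum>i<n. \<Sum>k<n. (D $$ (i,k) + c * (u $ i * u $ k))\<^sup>2)"
    using D u by (auto simp: fro2_def outer_def intro!: sum.cong)
  also have "\<dots> = (\<Sum>i<n. \<Sum>k<n. (D $$ (i,k))\<^sup>2) + 2 * c * (\<Sum>i<n. \<Sum>k<n. u $ i * (D $$ (i,k) * u $ k))
      + c\<^sup>2 * (\<Sum>i<n. \<Sum>k<n. (u $ i * u $ i) * (u $ k * u $ k))"
    unfolding sum_distrib_left sum.distrib[symmetric] by (intro sum.cong) (auto simp: power2_eq_square algebra_simps)
  also have "(\<Sum>i<n. \<Sum>k<n. u $ i * (D $$ (i,k) * u $ k)) = u \<bullet> (D *\<^sub>v u)"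
    using D u by (auto simp: scalar_prod_def sum_distrib_left lessThan_atLeast0 intro!: sum.cong)
  also have "(\<Sum>i<n. \<Sum>k<n. (u $ i * u $ i) * (u $ k * u $ k)) = (u \<bullet> u)\<^sup>2"
    using u unfolding scalar_prod_def power2_eq_square sum_product by (auto simp: lessThan_atLeast0)
  also have "(\<Sum>i<n. \<Sum>k<n. (D $$ (i,k))\<^sup>2) = fro2 D" using D by (simp add: fro2_def)
  finally show ?thesis .
qed

text \<open>
  As long as some unit vector \<open>u\<close> has \<open>u \<bullet> A u < 1/2\<close>, adding \<open>1/2 u u\<^sup>T\<close> to \<open>A\<close> lowers
  \<open>\<parallel>A - I\<parallel>\<^sup>2\<close> by at least 1/4 and changes the trace by at most 1. Hence after boundedly many steps
  \<open>A \<ge> 1/2\<close>, where the resolvent identity applies.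
\<close>

lemma mtrace_shift_le:
  assumes B: "psd n B" and t: "0 < t" and A: "pd n A"
  shows "\<bar>mtrace (B * minv (B + t \<cdot>\<^sub>m A)) - mtrace (B * minv (B + t \<cdot>\<^sub>m 1\<^sub>m n))\<bar>
    \<le> 4 * fro2 (A - 1\<^sub>m n) + 2 * sqrt n * sqrt (fro2 (A - 1\<^sub>m n))"
proof -
  \<comment> \<open>Induction on an integer above \<open>4 * fro2 (A - I)\<close>: every repair
    lowers this quantity by at least 1, and for \<open>k = 0\<close> the premise contradicts
    nonnegativity.\<close>
  have "4 * fro2 (A - 1\<^sub>m n) < real k \<Longrightarrow> pd n A \<Longrightarrow> ?thesis" for k
  proof (induction k arbitrary: A)
    case 0
    then show ?case using fro2_nonneg[of "A - 1\<^sub>m n"] by simp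
  next
    case (Suc k)
    note A = Suc.prems(2)
    note Ac = pdD[OF A] and Bc = psdD[OF B]
    show ?case
    proof (cases "\<forall>v\<in>carrier_vec n. (v \<bullet> v) / 2 \<le> v \<bullet> (A *\<^sub>v v)")
      case True
      then show ?thesis using mtrace_resolvent_le[OF B pd_symm[OF A] t] fro2_nonneg[of "A - 1\<^sub>m n"] by fastforce
    next
      case False
      then obtain v where v: "v \<in> carrier_vec n" "v \<bullet> (A *\<^sub>v v) < (v \<bullet> v) / 2" by force
      have "v \<noteq> 0\<^sub>v n" using v Ac by auto
      then have vp: "0 < v \<bullet> v" using sprod_self_pos[OF v(1)] by simp
      define u where "u = (1 / sqrt (v \<bullet> v)) \<cdot>\<^sub>v v"
      have u: "u \<in> carrier_vec n" using v by (simp add: u_def)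
      have uu: "u \<bullet> u = 1" using vp v by (simp add: u_def smult_scalar_prod_distrib[of _ n] scalar_prod_smult_distrib[of _ n])
      have "u \<bullet> (A *\<^sub>v u) = (v \<bullet> (A *\<^sub>v v)) / (v \<bullet> v)"
        using vp v Ac by (simp add: u_def mult_mat_vec[of _ n n] smult_scalar_prod_distrib[of _ n] scalar_prod_smult_distrib[of _ n])
      then have uAu: "u \<bullet> (A *\<^sub>v u) < 1 / 2" using vp v by (simp add: pos_divide_less_eq)
      define A1 where "A1 = A + (1/2) \<cdot>\<^sub>m outer u"
      have A1: "pd n A1" unfolding A1_def by (intro pd_add_psd A psd_smult psd_outer u) simp
      have D: "A1 - 1\<^sub>m n = (A - 1\<^sub>m n) + (1/2) \<cdot>\<^sub>m outer u"
        unfolding A1_def using Ac u by (intro eq_matI) (auto simp: outer_def)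
      have "u \<bullet> ((A - 1\<^sub>m n) *\<^sub>v u) = u \<bullet> (A *\<^sub>v u - u)"
        using Ac u by (simp add: minus_mult_distrib_mat_vec[of _ n n])
      also have "\<dots> = u \<bullet> (A *\<^sub>v u - 1 \<cdot>\<^sub>v u)" by simp
      also have "\<dots> = u \<bullet> (A *\<^sub>v u) - 1" using sprod_minus_smult[of u n "A *\<^sub>v u" u 1] u Ac uu by auto
      finally have uDu: "u \<bullet> ((A - 1\<^sub>m n) *\<^sub>v u) = u \<bullet> (A *\<^sub>v u) - 1" .
      \<comment> \<open>As |u| = 1, the change is \<open>u \<bullet> (A - I) u + 1/4\<close>, and
        \<open>u \<bullet> A u < 1/2\<close> makes it less than \<open>-1/2 + 1/4\<close>.\<close>
      have f1: "fro2 (A1 - 1\<^sub>m n) \<le> fro2 (A - 1\<^sub>m n) - 1/4"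
        unfolding D using fro2_add_outer[OF minus_carrier_mat[OF one_carrier_mat[of n]] u, of A "1/2"] uAu uu uDu by (simp add: power2_eq_square)
      have IH: "\<bar>mtrace (B * minv (B + t \<cdot>\<^sub>m A1)) - mtrace (B * minv (B + t \<cdot>\<^sub>m 1\<^sub>m n))\<bar>
        \<le> 4 * fro2 (A1 - 1\<^sub>m n) + 2 * sqrt n * sqrt (fro2 (A1 - 1\<^sub>m n))"
        using Suc.IH[OF _ A1] Suc.prems f1 by simp
      have eq: "B + t \<cdot>\<^sub>m A1 = (B + t \<cdot>\<^sub>m A) + outer (sqrt (t/2) \<cdot>\<^sub>v u)"
        unfolding A1_def outer_smult using Ac Bc u t by (intro eq_matI) (auto simp: outer_def algebra_simps)
      have M: "pd n (B + t \<cdot>\<^sub>m A)" using B A t by (intro psd_add_pd pd_smult)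
      have MB: "psd n ((B + t \<cdot>\<^sub>m A) - B)"
      proof -
        have "(B + t \<cdot>\<^sub>m A) - B = t \<cdot>\<^sub>m A" using Ac Bc by (intro eq_matI) auto
        then show ?thesis using psd_smult[OF pd_psd[OF A]] t by simp
      qed
      \<comment> \<open>This error of 1 is paid for by the decrease of the term
        \<open>4 * fro2\<close> on the right-hand side.\<close>
      have r1: "\<bar>mtrace (B * minv (B + t \<cdot>\<^sub>m A)) - mtrace (B * minv (B + t \<cdot>\<^sub>m A1))\<bar> \<le> 1"
        using mtrace_rank_one[OF M B MB, of "sqrt (t/2) \<cdot>\<^sub>v u"] u unfolding eq by auto
      have "sqrt n * sqrt (fro2 (A1 - 1\<^sub>m n)) \<le> sqrt n * sqrt (fro2 (A - 1\<^sub>m n))"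
        using f1 by (intro mult_left_mono) auto
      then show ?thesis using r1 IH f1 by (simp add: abs_le_iff)
    qed
  qed
  moreover obtain k where "4 * fro2 (A - 1\<^sub>m n) < real k" using reals_Archimedean2 by blast
  ultimately show ?thesis using A by blast
qed

section \<open>The spectrum of a definite pencil\<close>

lemma Re_mat_mult_vec:
  assumes "F \<in> carrier_mat n n" "v \<in> carrier_vec n" "i < n"
  shows "Re ((map_mat complex_of_real F *\<^sub>v v) $ i) = (F *\<^sub>v map_vec Re v) $ i"
    and "Im ((map_mat complex_of_real F *\<^sub>v v) $ i) = (F *\<^sub>v map_vec Im v) $ i"
  using assms by (auto simp: scalar_prod_def intro!: sum.cong)

text \<open>\<open>A * minv B\<close> need not be symmetric. Substituting \<open>v = B v'\<close>
  turns \<open>F v = e v\<close> into \<open>A v' = e B v'\<close>, and pairing with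
  \<open>v'\<close> exhibits \<open>e\<close> as a quotient of two real quadratic forms. The complex
  vector is handled through its real and imaginary parts \<open>a\<close> and
  \<open>b\<close>.\<close>

lemma pencil_eigenvalue_nonneg:
  assumes A: "psd n A" and B: "pd n B"
    and root: "poly (char_poly (map_mat complex_of_real (A * minv B))) e = 0"
  shows "Im e = 0" "0 \<le> Re e"
proof -
  note Ac = psdD[OF A] and Bc = pdD[OF B]
  define F where "F = A * minv B"
  have Fc: "F \<in> carrier_mat n n" using Ac Bc by (simp add: F_def)
  have "eigenvalue (map_mat complex_of_real F) e"
    using root Fc by (simp add: eigenvalue_root_char_poly[of _ n] F_def)
  then obtain v where v: "v \<in> carrier_vec n" "v \<noteq> 0\<^sub>v n" "map_mat complex_of_real F *\<^sub>v v = e \<cdot>\<^sub>v v"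
    using Fc by (auto simp: eigenvalue_def eigenvector_def)
  define a b where "a = map_vec Re v" and "b = map_vec Im v"
  have ab: "a \<in> carrier_vec n" "b \<in> carrier_vec n" using v by (auto simp: a_def b_def)
  define a' b' where "a' = minv B *\<^sub>v a" and "b' = minv B *\<^sub>v b"
  have a': "a' \<in> carrier_vec n" "B *\<^sub>v a' = a" and b': "b' \<in> carrier_vec n" "B *\<^sub>v b' = b"
    unfolding a'_def b'_def using minv_vec[OF B ab(1)] minv_vec[OF B ab(2)] by auto
  define p q where "p = Re e" and "q = Im e"
  have Fa: "F *\<^sub>v a = A *\<^sub>v a'" "F *\<^sub>v b = A *\<^sub>v b'"
    unfolding F_def a'_def b'_def using ab by (auto intro!: assoc_mult_mat_vec[OF Ac minv_carrier[OF Bc]])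
  have Aa: "A *\<^sub>v a' = p \<cdot>\<^sub>v a - q \<cdot>\<^sub>v b"
  proof (rule eq_vecI)
    fix i assume "i < dim_vec (p \<cdot>\<^sub>v a - q \<cdot>\<^sub>v b)"
    then have i: "i < n" using ab by simp
    have "(A *\<^sub>v a') $ i = Re ((e \<cdot>\<^sub>v v) $ i)"
      using Re_mat_mult_vec(1)[OF Fc v(1) i] v(3) Fa by (simp add: a_def)
    then show "(A *\<^sub>v a') $ i = (p \<cdot>\<^sub>v a - q \<cdot>\<^sub>v b) $ i"
      using i v(1) by (simp add: a_def b_def p_def q_def)
  qed (use Ac ab in auto)
  have Ab: "A *\<^sub>v b' = p \<cdot>\<^sub>v b + q \<cdot>\<^sub>v a"
  proof (rule eq_vecI)
    fix i assume "i < dim_vec (p \<cdot>\<^sub>v b + q \<cdot>\<^sub>v a)"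
    then have i: "i < n" using ab by simp
    have "(A *\<^sub>v b') $ i = Im ((e \<cdot>\<^sub>v v) $ i)"
      using Re_mat_mult_vec(2)[OF Fc v(1) i] v(3) Fa by (simp add: b_def)
    then show "(A *\<^sub>v b') $ i = (p \<cdot>\<^sub>v b + q \<cdot>\<^sub>v a) $ i"
      using i v(1) by (simp add: a_def b_def p_def q_def)
  qed (use Ac ab in auto)
  have sp: "x \<bullet> (p \<cdot>\<^sub>v a - q \<cdot>\<^sub>v b) = p * (x \<bullet> a) - q * (x \<bullet> b)"
    "x \<bullet> (p \<cdot>\<^sub>v b + q \<cdot>\<^sub>v a) = p * (x \<bullet> b) + q * (x \<bullet> a)" if "x \<in> carrier_vec n" for x
    using that ab sprod_minus_smult[of x n "p \<cdot>\<^sub>v a" b q]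
    by (simp_all add: scalar_prod_add_distrib[of _ n] scalar_prod_smult_distrib[of _ n])
  have symA: "b' \<bullet> (A *\<^sub>v a') = a' \<bullet> (A *\<^sub>v b')"
  proof -
    have "b' \<bullet> (A *\<^sub>v a') = (A *\<^sub>v b') \<bullet> a'" using symm_sprod[OF psd_symm[OF A] b'(1) a'(1)] by simp
    also have "\<dots> = a' \<bullet> (A *\<^sub>v b')" using Ac a' b' by (intro comm_scalar_prod[of _ n]) auto
    finally show ?thesis .
  qed
  have symB: "b' \<bullet> a = a' \<bullet> b"
  proof -
    have "b' \<bullet> a = (B *\<^sub>v b') \<bullet> a'" using symm_sprod[OF pd_symm[OF B] b'(1) a'(1)] a' by simp
    also have "\<dots> = a' \<bullet> b" using b' by (metis comm_scalar_prod a'(1) ab(2))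
    finally show ?thesis .
  qed
  have nz: "0 < a' \<bullet> a + b' \<bullet> b"
  proof -
    have "a' \<noteq> 0\<^sub>v n \<or> b' \<noteq> 0\<^sub>v n"
    proof (rule ccontr)
      assume "\<not> ?thesis"
      then have ab0: "a = 0\<^sub>v n" "b = 0\<^sub>v n" using a'(2) b'(2) Bc by auto
      have "v $ i = 0" if "i < n" for i
      proof -
        have "Re (v $ i) = a $ i" "Im (v $ i) = b $ i" using that v(1) by (auto simp: a_def b_def)
        then show ?thesis using ab0 that by (simp add: complex_eq_iff)
      qed
      then have "v = 0\<^sub>v n" using v(1) by auto
      then show False using v(2) by simp
    qed
    moreover have "0 \<le> a' \<bullet> a" "0 \<le> b' \<bullet> b"
      using psd_ge[OF pd_psd[OF B] a'(1)] psd_ge[OF pd_psd[OF B] b'(1)] a' b' by auto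
    moreover have "a' \<noteq> 0\<^sub>v n \<Longrightarrow> 0 < a' \<bullet> a" "b' \<noteq> 0\<^sub>v n \<Longrightarrow> 0 < b' \<bullet> b"
      using B a' b' by (auto simp: pd_def)
    ultimately show ?thesis by linarith
  qed
  \<comment> \<open>When both sides of \<open>symA\<close> are expanded by \<open>Aa\<close> and
    \<open>Ab\<close>, the terms in \<open>p\<close> cancel by \<open>symB\<close>.\<close>
  have "q * (a' \<bullet> a + b' \<bullet> b) = 0"
    using symA symB sp[OF b'(1)] sp[OF a'(1)] by (simp add: Aa Ab algebra_simps)
  then have q: "q = 0" using nz by simp
  have "p * (a' \<bullet> a + b' \<bullet> b) = a' \<bullet> (A *\<^sub>v a') + b' \<bullet> (A *\<^sub>v b')"
    using sp[OF b'(1)] sp[OF a'(1)] q by (simp add: Aa Ab algebra_simps)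
  also have "\<dots> \<ge> 0" using psd_ge[OF A a'(1)] psd_ge[OF A b'(1)] by simp
  finally have "0 \<le> p" using nz by (simp add: zero_le_mult_iff)
  with q show "Im e = 0" "0 \<le> Re e" by (auto simp: p_def q_def)
qed

text \<open>The complex characteristic polynomial splits, its roots are real by
  \<open>pencil_eigenvalue_nonneg\<close>, and comparison of values at real points brings the
  factorisation back to the reals.\<close>

lemma char_poly_pencil:
  assumes A: "psd n A" and B: "pd n B"
  obtains rs where "char_poly (A * minv B) = (\<Prod>r\<leftarrow>rs. [:- r, 1:])" "length rs = n" "\<And>r. r \<in> set rs \<Longrightarrow> 0 \<le> r"
proof -
  define F where "F = A * minv B"
  have Fc: "F \<in> carrier_mat n n" using psdD[OF A] pdD[OF B] by (simp add: F_def)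
  obtain as where as: "char_poly (map_mat complex_of_real F) = (\<Prod>a\<leftarrow>as. [:- a, 1:])" "length as = n"
    using char_poly_factorized[of "map_mat complex_of_real F" n] Fc by auto
  have real: "Im a = 0" "0 \<le> Re a" if "a \<in> set as" for a
  proof -
    have "poly (char_poly (map_mat complex_of_real F)) a = 0"
      unfolding as(1) poly_prod_list using that by (force simp: prod_list_zero_iff)
    then show "Im a = 0" "0 \<le> Re a" using pencil_eigenvalue_nonneg[OF A B, of a] by (auto simp: F_def)
  qed
  define rs where "rs = map Re as"
  have as_rs: "as = map complex_of_real rs"
    unfolding rs_def using real by (auto simp: map_idI complex_eq_iff intro!: map_idI[symmetric])
  have "poly (char_poly F) x = poly (\<Prod>r\<leftarrow>rs. [:- r, 1:]) x" for x
  proof -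
    have "complex_of_real (poly (char_poly F) x) = poly (map_poly complex_of_real (char_poly F)) (complex_of_real x)"
      by simp
    also have "map_poly complex_of_real (char_poly F) = (\<Prod>a\<leftarrow>as. [:- a, 1:])"
      using of_real_hom.char_poly_hom[OF Fc, where 'a=complex] as(1) by simp
    also have "poly \<dots> (complex_of_real x) = complex_of_real (poly (\<Prod>r\<leftarrow>rs. [:- r, 1:]) x)"
      unfolding as_rs by (induction rs) (auto simp: algebra_simps)
    finally show ?thesis by (simp only: of_real_eq_iff)
  qed
  then have "char_poly F = (\<Prod>r\<leftarrow>rs. [:- r, 1:])" by (simp add: poly_eq_poly_eq_iff[symmetric] fun_eq_iff)
  then show ?thesis using that[of rs] as(2) real by (auto simp: F_def rs_def)
qed

lemma eig_mset_linear_factors: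
  assumes "char_poly F = (\<Prod>r\<leftarrow>rs. [:- r, 1:])"
  shows "eig_mset F = mset rs"
proof (rule multiset_eqI)
  fix x
  let ?p = "char_poly F"
  have p0: "?p \<noteq> 0" unfolding assms by (auto simp: prod_list_zero_iff)
  have fin: "finite {r. poly ?p r = 0}" by (rule poly_roots_finite[OF p0])
  have "count (eig_mset F) x = (\<Sum>r\<in>{r. poly ?p r = 0}. if r = x then Polynomial.order r ?p else 0)"
    unfolding eig_mset_def count_sum by (intro sum.cong) auto
  also have "\<dots> = Polynomial.order x ?p"
    using fin p0 by (auto simp: order_root)
  also have "\<dots> = count (mset rs) x"
    unfolding assms by (subst order_prod_list, force, induction rs) (auto simp: order_linear')
  finally show "count (eig_mset F) x = count (mset rs) x" .
qed

text \<open>Column by column from the left, all entries of \<open>V\<close> below the diagonal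
  vanish; then the \<open>(j,j)\<close> entry of \<open>V * T\<close> is a single product.\<close>

lemma upper_triangular_inverse_diag:
  assumes T: "(T::real mat) \<in> carrier_mat n n" and V: "V \<in> carrier_mat n n"
    and VT: "V * T = 1\<^sub>m n" and ut: "upper_triangular T" and nz: "\<And>i. i < n \<Longrightarrow> T $$ (i,i) \<noteq> 0"
    and j: "j < n"
  shows "V $$ (j,j) = 1 / T $$ (j,j)"
proof -
  have "i < n \<Longrightarrow> j < n \<Longrightarrow> j \<le> i \<Longrightarrow> V $$ (i,j) = (if i = j then 1 / T $$ (j,j) else 0)" for i j
  proof (induction j arbitrary: i rule: less_induct)
    case (less j)
    have "(V * T) $$ (i,j) = (\<Sum>k<n. V $$ (i,k) * T $$ (k,j))"
      using T V less.prems by (simp add: scalar_prod_def lessThan_atLeast0)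
    also have "\<dots> = (\<Sum>k\<in>{j}. V $$ (i,k) * T $$ (k,j))"
    proof (rule sum.mono_neutral_right)
      show "\<forall>k\<in>{..<n} - {j}. V $$ (i,k) * T $$ (k,j) = 0"
      proof
        fix k assume k: "k \<in> {..<n} - {j}"
        show "V $$ (i,k) * T $$ (k,j) = 0"
        proof (cases "k < j")
          case True
          then show ?thesis using less.IH[of k i] less.prems k by auto
        next
          case False
          then show ?thesis using k ut T less.prems by (auto simp: upper_triangular_def)
        qed
      qed
    qed (use less.prems in auto)
    finally have "V $$ (i,j) * T $$ (j,j) = (if i = j then 1 else 0)"
      using VT less.prems by simp
    then show ?case using nz[of j] less.prems by (auto simp: field_simps split: if_splits)
  qed
  from this[OF j j] show ?thesis by simp
qed

text \<open>Schur's triangular form suffices, no diagonalisation is involved: conjugation carries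
  \<open>G\<close> to a left inverse of the triangular matrix \<open>1 + t U\<close>, whose diagonal
  entries are the numbers \<open>1 + t r\<close>, and preserves the trace.\<close>

lemma mtrace_inverse_eigenvalues:
  assumes F: "F \<in> carrier_mat n n" and cp: "char_poly F = (\<Prod>r\<leftarrow>rs. [:- r, 1:])"
    and pos: "\<And>r. r \<in> set rs \<Longrightarrow> 0 \<le> r" and t: "0 < t"
    and G: "G \<in> carrier_mat n n" "G * (1\<^sub>m n + t \<cdot>\<^sub>m F) = 1\<^sub>m n"
  shows "mtrace G = (\<Sum>r\<leftarrow>rs. 1 / (1 + t * r))"
proof -
  obtain U P Q where dec: "schur_decomposition F rs = (U, P, Q)" by (metis prod_cases3)
  from schur_decomposition[OF F cp dec]
  have sim: "similar_mat_wit F U P Q" and ut: "upper_triangular U" and dg: "diag_mat U = rs" by auto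
  from similar_mat_witD2[OF F sim] have PQ: "P * Q = 1\<^sub>m n" "Q * P = 1\<^sub>m n" "F = P * U * Q"
    and c: "U \<in> carrier_mat n n" "P \<in> carrier_mat n n" "Q \<in> carrier_mat n n" by auto
  note am = assoc_mult_mat[of _ n n _ n _ n]
  define V where "V = Q * G * P"
  define T where "T = 1\<^sub>m n + t \<cdot>\<^sub>m U"
  have Vc: "V \<in> carrier_mat n n" "T \<in> carrier_mat n n" using c G by (auto simp: V_def T_def)
  have QFP: "Q * F * P = U"
  proof -
    have "Q * F * P = (Q * P) * U * (Q * P)" unfolding PQ(3) using c by (simp add: am)
    then show ?thesis using c PQ by simp
  qed
  have T: "T = Q * (1\<^sub>m n + t \<cdot>\<^sub>m F) * P"
  proof -
    have "Q * (1\<^sub>m n + t \<cdot>\<^sub>m F) * P = (Q * 1\<^sub>m n + Q * (t \<cdot>\<^sub>m F)) * P"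
      using c F by (simp add: mult_add_distrib_mat[of _ n n _ n])
    also have "\<dots> = Q * P + t \<cdot>\<^sub>m (Q * F) * P"
      using c F by (simp add: add_mult_distrib_mat[of _ n n _ _ n] mult_smult_distrib[of _ n n _ n])
    also have "\<dots> = 1\<^sub>m n + t \<cdot>\<^sub>m (Q * F * P)"
      using c F PQ by (simp add: mult_smult_assoc_mat[of _ n n _ n])
    finally show ?thesis unfolding QFP T_def by simp
  qed
  have VT: "V * T = 1\<^sub>m n"
  proof -
    let ?R = "1\<^sub>m n + t \<cdot>\<^sub>m F"
    have R: "?R \<in> carrier_mat n n" using F by simp
    have "V * T = Q * (G * ((P * Q) * (?R * P)))" unfolding V_def T using c G R by (simp add: am)
    also have "\<dots> = Q * (G * (?R * P))" using PQ c R by simp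
    also have "\<dots> = Q * ((G * ?R) * P)" using c G(1) R by (simp add: am)
    also have "\<dots> = 1\<^sub>m n" using G c PQ by simp
    finally show ?thesis .
  qed
  have Ud: "i < n \<Longrightarrow> U $$ (i,i) \<in> set rs" for i using dg c by (auto simp: diag_mat_def)
  have "mtrace G = mtrace V"
  proof -
    have "mtrace V = mtrace (P * (Q * G))" unfolding V_def using c G by (intro mtrace_comm[of _ n]) auto
    also have "P * (Q * G) = (P * Q) * G" using c G by (simp add: am)
    also have "\<dots> = G" using G PQ by simp
    finally show ?thesis by simp
  qed
  also have "\<dots> = (\<Sum>i<n. 1 / (1 + t * U $$ (i,i)))"
  proof -
    have "V $$ (i,i) = 1 / (1 + t * U $$ (i,i))" if i: "i < n" for i
    proof -
      have Tii: "T $$ (k,k) = 1 + t * U $$ (k,k)" if "k < n" for k using that c by (simp add: T_def)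
      have "V $$ (i,i) = 1 / T $$ (i,i)"
      proof (rule upper_triangular_inverse_diag[OF Vc(2,1) VT _ _ i])
        show "upper_triangular T" using ut c by (auto simp: upper_triangular_def T_def)
        fix k assume k: "k < n"
        have "0 \<le> t * U $$ (k,k)" using pos[OF Ud[OF k]] t by simp
        then show "T $$ (k,k) \<noteq> 0" using Tii[OF k] by linarith
      qed
      then show ?thesis using Tii[OF i] by simp
    qed
    then show ?thesis using Vc by (simp add: mtrace_def)
  qed
  also have "\<dots> = (\<Sum>r\<leftarrow>rs. 1 / (1 + t * r))"
    using c by (simp add: dg[symmetric] diag_mat_def sum_list_sum_nth comp_def lessThan_atLeast0)
  finally show ?thesis .
qed

text \<open>The bridge from eigenvalues to resolvents. Since
  \<open>1 + t F = (B + t A) minv B\<close>, the matrix \<open>B minv (B + t A)\<close> is a left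
  inverse of it, and its trace is the sum over the spectrum.\<close>

lemma eigs_pencil:
  assumes A: "psd n A" and B: "pd n B"
  shows "length (eigs_sorted (A * minv B)) = n"
    and "\<And>i. i < n \<Longrightarrow> 0 \<le> eigs_sorted (A * minv B) ! i"
    and "0 < t \<Longrightarrow> (\<Sum>i<n. 1 / (1 + t * eigs_sorted (A * minv B) ! i)) = mtrace (B * minv (B + t \<cdot>\<^sub>m A))"
proof -
  define F where "F = A * minv B"
  note Ac = psdD[OF A] and Bc = pdD[OF B]
  have Fc: "F \<in> carrier_mat n n" using Ac Bc by (simp add: F_def)
  obtain rs where rs: "char_poly F = (\<Prod>r\<leftarrow>rs. [:- r, 1:])" "length rs = n" "\<And>r. r \<in> set rs \<Longrightarrow> 0 \<le> r"
    using char_poly_pencil[OF A B] unfolding F_def by blast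
  have ms: "mset (eigs_sorted F) = mset rs"
    unfolding eigs_sorted_def eig_mset_linear_factors[OF rs(1)] by simp
  from ms have len: "length (eigs_sorted F) = n" using rs(2) by (metis size_mset)
  then show "length (eigs_sorted (A * minv B)) = n" by (simp add: F_def)
  show "0 \<le> eigs_sorted (A * minv B) ! i" if "i < n" for i
    using that len rs(3) ms by (metis F_def nth_mem set_mset_mset)
  show "(\<Sum>i<n. 1 / (1 + t * eigs_sorted (A * minv B) ! i)) = mtrace (B * minv (B + t \<cdot>\<^sub>m A))" if t: "0 < t"
  proof -
    have S: "pd n (B + t \<cdot>\<^sub>m A)" using A B t by (intro pd_add_psd psd_smult) auto
    note Sc = pdD[OF S]
    define G where "G = B * minv (B + t \<cdot>\<^sub>m A)"
    have Gc: "G \<in> carrier_mat n n" using Bc Sc by (simp add: G_def)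
    have "1\<^sub>m n + t \<cdot>\<^sub>m F = (B + t \<cdot>\<^sub>m A) * minv B"
      using Ac Bc minv_right[OF Bc pd_det[OF B]]
      by (simp add: F_def add_mult_distrib_mat[of _ n n _ _ n] mult_smult_assoc_mat[of _ n n _ n])
    then have "G * (1\<^sub>m n + t \<cdot>\<^sub>m F) = B * ((minv (B + t \<cdot>\<^sub>m A) * (B + t \<cdot>\<^sub>m A)) * minv B)"
      unfolding G_def using Bc Sc by (simp add: assoc_mult_mat[of _ n n _ n _ n])
    also have "\<dots> = 1\<^sub>m n"
      using Bc Sc minv_left[OF Sc pd_det[OF S]] minv_right[OF Bc pd_det[OF B]] by (simp add: left_mult_one_mat[of _ n n])
    finally have "mtrace G = (\<Sum>r\<leftarrow>rs. 1 / (1 + t * r))"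
      by (intro mtrace_inverse_eigenvalues[OF Fc rs(1,3) t Gc]) auto
    also have "\<dots> = sum_mset (image_mset (\<lambda>r. 1 / (1 + t * r)) (mset rs))" by (simp flip: sum_mset_sum_list)
    also have "\<dots> = (\<Sum>r\<leftarrow>eigs_sorted F. 1 / (1 + t * r))" unfolding ms[symmetric] by (simp flip: sum_mset_sum_list)
    also have "\<dots> = (\<Sum>i<n. 1 / (1 + t * eigs_sorted F ! i))"
      using len by (simp add: sum_list_sum_nth lessThan_atLeast0)
    finally show ?thesis by (simp add: G_def F_def)
  qed
qed

section \<open>The Stieltjes-type transform of the limit law\<close>

text \<open>The smaller root of \<open>y H^2 - (t + y + 1) H + 1 = 0\<close>, the branch that tends
  to 1 as \<open>t\<close> tends to 0 for \<open>0 < y \<le> 1\<close>.\<close>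

definition H_lim :: "real \<Rightarrow> real \<Rightarrow> real" where
  "H_lim y t = ((t + y + 1) - sqrt ((t + y + 1)\<^sup>2 - 4 * y)) / (2 * y)"

text \<open>In terms of \<open>r = sqrt (1/y)\<close> the two numbers are \<open>2 (r - 1)^2\<close>
  and \<open>2 (r + 1)^2\<close>. Sum and product are recorded because the value of the transform
  depends on the endpoints through them only.\<close>

lemma s1_s2_props:
  assumes "0 < y" "y \<le> 1"
  shows "s1 y * s2 y = 4 * (1 / y - 1)\<^sup>2" "s1 y + s2 y = 4 * (1 / y + 1)" "0 \<le> s1 y" "s1 y < s2 y" "0 < s2 y"
proof -
  define r where "r = sqrt (1 / y)"
  have r: "r\<^sup>2 = 1 / y" "1 \<le> r" using assms by (auto simp: r_def field_simps)
  have s1: "s1 y = 2 * (r - 1)\<^sup>2" and s2: "s2 y = 2 * (r + 1)\<^sup>2"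
    using r by (auto simp: s1_def s2_def r_def[symmetric] power2_eq_square algebra_simps)
  show "s1 y * s2 y = 4 * (1 / y - 1)\<^sup>2" unfolding s1 s2 r(1)[symmetric] by (simp add: power2_eq_square algebra_simps)
  show "s1 y + s2 y = 4 * (1 / y + 1)" unfolding s1 s2 r(1)[symmetric] by (simp add: power2_eq_square algebra_simps)
  show "0 \<le> s1 y" unfolding s1 by simp
  show "s1 y < s2 y" "0 < s2 y" using r(2) by (auto simp: s1_def s2_def r_def[symmetric] intro!: add_pos_pos) (use assms in auto)
qed

text \<open>
  The substitution \<open>v = 1/x\<close> turns the integrand into \<open>sqrt ((b - v) (v - a)) / (v + c)\<close>, which is rational in
  \<open>q = sqrt ((v - a) / (b - v))\<close>.
\<close>

definition mp_prim :: "real \<Rightarrow> real \<Rightarrow> real \<Rightarrow> real \<Rightarrow> real" where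
  "mp_prim a b c x =
     (let q = sqrt ((1 - a * x) / (b * x - 1))
      in - (sqrt ((b * x - 1) * (1 - a * x)) / x + (a + b + 2 * c) * arctan q
         - 2 * sqrt ((a + c) * (b + c)) * arctan (q * sqrt ((b + c) / (a + c)))) / (4 * pi))"

text \<open>The derivative is the limit density with \<open>a = s1 y\<close>,
  \<open>b = s2 y\<close> times the transform kernel at \<open>c = 2 t / y\<close>. The strict
  inequalities keep both square roots differentiable.\<close>

lemma mp_prim_deriv:
  assumes "0 \<le> a" "a < b" "0 < c" "1 < b * x" "a * x < 1" "0 < x"
  shows "(mp_prim a b c has_real_derivative
     1 / (4 * pi) * sqrt ((b * x - 1) * (1 - a * x)) / x\<^sup>2 * (1 / (1 + c * x))) (at x)"
proof -
  \<comment> \<open>\<open>p\<close> and \<open>q\<close> turn the identities below into rational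
    ones, with \<open>p^2\<close> and \<open>q^2\<close> linear in \<open>x\<close>. The ratio
    \<open>q / p\<close> is the \<open>q\<close> of \<open>mp_prim\<close>.\<close>
  define p q r where "p = sqrt (b * x - 1)" and "q = sqrt (1 - a * x)" and "r = sqrt ((b + c) / (a + c))"
  have p: "p > 0" "p\<^sup>2 = b * x - 1" using assms by (auto simp: p_def)
  have q: "q > 0" "q\<^sup>2 = 1 - a * x" using assms by (auto simp: q_def)
  have r: "r > 0" "r\<^sup>2 = (b + c) / (a + c)" using assms by (auto simp: r_def)
  have rK: "sqrt ((a + c) * (b + c)) = (a + c) * r"
  proof (rule real_sqrt_unique)
    show "((a + c) * r)\<^sup>2 = (a + c) * (b + c)"
      using assms unfolding power_mult_distrib r(2) by (simp add: power2_eq_square)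
  qed (use assms r in auto)
  have dp: "((\<lambda>x. sqrt (b * x - 1)) has_real_derivative b / (2 * p)) (at x)"
    using assms unfolding p_def by (auto intro!: derivative_eq_intros simp: field_simps)
  have dq: "((\<lambda>x. sqrt (1 - a * x)) has_real_derivative - a / (2 * q)) (at x)"
    using assms unfolding q_def by (auto intro!: derivative_eq_intros simp: field_simps)
  have eq: "mp_prim a b c x = - (sqrt (b * x - 1) * sqrt (1 - a * x) / x + (a + b + 2 * c) * arctan (sqrt (1 - a * x) / sqrt (b * x - 1))
         - 2 * ((a + c) * r) * arctan (sqrt (1 - a * x) / sqrt (b * x - 1) * r)) / (4 * pi)" for x
    unfolding mp_prim_def Let_def rK by (simp add: real_sqrt_mult real_sqrt_divide r_def)
  define D where "D = - (b - a) / (2 * q * p ^ 3)"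
  have dqp: "((\<lambda>x. sqrt (1 - a * x) / sqrt (b * x - 1)) has_real_derivative D) (at x)"
  proof -
    have "((\<lambda>x. sqrt (1 - a * x) / sqrt (b * x - 1)) has_real_derivative (- a / (2 * q) * p - q * (b / (2 * p))) / (p * p)) (at x)"
      using DERIV_divide[OF dq dp] p q by (simp add: p_def[symmetric] q_def[symmetric])
    moreover have "(- a / (2 * q) * p - q * (b / (2 * p))) / (p * p) = - (a * p\<^sup>2 + b * q\<^sup>2) / (2 * q * p ^ 3)"
      using p(1) q(1) by (simp add: field_simps power2_eq_square power3_eq_cube)
    moreover have "a * p\<^sup>2 + b * q\<^sup>2 = b - a" unfolding p(2) q(2) by (simp add: algebra_simps)
    ultimately show ?thesis by (simp add: D_def)
  qed
  have d1: "((\<lambda>x. arctan (sqrt (1 - a * x) / sqrt (b * x - 1))) has_real_derivative - 1 / (2 * p * q * x)) (at x)"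
  proof -
    have "((\<lambda>x. arctan (sqrt (1 - a * x) / sqrt (b * x - 1))) has_real_derivative inverse (1 + (q / p)\<^sup>2) * D) (at x)"
      using DERIV_chain2[OF DERIV_arctan dqp] by (simp add: p_def q_def)
    moreover have "1 + (q / p)\<^sup>2 = (b - a) * x / p\<^sup>2"
    proof -
      have "1 + (q / p)\<^sup>2 = (p\<^sup>2 + q\<^sup>2) / p\<^sup>2" using p(1) by (simp add: field_simps power2_eq_square)
      also have "p\<^sup>2 + q\<^sup>2 = (b - a) * x" unfolding p(2) q(2) by (simp add: algebra_simps)
      finally show ?thesis .
    qed
    moreover have "inverse ((b - a) * x / p\<^sup>2) * D = - 1 / (2 * p * q * x)"
    proof -
      define w where "w = b - a"
      have "w > 0" using assms by (simp add: w_def)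
      then show ?thesis using assms p(1) q(1) unfolding D_def w_def[symmetric] by (simp add: field_simps power2_eq_square power3_eq_cube)
    qed
    ultimately show ?thesis by simp
  qed
  have d2: "((\<lambda>x. arctan (sqrt (1 - a * x) / sqrt (b * x - 1) * r)) has_real_derivative - r * (a + c) / (2 * p * q * (1 + c * x))) (at x)"
  proof -
    have "((\<lambda>x. arctan (sqrt (1 - a * x) / sqrt (b * x - 1) * r)) has_real_derivative inverse (1 + (q / p * r)\<^sup>2) * (D * r)) (at x)"
      using DERIV_chain2[OF DERIV_arctan DERIV_cmult_right[OF dqp, of r]] by (simp add: p_def q_def)
    moreover have "1 + (q / p * r)\<^sup>2 = (b - a) * (1 + c * x) / ((a + c) * p\<^sup>2)"
    proof -
      have "1 + (q / p * r)\<^sup>2 = 1 + q\<^sup>2 * r\<^sup>2 / p\<^sup>2" by (simp add: power_mult_distrib power_divide)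
      also have "\<dots> = (p\<^sup>2 * (a + c) + q\<^sup>2 * (b + c)) / ((a + c) * p\<^sup>2)"
      proof -
        define z w where "z = a + c" and "w = b + c"
        have "z > 0" using assms by (simp add: z_def)
        then show ?thesis using p(1) unfolding r(2) z_def[symmetric] w_def[symmetric] by (simp add: field_simps)
      qed
      also have "p\<^sup>2 * (a + c) + q\<^sup>2 * (b + c) = (b - a) * (1 + c * x)" unfolding p(2) q(2) by (simp add: algebra_simps)
      finally show ?thesis .
    qed
    moreover have "inverse ((b - a) * (1 + c * x) / ((a + c) * p\<^sup>2)) * (D * r) = - r * (a + c) / (2 * p * q * (1 + c * x))"
    proof -
      define w u z where "w = b - a" and "u = 1 + c * x" and "z = a + c"
      have "w > 0" "u > 0" "z > 0" using assms by (auto simp: w_def u_def z_def add_pos_nonneg)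
      then show ?thesis using p(1) q(1) unfolding D_def w_def[symmetric] u_def[symmetric] z_def[symmetric]
        by (simp add: field_simps power2_eq_square power3_eq_cube)
    qed
    ultimately show ?thesis by simp
  qed
  have d3: "((\<lambda>x. sqrt (b * x - 1) * sqrt (1 - a * x) / x) has_real_derivative (b * q\<^sup>2 - a * p\<^sup>2) / (2 * p * q * x) - p * q / x\<^sup>2) (at x)"
  proof -
    have "((\<lambda>x. sqrt (b * x - 1) * sqrt (1 - a * x) / x) has_real_derivative
       ((b / (2 * p) * q + - a / (2 * q) * p) * x - p * q * 1) / (x * x)) (at x)"
      using DERIV_divide[OF DERIV_mult[OF dp dq] DERIV_ident] assms by (simp add: p_def q_def)
    moreover have "((b / (2 * p) * q + - a / (2 * q) * p) * x - p * q * 1) / (x * x) = (b * q\<^sup>2 - a * p\<^sup>2) / (2 * p * q * x) - p * q / x\<^sup>2"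
      using p(1) q(1) assms by (simp add: field_simps power2_eq_square)
    ultimately show ?thesis by simp
  qed
  define E where "E = ((b * q\<^sup>2 - a * p\<^sup>2) / (2 * p * q * x) - p * q / x\<^sup>2) + (a + b + 2 * c) * (- 1 / (2 * p * q * x))
     - 2 * ((a + c) * r) * (- r * (a + c) / (2 * p * q * (1 + c * x)))"
  have "(mp_prim a b c has_real_derivative - E / (4 * pi)) (at x)"
    unfolding eq[abs_def] E_def
    by (intro DERIV_cdivide DERIV_minus DERIV_diff DERIV_add DERIV_cmult d1 d2 d3)
  moreover have "E = - (p * q / (x\<^sup>2 * (1 + c * x)))"
  proof -
    define u where "u = 1 + c * x"
    have u: "u > 0" using assms by (simp add: u_def add_pos_pos)
    have 1: "(b * q\<^sup>2 - a * p\<^sup>2) - (a + b + 2 * c) = - 2 * (a * b * x + c)" unfolding p(2) q(2) by (simp add: algebra_simps)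
    have 2: "(a + c) * r * r * (a + c) = (a + c) * (b + c)"
    proof -
      have "(a + c) * r * r * (a + c) = (a + c) * ((a + c) * r\<^sup>2)" by (simp add: power2_eq_square)
      also have "(a + c) * r\<^sup>2 = b + c" unfolding r(2) using assms by simp
      finally show ?thesis by simp
    qed
    have "E = ((b * q\<^sup>2 - a * p\<^sup>2) - (a + b + 2 * c)) / (2 * p * q * x) - p * q / x\<^sup>2 + ((a + c) * r * r * (a + c)) / (p * q * u)"
      unfolding E_def u_def[symmetric] using p(1) q(1) assms u by (simp add: field_simps)
    also have "\<dots> = - (a * b * x + c) / (p * q * x) - p * q / x\<^sup>2 + (a + c) * (b + c) / (p * q * u)"
      unfolding 1 2 using p(1) q(1) assms by (simp add: divide_simps)
    \<comment> \<open>Over the common denominator the numerator collapses to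
      \<open>- (p q)^2\<close> once \<open>p^2\<close>, \<open>q^2\<close> and \<open>u\<close> are
      expanded.\<close>
    also have "\<dots> = (- (a * b * x + c) * x * u - (p\<^sup>2 * q\<^sup>2) * u + (a + c) * (b + c) * x\<^sup>2) / (p * q * x\<^sup>2 * u)"
      using p(1) q(1) assms u by (simp add: field_simps power2_eq_square)
    also have "- (a * b * x + c) * x * u - (p\<^sup>2 * q\<^sup>2) * u + (a + c) * (b + c) * x\<^sup>2 = - (p\<^sup>2 * q\<^sup>2)"
      unfolding p(2) q(2) u_def by (simp add: algebra_simps power2_eq_square)
    also have "- (p\<^sup>2 * q\<^sup>2) / (p * q * x\<^sup>2 * u) = - (p * q / (x\<^sup>2 * u))"
      using p(1) q(1) assms u by (simp add: field_simps power2_eq_square)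
    finally show ?thesis by (simp add: u_def)
  qed
  moreover have "sqrt ((b * x - 1) * (1 - a * x)) = p * q" by (simp add: p_def q_def real_sqrt_mult)
  ultimately show ?thesis by (simp add: mult_ac)
qed

text \<open>At \<open>x = 1/b\<close> the square root term vanishes and \<open>q\<close> tends to
  infinity, so both arctangents tend to \<open>pi/2\<close>; their coefficients give the algebraic
  value.\<close>

lemma mp_prim_at_left_end:
  assumes "0 \<le> a" "a < b" "0 < c"
  shows "(mp_prim a b c \<longlongrightarrow> - ((a + b) / 2 + c - sqrt ((a + c) * (b + c))) / 4) (at_right (1 / b))"
proof -
  have b: "b > 0" using assms by simp
  have r: "sqrt ((b + c) / (a + c)) > 0" using assms by simp
  have gt: "eventually (\<lambda>x. 0 < b * x - 1) (at_right (1 / b))"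
    using eventually_at_right_less[of "1 / b"] by eventually_elim (use b in \<open>simp add: field_simps\<close>)
  have "LIM x at_right (1 / b). (1 - a * x) / (b * x - 1) :> at_top"
  proof (rule LIM_at_top_divide[OF _ _ _ gt])
    show "((\<lambda>x. 1 - a * x) \<longlongrightarrow> 1 - a * (1 / b)) (at_right (1 / b))" by (intro tendsto_intros)
    show "0 < 1 - a * (1 / b)" using assms b by (simp add: field_simps)
    have "((\<lambda>x. b * x - 1) \<longlongrightarrow> b * (1 / b) - 1) (at_right (1 / b))" by (intro tendsto_intros)
    then show "((\<lambda>x. b * x - 1) \<longlongrightarrow> 0) (at_right (1 / b))" using b by simp
  qed
  then have Q: "LIM x at_right (1 / b). sqrt ((1 - a * x) / (b * x - 1)) :> at_top"
    by (rule filterlim_compose[OF sqrt_at_top])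
  have Qr: "LIM x at_right (1 / b). sqrt ((1 - a * x) / (b * x - 1)) * sqrt ((b + c) / (a + c)) :> at_top"
    by (rule filterlim_at_top_mult_tendsto_pos[OF tendsto_const r Q])
  have "((\<lambda>x. - (sqrt ((b * x - 1) * (1 - a * x)) / x + (a + b + 2 * c) * arctan (sqrt ((1 - a * x) / (b * x - 1)))
         - 2 * sqrt ((a + c) * (b + c)) * arctan (sqrt ((1 - a * x) / (b * x - 1)) * sqrt ((b + c) / (a + c)))) / (4 * pi)) \<longlongrightarrow>
     - (sqrt ((b * (1 / b) - 1) * (1 - a * (1 / b))) / (1 / b) + (a + b + 2 * c) * (pi / 2) - 2 * sqrt ((a + c) * (b + c)) * (pi / 2)) / (4 * pi)) (at_right (1 / b))"
    by (intro tendsto_intros filterlim_compose[OF tendsto_arctan_at_top] Q Qr) (use b in auto)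
  note T = this
  have e: "- (sqrt ((b * (1 / b) - 1) * (1 - a * (1 / b))) / (1 / b) + (a + b + 2 * c) * (pi / 2) - 2 * sqrt ((a + c) * (b + c)) * (pi / 2)) / (4 * pi)
    = - ((a + b) / 2 + c - sqrt ((a + c) * (b + c))) / 4"
    using b by (simp add: field_simps)
  show ?thesis unfolding mp_prim_def[abs_def] Let_def e[symmetric] by (rule T)
qed

text \<open>Here \<open>q\<close> tends to 0 and every term vanishes.\<close>

lemma mp_prim_at_right_end_pos:
  assumes "0 < a" "a < b" "0 < c"
  shows "(mp_prim a b c \<longlongrightarrow> 0) (at_left (1 / a))"
proof -
  have ba: "b * (1 / a) - 1 \<noteq> 0" using assms by (simp add: field_simps)
  have "((\<lambda>x. - (sqrt ((b * x - 1) * (1 - a * x)) / x + (a + b + 2 * c) * arctan (sqrt ((1 - a * x) / (b * x - 1)))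
         - 2 * sqrt ((a + c) * (b + c)) * arctan (sqrt ((1 - a * x) / (b * x - 1)) * sqrt ((b + c) / (a + c)))) / (4 * pi)) \<longlongrightarrow>
    - (sqrt ((b * (1/a) - 1) * (1 - a * (1/a))) / (1/a) + (a + b + 2 * c) * arctan (sqrt ((1 - a * (1/a)) / (b * (1/a) - 1)))
         - 2 * sqrt ((a + c) * (b + c)) * arctan (sqrt ((1 - a * (1/a)) / (b * (1/a) - 1)) * sqrt ((b + c) / (a + c)))) / (4 * pi)) (at_left (1 / a))"
    by (intro tendsto_intros ba) (use assms in auto)
  then show ?thesis using assms unfolding mp_prim_def[abs_def] Let_def by simp
qed

text \<open>This is the case \<open>y = 1\<close>, in which \<open>s1 y = 0\<close> and the support
  reaches to infinity.\<close>

lemma mp_prim_at_right_end_zero: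
  assumes "0 < b" "0 < c"
  shows "(mp_prim 0 b c \<longlongrightarrow> 0) at_top"
proof -
  have 1: "((\<lambda>x. sqrt ((b * x - 1) * (1 - 0 * x)) / x) \<longlongrightarrow> 0) at_top" using assms by simp real_asymp
  have 2: "((\<lambda>x. sqrt ((1 - 0 * x) / (b * x - 1))) \<longlongrightarrow> 0) at_top" using assms by simp real_asymp
  have "((\<lambda>x. - (sqrt ((b * x - 1) * (1 - 0 * x)) / x + (0 + b + 2 * c) * arctan (sqrt ((1 - 0 * x) / (b * x - 1)))
         - 2 * sqrt ((0 + c) * (b + c)) * arctan (sqrt ((1 - 0 * x) / (b * x - 1)) * sqrt ((b + c) / (0 + c)))) / (4 * pi)) \<longlongrightarrow>
    - (0 + (0 + b + 2 * c) * arctan 0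
         - 2 * sqrt ((0 + c) * (b + c)) * arctan (0 * sqrt ((b + c) / (0 + c)))) / (4 * pi)) at_top"
    by (intro tendsto_intros 1 2) auto
  then show ?thesis unfolding mp_prim_def[abs_def] Let_def by simp
qed

text \<open>The kernel \<open>1 / (1 + t l)\<close> is taken at the eigenvalue
  \<open>l = 2 x / y\<close> that belongs to \<open>x\<close>. The fundamental theorem of calculus
  for nonnegative integrands yields integrability together with the value.\<close>

lemma f_dens_transform:
  assumes y: "0 < y" "y \<le> 1" and t: "0 < t"
  shows "integrable lborel (\<lambda>x. f_dens y x * (1 / (1 + t * (2 * x / y))))" (is ?I)
    and "(\<integral>x. f_dens y x * (1 / (1 + t * (2 * x / y))) \<partial>lborel) = H_lim y t" (is ?E)
proof -
  define a b c where "a = s1 y" and "b = s2 y" and "c = 2 * t / y"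
  have ab: "0 \<le> a" "a < b" "0 < b" "0 < c" "a * b = 4 * (1 / y - 1)\<^sup>2" "a + b = 4 * (1 / y + 1)"
    using s1_s2_props[OF y] y t by (auto simp: a_def b_def c_def)
  \<comment> \<open>Extended endpoints treat bounded support and the case \<open>s1 y = 0\<close> at
    once.\<close>
  define A B :: ereal where "A = ereal (1 / b)" and "B = (if a = 0 then \<infinity> else ereal (1 / a))"
  have AB: "A < B" using ab by (auto simp: A_def B_def intro!: divide_strict_left_mono mult_pos_pos)
  define h where "h x = 1 / (4 * pi) * sqrt ((b * x - 1) * (1 - a * x)) / x\<^sup>2 * (1 / (1 + c * x))" for x
  have mem: "(A < ereal x \<and> ereal x < B) \<longleftrightarrow> 1 < b * x \<and> a * x < 1" for x
  proof -
    have "A < ereal x \<longleftrightarrow> 1 < b * x" using ab by (simp add: A_def pos_divide_less_eq mult.commute)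
    moreover have "ereal x < B \<longleftrightarrow> a * x < 1"
      using ab by (cases "a = 0") (simp_all add: B_def pos_less_divide_eq mult.commute)
    ultimately show ?thesis by simp
  qed
  have xpos: "0 < x" if "1 < b * x" for x
    using that ab by (intro zero_less_mult_pos[of b x]) auto
  have h_cont: "DERIV (mp_prim a b c) x :> h x" "isCont h x" "0 \<le> h x" if "A < ereal x" "ereal x < B" for x
  proof -
    have x: "1 < b * x" "a * x < 1" using mem that by blast+
    note x0 = xpos[OF x(1)]
    show "DERIV (mp_prim a b c) x :> h x" unfolding h_def
      using mp_prim_deriv[OF ab(1,2,4) x x0] .
    have "1 + c * x \<noteq> 0" using mult_pos_pos[OF ab(4) x0] by linarith
    then show "isCont h x" unfolding h_def using x0 by (intro continuous_intros) auto
    show "0 \<le> h x" using x x0 ab by (simp add: h_def)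
  qed
  have h_nonneg: "AE x in lborel. A < ereal x \<longrightarrow> ereal x < B \<longrightarrow> 0 \<le> h x"
    using h_cont(3) by (intro AE_I2) blast
  have lA: "((mp_prim a b c \<circ> real_of_ereal) \<longlongrightarrow> - ((a + b) / 2 + c - sqrt ((a + c) * (b + c))) / 4) (at_right A)"
    unfolding A_def ereal_tendsto_simps1 by (rule mp_prim_at_left_end[OF ab(1,2,4)])
  have lB: "((mp_prim a b c \<circ> real_of_ereal) \<longlongrightarrow> 0) (at_left B)"
    using mp_prim_at_right_end_pos[of a b c] mp_prim_at_right_end_zero[of b c] ab
    by (auto simp: B_def ereal_tendsto_simps1)
  have FTC: "set_integrable lborel (einterval A B) h" "(LBINT x=A..B. h x) = ((a + b) / 2 + c - sqrt ((a + c) * (b + c))) / 4"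
    using interval_integral_FTC_nonneg[OF AB h_cont(1,2) h_nonneg lA lB] by (simp_all add: minus_divide_left)
  have fe: "f_dens y x * (1 / (1 + t * (2 * x / y))) = indicator (einterval A B) x *\<^sub>R h x" for x
    using mem[of x] ab by (auto simp: f_dens_def h_def einterval_def a_def[symmetric] b_def[symmetric] c_def mult.commute pos_divide_less_eq split: split_indicator)
  show ?I unfolding fe using FTC(1) by (simp add: set_integrable_def)
  have "(\<integral>x. f_dens y x * (1 / (1 + t * (2 * x / y))) \<partial>lborel) = (LBINT x=A..B. h x)"
    unfolding fe using AB by (simp add: interval_lebesgue_integral_def set_lebesgue_integral_def)
  also have "\<dots> = ((a + b) / 2 + c - sqrt ((a + c) * (b + c))) / 4" by (rule FTC(2))
  \<comment> \<open>Up to the factor \<open>(2 / y)^2\<close>, sum and product of the endpoints turn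
    the radicand into the discriminant of the quadratic equation for \<open>H_lim\<close>.\<close>
  also have "sqrt ((a + c) * (b + c)) = 2 / y * sqrt ((t + y + 1)\<^sup>2 - 4 * y)"
  proof -
    have "(a + c) * (b + c) = a * b + c * (a + b) + c\<^sup>2" by (simp add: power2_eq_square algebra_simps)
    also have "\<dots> = (2 / y)\<^sup>2 * ((t + y + 1)\<^sup>2 - 4 * y)"
      unfolding ab(5,6) c_def using y by (simp add: field_simps power2_eq_square)
    finally show ?thesis using y by (simp add: real_sqrt_mult)
  qed
  also have "((a + b) / 2 + c - 2 / y * sqrt ((t + y + 1)\<^sup>2 - 4 * y)) / 4 = H_lim y t"
    unfolding ab(6) c_def H_lim_def using y by (simp add: field_simps)
  finally show ?E .
qed

section \<open>Nonnegativity and total mass of the limit density\<close>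

lemma f_dens_nonneg: assumes "0 < y" "y \<le> 1" shows "0 \<le> f_dens y x"
  using s1_s2_props[OF assms] by (auto simp: f_dens_def pos_divide_less_eq)

lemma f_dens_eq_0: assumes "0 < y" "y \<le> 1" "x \<le> 1 / s2 y" shows "f_dens y x = 0"
  using assms by (auto simp: f_dens_def)

lemma f_dens_meas[measurable]: "f_dens y \<in> borel_measurable borel"
  unfolding f_dens_def[abs_def] by measurable

text \<open>No new integral is computed: \<open>t\<close> decreases to 0 in
  \<open>f_dens_transform\<close>, and monotone convergence applies. The limit of
  \<open>H_lim\<close> is 1 because the radicand becomes \<open>(1 - y)^2\<close> and
  \<open>y \<le> 1\<close> selects the root \<open>1 - y\<close>.\<close>

lemma f_dens_mass:
  assumes y: "0 < y" "y \<le> 1"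
  shows "integrable lborel (f_dens y)" "(\<integral>x. f_dens y x \<partial>lborel) = 1"
proof -
  let ?t = "\<lambda>k::nat. 1 / (real k + 1)"
  let ?f = "\<lambda>k x. f_dens y x * (1 / (1 + ?t k * (2 * x / y)))"
  have t: "?t k > 0" for k by simp
  have xpos: "0 < x" if "f_dens y x \<noteq> 0" for x
  proof -
    have "1 / s2 y < x" using that f_dens_eq_0[OF y, of x] by force
    then show ?thesis using s1_s2_props(5)[OF y] by (meson less_trans zero_less_divide_1_iff)
  qed
  have mono: "mono (\<lambda>k. ?f k x)" for x
  proof (cases "f_dens y x = 0")
    case False
    have gen: "f * (1 / (1 + s * w)) \<le> f * (1 / (1 + s' * w))" if "0 \<le> s'" "s' \<le> s" "0 \<le> w" "0 \<le> f" for f s s' w :: real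
      using that by (intro mult_left_mono divide_left_mono add_left_mono mult_right_mono mult_pos_pos add_pos_nonneg mult_nonneg_nonneg) auto
    show ?thesis
    proof (rule monoI)
      fix m n :: nat assume "m \<le> n"
      then have "?t n \<le> ?t m" by (simp add: frac_le)
      then show "?f m x \<le> ?f n x"
        using xpos[OF False] y by (intro gen f_dens_nonneg) auto
    qed
  qed (simp add: mono_def)
  have t0: "?t \<longlonglongrightarrow> 0" by real_asymp
  have lim: "(\<lambda>k. ?f k x) \<longlonglongrightarrow> f_dens y x" for x
  proof -
    have "(\<lambda>k. ?f k x) \<longlonglongrightarrow> f_dens y x * (1 / (1 + 0 * (2 * x / y)))"
      by (intro tendsto_intros t0) auto
    then show ?thesis by simp
  qed
  have "(\<lambda>k. H_lim y (?t k)) \<longlonglongrightarrow> ((0 + y + 1) - sqrt ((0 + y + 1)\<^sup>2 - 4 * y)) / (2 * y)"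
    unfolding H_lim_def using y by (intro tendsto_intros t0) auto
  also have "((0 + y + 1) - sqrt ((0 + y + 1)\<^sup>2 - 4 * y)) / (2 * y) = 1"
  proof -
    have "(0 + y + 1)\<^sup>2 - 4 * y = (1 - y)\<^sup>2" by (simp add: power2_eq_square algebra_simps)
    then show ?thesis using y by (simp add: field_simps)
  qed
  finally have Hlim: "(\<lambda>k. integral\<^sup>L lborel (?f k)) \<longlonglongrightarrow> 1"
    using f_dens_transform(2)[OF y t] by simp
  have pos: "0 \<le> ?f k x" for k x
    using xpos[of x] f_dens_nonneg[OF y, of x] y by (cases "f_dens y x = 0") auto
  show "integrable lborel (f_dens y)" "(\<integral>x. f_dens y x \<partial>lborel) = 1"
    by (rule integral_monotone_convergence_nonneg[OF f_dens_transform(1)[OF y t] _ _ _ Hlim]; use mono lim pos in auto)+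
qed

section \<open>From transforms to distribution functions\<close>

text \<open>
  Coefficients of power series are recovered one after the other from the values at points \<open>s m\<close>
  tending to 0.
\<close>

lemma coefficient_convergence:
  fixes a :: "nat \<Rightarrow> nat \<Rightarrow> real" and s \<tau> \<alpha> :: "nat \<Rightarrow> real" and T :: "nat \<Rightarrow> nat \<Rightarrow> real"
  assumes T: "\<And>n k m. \<bar>T n m - (\<Sum>j\<le>k. s m ^ j * a n j)\<bar> \<le> C * s m ^ Suc k"
    and \<tau>: "\<And>k m. \<bar>\<tau> m - (\<Sum>j\<le>k. s m ^ j * \<alpha> j)\<bar> \<le> C * s m ^ Suc k"
    and s: "\<And>m. s m > 0" "s \<longlonglongrightarrow> 0" and lim: "\<And>m. (\<lambda>n. T n m) \<longlonglongrightarrow> \<tau> m"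
  shows "(\<lambda>n. a n k) \<longlonglongrightarrow> \<alpha> k"
proof (induction k rule: less_induct)
  case (less k)
  show ?case
  proof (rule LIMSEQ_I)
    fix e :: real assume e: "e > 0"
    have "(\<lambda>m. 2 * C * s m) \<longlonglongrightarrow> 2 * C * 0" by (intro tendsto_intros s)
    then have "eventually (\<lambda>m. 2 * C * s m < e / 2) sequentially"
      using e by (intro order_tendstoD(2)) auto
    \<comment> \<open>The point \<open>s m\<close> is fixed before \<open>n\<close> grows: the two
      remainders then cost less than half of \<open>e\<close>, and the differences of the lower
      coefficients tend to 0 by induction.\<close>
    then obtain m where m: "2 * C * s m < e / 2" by (auto simp: eventually_sequentially)
    define r where "r = s m"
    have r: "r > 0" using s by (simp add: r_def)
    have "(\<lambda>n. (T n m - \<tau> m) - (\<Sum>j<k. r ^ j * (a n j - \<alpha> j))) \<longlonglongrightarrow> (\<tau> m - \<tau> m) - (\<Sum>j<k. r ^ j * (\<alpha> j - \<alpha> j))"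
      by (intro tendsto_intros lim less) auto
    then have "(\<lambda>n. \<bar>(T n m - \<tau> m) - (\<Sum>j<k. r ^ j * (a n j - \<alpha> j))\<bar>) \<longlonglongrightarrow> 0"
      using tendsto_rabs_zero by simp
    then have "eventually (\<lambda>n. \<bar>(T n m - \<tau> m) - (\<Sum>j<k. r ^ j * (a n j - \<alpha> j))\<bar> < r ^ k * (e / 2)) sequentially"
      using e r by (intro order_tendstoD(2)) auto
    then obtain N where N: "\<And>n. n \<ge> N \<Longrightarrow> \<bar>(T n m - \<tau> m) - (\<Sum>j<k. r ^ j * (a n j - \<alpha> j))\<bar> < r ^ k * (e / 2)"
      by (auto simp: eventually_sequentially)
    show "\<exists>N. \<forall>n\<ge>N. norm (a n k - \<alpha> k) < e"
    proof (intro exI[of _ N] allI impI)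
      fix n assume n: "n \<ge> N"
      define X where "X = (T n m - \<tau> m) - (\<Sum>j<k. r ^ j * (a n j - \<alpha> j))"
      define P where "P = T n m - (\<Sum>j\<le>k. r ^ j * a n j)"
      define Q where "Q = \<tau> m - (\<Sum>j\<le>k. r ^ j * \<alpha> j)"
      have "r ^ k * (a n k - \<alpha> k) = X - P + Q"
        unfolding X_def P_def Q_def lessThan_Suc_atMost[symmetric] by (simp add: sum_subtractf right_diff_distrib)
      moreover have "\<bar>X\<bar> < r ^ k * (e / 2)" using N[OF n] by (simp add: X_def)
      moreover have "\<bar>P\<bar> \<le> r ^ k * (C * r)" "\<bar>Q\<bar> \<le> r ^ k * (C * r)"
        using T[of n m k] \<tau>[of m k] by (simp_all add: P_def Q_def r_def mult_ac)
      ultimately have "\<bar>r ^ k * (a n k - \<alpha> k)\<bar> < r ^ k * (e / 2) + r ^ k * (2 * C * r)" by linarith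
      also have "\<dots> < r ^ k * (e / 2) + r ^ k * (e / 2)"
        using m r by (intro add_strict_left_mono mult_strict_left_mono) (auto simp: r_def)
      finally have "r ^ k * \<bar>a n k - \<alpha> k\<bar> < r ^ k * e" using r by (simp add: abs_mult)
      then show "norm (a n k - \<alpha> k) < e" using r by simp
    qed
  qed
qed

text \<open>With \<open>u = 1 / (1 + l)\<close> and \<open>w = l / (1 + l)\<close> the transform is
  \<open>u / (1 - s w)\<close>, a geometric series. The bound \<open>s \<le> 1/2\<close> keeps the
  denominator at least 1/2, hence the factor 2, uniformly in \<open>l\<close>.\<close>

lemma resolvent_expansion:
  fixes l s :: real
  assumes "0 \<le> l" "0 < s" "s \<le> 1/2"
  shows "\<bar>1 / (1 + (1 - s) * l) - (\<Sum>j\<le>k. s ^ j * ((1 / (1 + l)) * (l / (1 + l)) ^ j))\<bar> \<le> 2 * s ^ Suc k"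
proof -
  define u w where "u = 1 / (1 + l)" and "w = l / (1 + l)"
  have u: "0 \<le> u" "u \<le> 1" and w: "0 \<le> w" "w < 1" using assms by (auto simp: u_def w_def)
  have sw: "s * w \<le> 1/2" using w assms by (metis less_eq_real_def mult.right_neutral mult_mono order_trans zero_le_one mult_left_le)
  have "1 / (1 + (1 - s) * l) = u / (1 - s * w)"
  proof -
    have "1 - s * w = (1 + (1 - s) * l) / (1 + l)" using assms by (simp add: w_def field_simps)
    then show ?thesis using assms by (simp add: u_def)
  qed
  also have "u / (1 - s * w) = u * ((\<Sum>j\<le>k. (s * w) ^ j) + (s * w) ^ Suc k / (1 - s * w))"
  proof -
    have "(\<Sum>j\<le>k. (s * w) ^ j) = (1 - (s * w) ^ Suc k) / (1 - s * w)"
      using sum_gp_strict[of "s * w" "Suc k"] sw by (simp add: lessThan_Suc_atMost)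
    then show ?thesis using sw by (simp add: add_divide_distrib[symmetric])
  qed
  finally have "1 / (1 + (1 - s) * l) - (\<Sum>j\<le>k. s ^ j * (u * w ^ j)) = u * ((s * w) ^ Suc k / (1 - s * w))"
    by (simp add: distrib_left sum_distrib_left power_mult_distrib mult_ac)
  moreover have "\<bar>u * ((s * w) ^ Suc k / (1 - s * w))\<bar> \<le> 2 * s ^ Suc k"
  proof -
    have "0 \<le> (s * w) ^ Suc k" using w assms by simp
    moreover have "(s * w) ^ Suc k \<le> s ^ Suc k" using w assms by (intro power_mono) (auto simp: mult_left_le)
    moreover have "(s * w) ^ Suc k / (1 - s * w) \<le> s ^ Suc k / (1/2)"
      using calculation sw by (intro frac_le) auto
    ultimately have "(s * w) ^ Suc k / (1 - s * w) \<le> 2 * s ^ Suc k" and "0 \<le> (s * w) ^ Suc k / (1 - s * w)"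
      using sw by auto
    moreover define v where "v = (s * w) ^ Suc k / (1 - s * w)"
    ultimately have v: "0 \<le> v" "v \<le> 2 * s ^ Suc k" by simp_all
    then have "\<bar>u * v\<bar> \<le> v" using u by (simp add: abs_mult mult_left_le_one_le)
    then show ?thesis using v unfolding v_def by linarith
  qed
  ultimately show ?thesis by (simp add: u_def w_def)
qed

text \<open>Continuous test functions that enclose the indicator of a half-line; for positive
  \<open>m\<close> the descent takes place on \<open>[a, a + 1/m]\<close>.\<close>

definition ramp :: "real \<Rightarrow> nat \<Rightarrow> real \<Rightarrow> real" where
  "ramp a m w = max 0 (min 1 (1 - real m * (w - a)))"

lemma ramp_bounds: "0 \<le> ramp a m w" "ramp a m w \<le> 1" by (auto simp: ramp_def)
lemma ramp_1: "w \<le> a \<Longrightarrow> ramp a m w = 1" by (auto simp: ramp_def mult_nonneg_nonpos)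
lemma ramp_0: assumes "m > 0" "a + 1 / real m \<le> w" shows "ramp a m w = 0"
proof -
  have "real m * (1 / real m) \<le> real m * (w - a)" using assms by (intro mult_left_mono) auto
  then show ?thesis using assms by (simp add: ramp_def)
qed
lemma ramp_cont: "continuous_on S (ramp a m)" unfolding ramp_def[abs_def] by (intro continuous_intros)

text \<open>
  The transform is only used at \<open>t = 1 - s\<close> with \<open>s = 1/(m + 2)\<close>: with \<open>w = l / (1 + l)\<close> it is the power
  series in \<open>s\<close> whose coefficients are the averages of \<open>(1 - w) w\<^sup>k\<close>.
\<close>

locale transform_limit =
  fixes lam :: "nat \<Rightarrow> nat \<Rightarrow> real" and f g :: "real \<Rightarrow> real"
  assumes lam: "\<And>n i. i < n \<Longrightarrow> 0 \<le> lam n i"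
    and f: "\<And>x. 0 \<le> f x" "integrable lborel f" "(\<integral>x. f x \<partial>lborel) = 1"
    and g: "\<And>x. f x \<noteq> 0 \<Longrightarrow> 0 \<le> g x" and g_meas[measurable]: "g \<in> borel_measurable borel"
    and lim: "\<And>m::nat. (\<lambda>n. (\<Sum>i<n. 1 / (1 + (1 - 1 / (real m + 2)) * lam n i)) / n)
      \<longlonglongrightarrow> (\<integral>x. f x * (1 / (1 + (1 - 1 / (real m + 2)) * g x)) \<partial>lborel)"
begin

definition w :: "nat \<Rightarrow> nat \<Rightarrow> real" where "w n i = lam n i / (1 + lam n i)"
text \<open>Clipping keeps \<open>W\<close> in [0,1] on the whole line. Where \<open>f\<close> is
  nonzero, \<open>g\<close> is nonnegative and \<open>W\<close> agrees with
  \<open>g / (1 + g)\<close>.\<close>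

definition W :: "real \<Rightarrow> real" where "W x = max 0 (g x) / (1 + max 0 (g x))"

lemma f_meas[measurable]: "f \<in> borel_measurable borel"
  using borel_measurable_integrable[OF f(2)] by simp

lemma W_meas[measurable]: "W \<in> borel_measurable borel"
  unfolding W_def[abs_def] by measurable

lemma w_range: "i < n \<Longrightarrow> 0 \<le> w n i" "i < n \<Longrightarrow> w n i \<le> 1"
  using lam[of i n] by (auto simp: w_def)

lemma W_range: "0 \<le> W x" "W x \<le> 1"
  by (auto simp: W_def)

lemma int_bounded:
  assumes [measurable]: "\<phi> \<in> borel_measurable borel" and "\<And>x. f x \<noteq> 0 \<Longrightarrow> \<bar>\<phi> x\<bar> \<le> B"
  shows "integrable lborel (\<lambda>x. f x * \<phi> x)"
proof (rule Bochner_Integration.integrable_bound)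
  show "integrable lborel (\<lambda>x. B * f x)" using f(2) by simp
  show "AE x in lborel. norm (f x * \<phi> x) \<le> norm (B * f x)"
  proof (rule AE_I2)
    fix x
    show "norm (f x * \<phi> x) \<le> norm (B * f x)"
    proof (cases "f x = 0")
      case False
      then have "\<bar>\<phi> x\<bar> \<le> \<bar>B\<bar>" using assms(2) by fastforce
      then show ?thesis using f(1)[of x] by (simp add: abs_mult mult.commute[of "\<bar>B\<bar>"] mult_left_mono)
    qed simp
  qed
qed measurable

text \<open>Both transforms are expanded in \<open>s\<close> with the same remainder constant 2, one
  by averaging \<open>resolvent_expansion\<close> over the eigenvalues, the other by integrating it
  against \<open>f\<close>; then coefficients are compared.\<close>

lemma first_moments:
  "(\<lambda>n. (\<Sum>i<n. (1 / (1 + lam n i)) * (w n i) ^ k) / n) \<longlonglongrightarrow> (\<integral>x. f x * ((1 / (1 + max 0 (g x))) * W x ^ k) \<partial>lborel)"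
proof (rule coefficient_convergence[where C=2 and s="\<lambda>m. 1 / (real m + 2)" and
      T="\<lambda>n m. (\<Sum>i<n. 1 / (1 + (1 - 1 / (real m + 2)) * lam n i)) / n"
      and \<tau>="\<lambda>m. \<integral>x. f x * (1 / (1 + (1 - 1 / (real m + 2)) * g x)) \<partial>lborel"])
  fix n k m :: nat
  define s where "s = 1 / (real m + 2)"
  have s: "0 < s" "s \<le> 1/2" by (auto simp: s_def field_simps)
  show "\<bar>(\<Sum>i<n. 1 / (1 + (1 - 1 / (real m + 2)) * lam n i)) / real n -
     (\<Sum>j\<le>k. (1 / (real m + 2)) ^ j * ((\<Sum>i<n. 1 / (1 + lam n i) * w n i ^ j) / real n))\<bar> \<le> 2 * (1 / (real m + 2)) ^ Suc k"
  proof -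
    let ?d = "\<lambda>i. 1 / (1 + (1 - s) * lam n i) - (\<Sum>j\<le>k. s ^ j * ((1 / (1 + lam n i)) * w n i ^ j))"
    have "(\<Sum>i<n. 1 / (1 + (1 - s) * lam n i)) / real n - (\<Sum>j\<le>k. s ^ j * ((\<Sum>i<n. 1 / (1 + lam n i) * w n i ^ j) / real n))
       = (\<Sum>i<n. ?d i) / real n"
    proof -
      have "(\<Sum>j\<le>k. s ^ j * ((\<Sum>i<n. 1 / (1 + lam n i) * w n i ^ j) / real n))
        = (\<Sum>j\<le>k. \<Sum>i<n. s ^ j * (1 / (1 + lam n i) * w n i ^ j)) / real n"
        by (simp add: sum_distrib_left sum_divide_distrib)
      also have "(\<Sum>j\<le>k. \<Sum>i<n. s ^ j * (1 / (1 + lam n i) * w n i ^ j)) = (\<Sum>i<n. \<Sum>j\<le>k. s ^ j * (1 / (1 + lam n i) * w n i ^ j))"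
        by (rule sum.swap)
      finally show ?thesis by (simp add: sum_subtractf diff_divide_distrib)
    qed
    also have "\<bar>\<dots>\<bar> \<le> (\<Sum>i<n. 2 * s ^ Suc k) / real n"
      unfolding abs_divide abs_of_nat using resolvent_expansion[OF lam s, of _ n k]
      by (intro divide_right_mono order.trans[OF sum_abs] sum_mono) (auto simp: w_def)
    also have "\<dots> \<le> 2 * s ^ Suc k" using s by (cases "n = 0") auto
    finally show ?thesis by (simp add: s_def)
  qed
  show "\<bar>(\<integral>x. f x * (1 / (1 + (1 - 1 / (real m + 2)) * g x)) \<partial>lborel) -
     (\<Sum>j\<le>k. (1 / (real m + 2)) ^ j * (\<integral>x. f x * (1 / (1 + max 0 (g x)) * W x ^ j) \<partial>lborel))\<bar> \<le> 2 * (1 / (real m + 2)) ^ Suc k"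
  proof -
    have bnd: "\<bar>1 / (1 + max 0 (g x)) * W x ^ j\<bar> \<le> 1" for x j
    proof -
      have "W x ^ j \<le> 1" using W_range[of x] by (simp add: power_le_one)
      then have "W x ^ j \<le> 1 + max 0 (g x)" by linarith
      then show ?thesis using W_range[of x] by (simp add: abs_mult)
    qed
    have i1: "integrable lborel (\<lambda>x. f x * (1 / (1 + max 0 (g x)) * W x ^ j))" for j
      by (rule int_bounded[OF _ bnd]) measurable
    have i2: "integrable lborel (\<lambda>x. f x * (1 / (1 + (1 - s) * g x)))"
    proof (rule int_bounded)
      fix x assume "f x \<noteq> 0"
      then have "0 \<le> (1 - s) * g x" using g[of x] s by simp
      then show "\<bar>1 / (1 + (1 - s) * g x)\<bar> \<le> 1" by simp
    qed measurable
    have i3: "integrable lborel (\<lambda>x. s ^ j * (f x * (1 / (1 + max 0 (g x)) * W x ^ j)))" for j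
      by (rule integrable_mult_right[OF i1])
    have i4: "integrable lborel (\<lambda>x. \<Sum>j\<le>k. s ^ j * (f x * (1 / (1 + max 0 (g x)) * W x ^ j)))"
      by (rule Bochner_Integration.integrable_sum) (rule i3)
    have eq1: "(\<integral>x. f x * (1 / (1 + (1 - s) * g x)) \<partial>lborel) - (\<Sum>j\<le>k. s ^ j * (\<integral>x. f x * (1 / (1 + max 0 (g x)) * W x ^ j) \<partial>lborel))
      = (\<integral>x. f x * (1 / (1 + (1 - s) * g x)) - (\<Sum>j\<le>k. s ^ j * (f x * (1 / (1 + max 0 (g x)) * W x ^ j))) \<partial>lborel)"
    proof -
      have "(\<Sum>j\<le>k. s ^ j * (\<integral>x. f x * (1 / (1 + max 0 (g x)) * W x ^ j) \<partial>lborel))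
        = (\<integral>x. (\<Sum>j\<le>k. s ^ j * (f x * (1 / (1 + max 0 (g x)) * W x ^ j))) \<partial>lborel)"
        by (subst Bochner_Integration.integral_sum[OF i3]) (simp only: integral_mult_right_zero)
      then show ?thesis
        by (simp only: Bochner_Integration.integral_diff[OF i2 i4])
    qed
    have "\<bar>\<integral>x. f x * (1 / (1 + (1 - s) * g x)) - (\<Sum>j\<le>k. s ^ j * (f x * (1 / (1 + max 0 (g x)) * W x ^ j))) \<partial>lborel\<bar>
        \<le> (\<integral>x. 2 * s ^ Suc k * f x \<partial>lborel)"
    proof (rule order.trans[OF integral_abs_bound], rule integral_mono)
      fix x
      show "\<bar>f x * (1 / (1 + (1 - s) * g x)) - (\<Sum>j\<le>k. s ^ j * (f x * (1 / (1 + max 0 (g x)) * W x ^ j)))\<bar> \<le> 2 * s ^ Suc k * f x"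
      proof (cases "f x = 0")
        case False
        have eq: "f x * (1 / (1 + (1 - s) * g x)) - (\<Sum>j\<le>k. s ^ j * (f x * (1 / (1 + max 0 (g x)) * W x ^ j)))
          = f x * (1 / (1 + (1 - s) * g x) - (\<Sum>j\<le>k. s ^ j * (1 / (1 + g x) * (g x / (1 + g x)) ^ j)))"
          using g[OF False] by (simp add: W_def right_diff_distrib sum_distrib_left mult_ac)
        show ?thesis unfolding eq abs_mult abs_of_nonneg[OF f(1)] mult.commute[of "2 * s ^ Suc k"]
          by (rule mult_left_mono[OF resolvent_expansion[OF g[OF False] s] f(1)])
      qed simp
    next
      show "integrable lborel (\<lambda>x. \<bar>f x * (1 / (1 + (1 - s) * g x)) - (\<Sum>j\<le>k. s ^ j * (f x * (1 / (1 + max 0 (g x)) * W x ^ j)))\<bar>)"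
        by (rule Bochner_Integration.integrable_abs, rule Bochner_Integration.integrable_diff[OF i2 i4])
      show "integrable lborel (\<lambda>x. 2 * s ^ Suc k * f x)" using f(2) by (rule integrable_mult_right)
    qed
    then show ?thesis using f(3) unfolding eq1[symmetric] s_def[symmetric] by simp
  qed
next
  show "(\<lambda>m. 1 / (real m + 2)) \<longlonglongrightarrow> 0" by real_asymp
qed (use lim in auto)

text \<open>Since \<open>(1 - w) w^k = w^k - w^(k+1)\<close>, the coefficients telescope: starting
  from total mass 1, each of them yields the next moment.\<close>

lemma moments: "(\<lambda>n. (\<Sum>i<n. w n i ^ k) / n) \<longlonglongrightarrow> (\<integral>x. f x * W x ^ k \<partial>lborel)"
proof (induction k)
  case 0
  have "eventually (\<lambda>n. (\<Sum>i<n. w n i ^ 0) / real n = 1) sequentially"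
    using eventually_gt_at_top[of 0] by eventually_elim simp
  then show ?case using f(3) by (simp add: tendsto_eventually)
next
  case (Suc k)
  have u: "1 / (1 + lam n i) = 1 - w n i" if "i < n" for n i using lam[OF that] by (simp add: w_def field_simps)
  have U: "1 / (1 + max 0 (g x)) = 1 - W x" for x unfolding W_def by (simp add: field_simps)
  have eq: "(\<Sum>i<n. w n i ^ Suc k) / real n = (\<Sum>i<n. w n i ^ k) / real n - (\<Sum>i<n. (1 / (1 + lam n i)) * (w n i) ^ k) / real n" for n
    by (simp add: u left_diff_distrib sum_subtractf diff_divide_distrib)
  have p1: "\<bar>W x ^ k\<bar> \<le> 1" for x k using W_range[of x] by (simp add: power_le_one)
  have i: "integrable lborel (\<lambda>x. f x * W x ^ k)" for k
    by (rule int_bounded[OF _ p1]) measurable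
  have "(\<integral>x. f x * W x ^ Suc k \<partial>lborel) = (\<integral>x. f x * W x ^ k \<partial>lborel) - (\<integral>x. f x * ((1 / (1 + max 0 (g x))) * W x ^ k) \<partial>lborel)"
    using i[of k] i[of "Suc k"] unfolding U
    by (subst Bochner_Integration.integral_diff[symmetric]) (auto simp: algebra_simps intro!: Bochner_Integration.integrable_diff)
  then show ?case unfolding eq using tendsto_diff[OF Suc first_moments[of k]] by simp
qed

text \<open>Weierstrass approximation on [0,1], which contains all values of \<open>w\<close> and
  \<open>W\<close>, reduces the claim to \<open>moments\<close>. Three errors of at most
  \<open>e/4\<close> add up.\<close>

lemma continuous_test:
  assumes \<phi>: "continuous_on UNIV \<phi>"
  shows "(\<lambda>n. (\<Sum>i<n. \<phi> (w n i)) / n) \<longlonglongrightarrow> (\<integral>x. f x * \<phi> (W x) \<partial>lborel)"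
proof (rule LIMSEQ_I)
  fix e :: real assume e: "e > 0"
  have [measurable]: "\<phi> \<in> borel_measurable borel" using \<phi> by (rule borel_measurable_continuous_onI)
  have "continuous_on {0..1} \<phi>" using \<phi> continuous_on_subset by blast
  from Stone_Weierstrass_real_polynomial_function[OF compact_Icc this, of "e/4"] e
  obtain p where p: "real_polynomial_function p" "\<And>x. x \<in> {0..1} \<Longrightarrow> \<bar>\<phi> x - p x\<bar> < e / 4" by auto
  from p(1) obtain c d where cd: "p = (\<lambda>x. \<Sum>i\<le>d. c i * x ^ i)"
    unfolding real_polynomial_function_iff_sum by auto
  have "(\<lambda>n. (\<Sum>k\<le>d. c k * ((\<Sum>i<n. w n i ^ k) / n))) \<longlonglongrightarrow> (\<Sum>k\<le>d. c k * (\<integral>x. f x * W x ^ k \<partial>lborel))"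
    by (intro tendsto_intros moments)
  also have "(\<lambda>n. (\<Sum>k\<le>d. c k * ((\<Sum>i<n. w n i ^ k) / n))) = (\<lambda>n. (\<Sum>i<n. p (w n i)) / n)"
  proof
    fix n
    have "(\<Sum>k\<le>d. c k * ((\<Sum>i<n. w n i ^ k) / n)) = (\<Sum>k\<le>d. \<Sum>i<n. c k * w n i ^ k) / n"
      by (simp add: sum_distrib_left sum_divide_distrib)
    then show "(\<Sum>k\<le>d. c k * ((\<Sum>i<n. w n i ^ k) / n)) = (\<Sum>i<n. p (w n i)) / n"
      unfolding cd by (subst (asm) sum.swap)
  qed
  also have "(\<Sum>k\<le>d. c k * (\<integral>x. f x * W x ^ k \<partial>lborel)) = (\<integral>x. f x * p (W x) \<partial>lborel)"
  proof -
    have p1: "\<bar>W x ^ k\<bar> \<le> 1" for x k using W_range[of x] by (simp add: power_le_one)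
    have "integrable lborel (\<lambda>x. f x * W x ^ k)" for k by (rule int_bounded[OF _ p1]) measurable
    then have "(\<Sum>k\<le>d. c k * (\<integral>x. f x * W x ^ k \<partial>lborel)) = (\<integral>x. (\<Sum>k\<le>d. c k * (f x * W x ^ k)) \<partial>lborel)"
      by (subst Bochner_Integration.integral_sum) auto
    then show ?thesis unfolding cd by (simp add: sum_distrib_left mult_ac)
  qed
  finally have P: "(\<lambda>n. (\<Sum>i<n. p (w n i)) / n) \<longlonglongrightarrow> (\<integral>x. f x * p (W x) \<partial>lborel)" .
  from LIMSEQ_D[OF this, of "e/4"] e obtain N where
    N: "\<And>n. n \<ge> N \<Longrightarrow> \<bar>(\<Sum>i<n. p (w n i)) / n - (\<integral>x. f x * p (W x) \<partial>lborel)\<bar> < e / 4" by auto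
  have pc[measurable]: "p \<in> borel_measurable borel" unfolding cd by measurable
  have W01: "W x \<in> {0..1}" for x using W_range by auto
  obtain B where B: "\<And>x. x \<in> {0..1} \<Longrightarrow> \<bar>\<phi> x\<bar> \<le> B"
  proof -
    have "compact (\<phi> ` {0..1})" using \<open>continuous_on {0..1} \<phi>\<close> by (intro compact_continuous_image) auto
    from compact_imp_bounded[OF this] obtain B where "\<forall>y\<in>\<phi> ` {0..1}. norm y \<le> B" unfolding bounded_iff by blast
    then show ?thesis using that[of B] by auto
  qed
  have i1: "integrable lborel (\<lambda>x. f x * \<phi> (W x))" by (rule int_bounded) (use B W01 in auto)
  have pB: "\<bar>p x\<bar> \<le> B + e / 4" if "x \<in> {0..1}" for x using B[OF that] p(2)[OF that] by linarith
  have i2: "integrable lborel (\<lambda>x. f x * p (W x))" by (rule int_bounded[OF _ pB[OF W01]]) measurable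
  show "\<exists>N. \<forall>n\<ge>N. norm ((\<Sum>i<n. \<phi> (w n i)) / n - (\<integral>x. f x * \<phi> (W x) \<partial>lborel)) < e"
  proof (intro exI[of _ N] allI impI)
    fix n assume n: "n \<ge> N"
    have "\<bar>(\<Sum>i<n. \<phi> (w n i)) / n - (\<Sum>i<n. p (w n i)) / n\<bar> = \<bar>\<Sum>i<n. \<phi> (w n i) - p (w n i)\<bar> / n"
      by (simp add: sum_subtractf diff_divide_distrib[symmetric])
    also have "\<dots> \<le> (\<Sum>i<n. e / 4) / n"
      using p(2) w_range by (intro divide_right_mono order.trans[OF sum_abs] sum_mono) (auto intro: less_imp_le)
    also have "\<dots> \<le> e / 4" using e by (cases "n = 0") auto
    finally have 1: "\<bar>(\<Sum>i<n. \<phi> (w n i)) / n - (\<Sum>i<n. p (w n i)) / n\<bar> \<le> e / 4" .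
    have "\<bar>(\<integral>x. f x * \<phi> (W x) \<partial>lborel) - (\<integral>x. f x * p (W x) \<partial>lborel)\<bar> = \<bar>\<integral>x. f x * \<phi> (W x) - f x * p (W x) \<partial>lborel\<bar>"
      using i1 i2 by (subst Bochner_Integration.integral_diff) auto
    also have "\<dots> \<le> (\<integral>x. e / 4 * f x \<partial>lborel)"
    proof (rule order.trans[OF integral_abs_bound], rule integral_mono)
      fix x
      have "\<bar>f x * \<phi> (W x) - f x * p (W x)\<bar> = f x * \<bar>\<phi> (W x) - p (W x)\<bar>"
        using f(1)[of x] by (simp add: right_diff_distrib[symmetric] abs_mult)
      also have "\<dots> \<le> f x * (e / 4)" using f(1)[of x] p(2)[OF W01[of x]] by (intro mult_left_mono) auto
      finally show "\<bar>f x * \<phi> (W x) - f x * p (W x)\<bar> \<le> e / 4 * f x" by (simp add: mult.commute)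
    qed (use i1 i2 f(2) in auto)
    also have "\<dots> = e / 4" using f(3) by simp
    finally have 2: "\<bar>(\<integral>x. f x * \<phi> (W x) \<partial>lborel) - (\<integral>x. f x * p (W x) \<partial>lborel)\<bar> \<le> e / 4" .
    show "norm ((\<Sum>i<n. \<phi> (w n i)) / n - (\<integral>x. f x * \<phi> (W x) \<partial>lborel)) < e"
      using 1 2 N[OF n] e unfolding real_norm_def by linarith
  qed
qed

text \<open>Continuous functions enclose the indicator. The threshold moves with \<open>n\<close>
  because the affine rescaling of the eigenvalues does; the null set condition excludes an atom at
  the limit threshold.\<close>

lemma df_limit:
  assumes \<kappa>: "\<kappa>n \<longlonglongrightarrow> \<kappa>" and null: "AE x in lborel. f x \<noteq> 0 \<longrightarrow> W x \<noteq> \<kappa>"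
  shows "(\<lambda>n. (\<Sum>i<n. if w n i \<le> \<kappa>n n then 1 else 0) / n) \<longlonglongrightarrow> (\<integral>x. f x * (if W x \<le> \<kappa> then 1 else 0) \<partial>lborel)"
    (is "?E \<longlonglongrightarrow> ?G")
proof (rule LIMSEQ_I)
  fix e :: real assume e: "e > 0"
  \<comment> \<open>\<open>up m\<close> descends between \<open>\<kappa> + 1/(m+1)\<close> and
    \<open>\<kappa> + 2/(m+1)\<close>, \<open>lo m\<close> between \<open>\<kappa> - 2/(m+1)\<close>
    and \<open>\<kappa> - 1/(m+1)\<close>. The gap on either side of \<open>\<kappa>\<close> absorbs
    the difference between \<open>\<kappa>n n\<close> and \<open>\<kappa>\<close>.\<close>
  define up where "up m = ramp (\<kappa> + 1 / real (Suc m)) (Suc m)" for m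
  define lo where "lo m = ramp (\<kappa> - 2 / real (Suc m)) (Suc m)" for m
  have t1: "(\<lambda>m. \<kappa> + 2 / real (Suc m)) \<longlonglongrightarrow> \<kappa>" by real_asymp
  have t2: "(\<lambda>m. \<kappa> - 2 / real (Suc m)) \<longlonglongrightarrow> \<kappa>" by real_asymp
  have [measurable]: "up m \<in> borel_measurable borel" "lo m \<in> borel_measurable borel" for m
    unfolding up_def lo_def by (intro borel_measurable_continuous_onI ramp_cont)+
  have upl: "(\<lambda>m. up m v) \<longlonglongrightarrow> (if v \<le> \<kappa> then 1 else 0)" for v
  proof (cases "v \<le> \<kappa>")
    case True
    then have "up m v = 1" for m unfolding up_def by (intro ramp_1) (simp add: add_increasing2)
    then show ?thesis using True by simp
  next
    case False
    then have "eventually (\<lambda>m. \<kappa> + 2 / real (Suc m) < v) sequentially" using t1 by (intro order_tendstoD(2)) auto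
    then have "eventually (\<lambda>m. up m v = 0) sequentially"
      by eventually_elim (simp add: up_def, intro ramp_0, auto)
    then show ?thesis using False by (simp add: tendsto_eventually)
  qed
  have lol: "(\<lambda>m. lo m v) \<longlonglongrightarrow> (if v \<le> \<kappa> then 1 else 0)" if "v \<noteq> \<kappa>" for v
  proof (cases "v \<le> \<kappa>")
    case True
    then have "eventually (\<lambda>m. v < \<kappa> - 2 / real (Suc m)) sequentially" using t2 that by (intro order_tendstoD(1)) auto
    then have "eventually (\<lambda>m. lo m v = 1) sequentially"
      by eventually_elim (simp add: lo_def ramp_1)
    then show ?thesis using True by (simp add: tendsto_eventually)
  next
    case False
    have "lo m v = 0" for m unfolding lo_def
    proof (rule ramp_0)
      have "0 \<le> 1 / real (Suc m)" "\<kappa> - 2 / real (Suc m) + 1 / real (Suc m) = \<kappa> - 1 / real (Suc m)"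
        by (simp_all add: field_simps)
      then show "\<kappa> - 2 / real (Suc m) + 1 / real (Suc m) \<le> v" using False by linarith
    qed simp
    then show ?thesis using False by simp
  qed
  have U: "(\<lambda>m. \<integral>x. f x * up m (W x) \<partial>lborel) \<longlonglongrightarrow> ?G"
  proof (rule integral_dominated_convergence[where w=f])
    show "AE x in lborel. (\<lambda>m. f x * up m (W x)) \<longlonglongrightarrow> f x * (if W x \<le> \<kappa> then 1 else 0)"
      by (intro AE_I2 tendsto_intros upl)
    show "AE x in lborel. norm (f x * up m (W x)) \<le> f x" for m
      using f(1) ramp_bounds by (intro AE_I2) (auto simp: up_def abs_mult mult_left_le)
  qed (use f(2) in measurable)
  have Lo: "(\<lambda>m. \<integral>x. f x * lo m (W x) \<partial>lborel) \<longlonglongrightarrow> ?G"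
  proof (rule integral_dominated_convergence[where w=f])
    show "AE x in lborel. (\<lambda>m. f x * lo m (W x)) \<longlonglongrightarrow> f x * (if W x \<le> \<kappa> then 1 else 0)"
      using null
    proof eventually_elim
      case (elim x)
      show ?case
      proof (cases "f x = 0")
        case False
        then show ?thesis using elim by (intro tendsto_intros lol) auto
      qed simp
    qed
    show "AE x in lborel. norm (f x * lo m (W x)) \<le> f x" for m
      using f(1) ramp_bounds by (intro AE_I2) (auto simp: lo_def abs_mult mult_left_le)
  qed (use f(2) in measurable)
  have "eventually (\<lambda>m. (\<integral>x. f x * up m (W x) \<partial>lborel) < ?G + e / 2) sequentially"
    using U e by (intro order_tendstoD(2)) auto
  moreover have "eventually (\<lambda>m. (\<integral>x. f x * lo m (W x) \<partial>lborel) > ?G - e / 2) sequentially"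
    using Lo e by (intro order_tendstoD(1)) auto
  ultimately obtain m where m: "(\<integral>x. f x * up m (W x) \<partial>lborel) < ?G + e / 2" "(\<integral>x. f x * lo m (W x) \<partial>lborel) > ?G - e / 2"
    using eventually_conj[THEN eventually_happens] by (metis (no_types, lifting) sequentially_bot)
  have "(\<lambda>n. (\<Sum>i<n. up m (w n i)) / n) \<longlonglongrightarrow> (\<integral>x. f x * up m (W x) \<partial>lborel)"
    unfolding up_def by (intro continuous_test ramp_cont)
  then have e1: "eventually (\<lambda>n. (\<Sum>i<n. up m (w n i)) / n < ?G + e / 2) sequentially"
    using m by (intro order_tendstoD(2)) auto
  have "(\<lambda>n. (\<Sum>i<n. lo m (w n i)) / n) \<longlonglongrightarrow> (\<integral>x. f x * lo m (W x) \<partial>lborel)"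
    unfolding lo_def by (intro continuous_test ramp_cont)
  then have e2: "eventually (\<lambda>n. (\<Sum>i<n. lo m (w n i)) / n > ?G - e / 2) sequentially"
    using m by (intro order_tendstoD(1)) auto
  have e3: "eventually (\<lambda>n. \<kappa>n n < \<kappa> + 1 / real (Suc m)) sequentially" "eventually (\<lambda>n. \<kappa>n n > \<kappa> - 1 / real (Suc m)) sequentially"
    by (rule order_tendstoD[OF \<kappa>], simp)+
  have "eventually (\<lambda>n. norm (?E n - ?G) < e) sequentially"
    using e1 e2 e3
  proof eventually_elim
    case (elim n)
    have "?E n \<le> (\<Sum>i<n. up m (w n i)) / n"
    proof (intro divide_right_mono sum_mono)
      fix i
      show "(if w n i \<le> \<kappa>n n then 1 else 0) \<le> up m (w n i)"
        using elim(3) ramp_1[of "w n i" "\<kappa> + 1 / real (Suc m)" "Suc m"] ramp_bounds[of "\<kappa> + 1 / real (Suc m)" "Suc m" "w n i"]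
        by (auto simp: up_def)
    qed simp
    moreover have "(\<Sum>i<n. lo m (w n i)) / n \<le> ?E n"
    proof (intro divide_right_mono sum_mono)
      fix i
      show "lo m (w n i) \<le> (if w n i \<le> \<kappa>n n then 1 else 0)"
      proof (cases "w n i \<le> \<kappa>n n")
        case False
        have "lo m (w n i) = 0" unfolding lo_def
        proof (rule ramp_0)
          have "\<kappa> - 2 / real (Suc m) + 1 / real (Suc m) = \<kappa> - 1 / real (Suc m)" by (simp add: field_simps)
          then show "\<kappa> - 2 / real (Suc m) + 1 / real (Suc m) \<le> w n i" using False elim(4) by linarith
        qed simp
        then show ?thesis using False by simp
      qed (use ramp_bounds in \<open>auto simp: lo_def\<close>)
    qed simp
    ultimately show ?case using elim(1,2) e unfolding real_norm_def by linarith
  qed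
  then show "\<exists>N. \<forall>n\<ge>N. norm (?E n - ?G) < e" by (simp add: eventually_sequentially)
qed

end

section \<open>Bounded differences\<close>

text \<open>Induction over the coordinates. Integrating out all but coordinate \<open>i\<close>
  leaves \<open>fb\<close>; Hoeffding's lemma controls \<open>fb - m\<close>, the induction
  hypothesis controls \<open>f - fb\<close> for each fixed value of that coordinate, and the
  exponential bounds multiply.\<close>

lemma mcdiarmid_PiM:
  fixes D :: "'i \<Rightarrow> 'b measure" and f :: "('i \<Rightarrow> 'b) \<Rightarrow> real"
  assumes D: "\<And>i. prob_space (D i)" and L: "finite L" and l: "l > 0"
    and f: "f \<in> borel_measurable (PiM L D)"
    and bd: "\<And>x. x \<in> space (PiM L D) \<Longrightarrow> \<bar>f x\<bar> \<le> K"
    and diff: "\<And>x i z. x \<in> space (PiM L D) \<Longrightarrow> i \<in> L \<Longrightarrow> z \<in> space (D i) \<Longrightarrow> \<bar>f x - f (x(i := z))\<bar> \<le> c"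
  shows "(\<integral>\<^sup>+x. exp (l * (f x - (\<integral>x. f x \<partial>PiM L D))) \<partial>PiM L D) \<le> ennreal (exp (l\<^sup>2 * card L * c\<^sup>2 / 8))"
  using L f bd diff
proof (induction L arbitrary: f)
  case empty
  interpret E: prob_space "PiM {} D" using D by (intro prob_space_PiM)
  have f0: "f x = f (\<lambda>_. undefined)" if "x \<in> space (PiM {} D)" for x
    using that by (simp add: space_PiM_empty)
  have "(\<integral>x. f x \<partial>PiM {} D) = (\<integral>x. f (\<lambda>_. undefined) \<partial>PiM {} D)"
    by (intro Bochner_Integration.integral_cong) (auto dest: f0)
  then have m: "(\<integral>x. f x \<partial>PiM {} D) = f (\<lambda>_. undefined)" by (simp add: E.prob_space)
  have "(\<integral>\<^sup>+x. exp (l * (f x - f (\<lambda>_. undefined))) \<partial>PiM {} D) = (\<integral>\<^sup>+x. 1 \<partial>PiM {} D)"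
    by (intro nn_integral_cong) (auto dest: f0)
  then show ?case unfolding m by (simp add: E.emeasure_space_1)
next
  case (insert i L)
  interpret P: product_prob_space D using D by (rule product_prob_spaceI)
  interpret PL: prob_space "PiM L D" using D by (intro prob_space_PiM)
  interpret PI: prob_space "PiM (insert i L) D" using D by (intro prob_space_PiM)
  interpret Di: prob_space "D i" by (rule D)
  interpret pp: pair_prob_space "D i" "PiM L D" ..
  note [measurable] = insert.prems(1)
  have upd: "x(i := y) \<in> space (PiM (insert i L) D)" if "x \<in> space (PiM L D)" "y \<in> space (D i)" for x y
    using that by (auto simp: space_PiM PiE_def extensional_def Pi_def)
  have meas2: "(\<lambda>(y, x). f (x(i := y))) \<in> borel_measurable (D i \<Otimes>\<^sub>M PiM L D)"
  proof -
    have "(\<lambda>p. (snd p)(i := fst p)) \<in> D i \<Otimes>\<^sub>M PiM L D \<rightarrow>\<^sub>M PiM (insert i L) D"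
      by (rule measurable_fun_upd[of _ _ i]) auto
    from measurable_compose[OF this insert.prems(1)] show ?thesis by (simp add: case_prod_beta)
  qed
  define fb where "fb y = (\<integral>x. f (x(i := y)) \<partial>PiM L D)" for y
  have fb_meas[measurable]: "fb \<in> borel_measurable (D i)"
    unfolding fb_def using meas2 by (rule PL.borel_measurable_lebesgue_integral)
  have fy_meas: "(\<lambda>x. f (x(i := y))) \<in> borel_measurable (PiM L D)" if "y \<in> space (D i)" for y
    using measurable_compose[OF measurable_Pair1'[OF that] meas2] by simp
  have fy_int: "integrable (PiM L D) (\<lambda>x. f (x(i := y)))" if "y \<in> space (D i)" for y
    using insert.prems(2) upd that fy_meas[OF that] by (intro PL.integrable_const_bound[of _ K]) auto
  have f_int: "integrable (PiM (insert i L) D) f"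
    using insert.prems(2) by (intro PI.integrable_const_bound[of _ K]) auto
  define m where "m = (\<integral>x. f x \<partial>PiM (insert i L) D)"
  have m_eq: "m = (\<integral>y. fb y \<partial>D i)"
  proof -
    have int2: "integrable (D i \<Otimes>\<^sub>M PiM L D) (\<lambda>(y, x). f (x(i := y)))"
      using meas2 insert.prems(2) upd by (intro pp.P.integrable_const_bound[of _ K]) (auto simp: space_pair_measure)
    have "m = (\<integral>x. (\<integral>y. f (x(i := y)) \<partial>D i) \<partial>PiM L D)"
      unfolding m_def by (rule P.product_integral_insert[OF insert.hyps f_int])
    also have "\<dots> = (\<integral>y. (\<integral>x. f (x(i := y)) \<partial>PiM L D) \<partial>D i)"
      by (rule pp.Fubini_integral[OF int2])
    finally show ?thesis by (simp add: fb_def)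
  qed
  define s where "s = l\<^sup>2 * card L * c\<^sup>2 / 8"
  have IH: "(\<integral>\<^sup>+x. exp (l * (f (x(i := y)) - fb y)) \<partial>PiM L D) \<le> ennreal (exp s)" if y: "y \<in> space (D i)" for y
    unfolding fb_def s_def
  proof (rule insert.IH[OF fy_meas[OF y]])
    fix x assume x: "x \<in> space (PiM L D)"
    show "\<bar>f (x(i := y))\<bar> \<le> K" using insert.prems(2) upd[OF x y] by blast
    fix k z assume k: "k \<in> L" "z \<in> space (D k)"
    then have "k \<noteq> i" using insert.hyps by auto
    then have eq: "x(k := z, i := y) = x(i := y, k := z)" by (auto simp: fun_upd_twist)
    show "\<bar>f (x(i := y)) - f (x(k := z, i := y))\<bar> \<le> c"
      unfolding eq by (rule insert.prems(3)[OF upd[OF x y]]) (use k in auto)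
  qed
  have fb_diff: "\<bar>fb y - fb y'\<bar> \<le> c" if "y \<in> space (D i)" "y' \<in> space (D i)" for y y'
  proof -
    have "\<bar>fb y - fb y'\<bar> = \<bar>\<integral>x. f (x(i := y)) - f (x(i := y')) \<partial>PiM L D\<bar>"
      unfolding fb_def using fy_int that by (subst Bochner_Integration.integral_diff) auto
    also have "\<dots> \<le> (\<integral>x. \<bar>f (x(i := y)) - f (x(i := y'))\<bar> \<partial>PiM L D)"
      by (rule integral_abs_bound)
    also have "\<dots> \<le> (\<integral>x. c \<partial>PiM L D)"
    proof (rule integral_mono)
      fix x assume x: "x \<in> space (PiM L D)"
      show "\<bar>f (x(i := y)) - f (x(i := y'))\<bar> \<le> c"
        using insert.prems(3)[OF upd[OF x that(1)], of i y', unfolded fun_upd_upd] that(2) by blast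
    qed (use fy_int that in auto)
    finally show ?thesis by (simp add: PL.prob_space)
  qed
  obtain y0 where y0: "y0 \<in> space (D i)" using prob_space.not_empty[OF D] by blast
  \<comment> \<open>Hoeffding's lemma asks for an interval of length \<open>c\<close>; the infimum
    of \<open>fb\<close> serves as its left end.\<close>
  define a where "a = (INF y\<in>space (D i). fb y)"
  have bdd: "bdd_below (fb ` space (D i))"
    using fb_diff[OF y0] by (intro bdd_belowI2[of _ "fb y0 - c"]) (auto simp: abs_le_iff algebra_simps)
  have range: "fb y \<in> {a..a + c}" if y: "y \<in> space (D i)" for y
  proof -
    have "a \<le> fb y" unfolding a_def using bdd y by (rule cINF_lower)
    moreover have "fb y - c \<le> a" unfolding a_def
      using fb_diff[OF y] y0 by (intro cINF_greatest) (auto simp: abs_le_iff algebra_simps)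
    ultimately show ?thesis by simp
  qed
  interpret H: interval_bounded_random_variable "D i" fb a "a + c"
    using range by unfold_locales (auto intro: AE_I2)
  have H: "(\<integral>\<^sup>+y. exp (l * (fb y - m)) \<partial>D i) \<le> ennreal (exp (l\<^sup>2 * c\<^sup>2 / 8))"
    using H.Hoeffdings_lemma_nn_integral[OF l] m_eq by simp
  have "(\<integral>\<^sup>+x. exp (l * (f x - m)) \<partial>PiM (insert i L) D)
      = (\<integral>\<^sup>+y. (\<integral>\<^sup>+x. exp (l * (f (x(i := y)) - m)) \<partial>PiM L D) \<partial>D i)"
    by (rule P.product_nn_integral_insert_rev[OF insert.hyps]) measurable
  also have "\<dots> = (\<integral>\<^sup>+y. ennreal (exp (l * (fb y - m))) * (\<integral>\<^sup>+x. exp (l * (f (x(i := y)) - fb y)) \<partial>PiM L D) \<partial>D i)"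
  proof (intro nn_integral_cong)
    fix y assume y: "y \<in> space (D i)"
    have "(\<integral>\<^sup>+x. exp (l * (f (x(i := y)) - m)) \<partial>PiM L D)
      = (\<integral>\<^sup>+x. ennreal (exp (l * (fb y - m))) * ennreal (exp (l * (f (x(i := y)) - fb y))) \<partial>PiM L D)"
      by (intro nn_integral_cong) (simp add: ennreal_mult[symmetric] exp_add[symmetric] algebra_simps)
    also have "\<dots> = ennreal (exp (l * (fb y - m))) * (\<integral>\<^sup>+x. exp (l * (f (x(i := y)) - fb y)) \<partial>PiM L D)"
    proof (rule nn_integral_cmult)
      have "(\<lambda>x. ennreal (exp (l * (f (x(i := y)) - k)))) \<in> borel_measurable (PiM L D)" for k
        using fy_meas[OF y] by simp
      then show "(\<lambda>x. ennreal (exp (l * (f (x(i := y)) - fb y)))) \<in> borel_measurable (PiM L D)" .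
    qed
    finally show "(\<integral>\<^sup>+x. exp (l * (f (x(i := y)) - m)) \<partial>PiM L D) = \<dots>" .
  qed
  also have "\<dots> \<le> (\<integral>\<^sup>+y. ennreal (exp (l * (fb y - m))) * ennreal (exp s) \<partial>D i)"
    by (intro nn_integral_mono mult_left_mono IH) auto
  also have "\<dots> = (\<integral>\<^sup>+y. exp (l * (fb y - m)) \<partial>D i) * ennreal (exp s)"
    by (intro nn_integral_multc) measurable
  also have "\<dots> \<le> ennreal (exp (l\<^sup>2 * c\<^sup>2 / 8)) * ennreal (exp s)"
    by (intro mult_right_mono H) auto
  also have "\<dots> = ennreal (exp (l\<^sup>2 * card (insert i L) * c\<^sup>2 / 8))"
    using insert.hyps by (simp add: ennreal_mult[symmetric] exp_add[symmetric] s_def field_simps)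
  finally show ?case by (simp add: m_def)
qed

locale bounded_differences = prob_space M for M :: "'a measure" +
  fixes N :: "'i \<Rightarrow> 'b measure" and U :: "'i \<Rightarrow> 'a \<Rightarrow> 'b" and L :: "'i set"
    and f :: "('i \<Rightarrow> 'b) \<Rightarrow> real" and K c :: real
  assumes indep: "indep_vars N U L" and fin: "finite L" and ne: "L \<noteq> {}"
    and meas: "f \<in> borel_measurable (PiM L N)"
    and bd: "\<And>x. x \<in> space (PiM L N) \<Longrightarrow> \<bar>f x\<bar> \<le> K"
    and diff: "\<And>x i z. x \<in> space (PiM L N) \<Longrightarrow> i \<in> L \<Longrightarrow> z \<in> space (N i) \<Longrightarrow> \<bar>f x - f (x(i := z))\<bar> \<le> c"
begin

definition g :: "'a \<Rightarrow> real" where "g \<omega> = f (\<lambda>i\<in>L. U i \<omega>)"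

lemma U_meas: "(\<lambda>\<omega>. \<lambda>i\<in>L. U i \<omega>) \<in> M \<rightarrow>\<^sub>M PiM L N"
  using indep by (intro measurable_restrict) (auto simp: indep_vars_def)

lemma g_meas[measurable]: "g \<in> borel_measurable M"
  unfolding g_def using measurable_compose[OF U_meas meas] .

lemma g_bd: "\<omega> \<in> space M \<Longrightarrow> \<bar>g \<omega>\<bar> \<le> K"
  unfolding g_def by (intro bd measurable_space[OF U_meas])

lemma mgf_pos:
  assumes l: "l > 0"
  shows "(\<integral>\<^sup>+\<omega>. exp (l * (g \<omega> - expectation g)) \<partial>M) \<le> ennreal (exp (l\<^sup>2 * card L * c\<^sup>2 / 8))"
proof -
  obtain j where j: "j \<in> L" using ne by auto
  have rv: "\<And>i. i \<in> L \<Longrightarrow> random_variable (N i) (U i)" using indep by (auto simp: indep_vars_def)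
  \<comment> \<open>The product construction needs a probability measure at every index, so indices
    outside \<open>L\<close> receive the law of \<open>U j\<close>.\<close>
  define D where "D i = (if i \<in> L then distr M (N i) (U i) else distr M (N j) (U j))" for i
  have D: "prob_space (D i)" for i unfolding D_def using rv j by (auto intro: prob_space_distr)
  have dPi: "distr M (PiM L N) (\<lambda>\<omega>. \<lambda>i\<in>L. U i \<omega>) = PiM L D"
    using indep_vars_iff_distr_eq_PiM'[OF ne rv] indep by (simp add: D_def cong: PiM_cong)
  have sp: "space (PiM L D) = space (PiM L N)" by (simp add: dPi[symmetric])
  have ms: "f \<in> borel_measurable (PiM L D)" using meas by (simp add: dPi[symmetric])
  have "(\<integral>\<^sup>+x. exp (l * (f x - (\<integral>x. f x \<partial>PiM L D))) \<partial>PiM L D) \<le> ennreal (exp (l\<^sup>2 * card L * c\<^sup>2 / 8))"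
    by (rule mcdiarmid_PiM[OF D fin l ms, of K]) (use bd diff sp in \<open>auto simp: D_def\<close>)
  moreover have "(\<integral>x. f x \<partial>PiM L D) = expectation g"
    unfolding dPi[symmetric] g_def by (rule integral_distr[OF U_meas meas])
  moreover have "(\<integral>\<^sup>+x. exp (l * (f x - expectation g)) \<partial>PiM L D) = (\<integral>\<^sup>+\<omega>. exp (l * (g \<omega> - expectation g)) \<partial>M)"
    unfolding dPi[symmetric] using meas by (subst nn_integral_distr[OF U_meas]) (auto simp: g_def)
  ultimately show ?thesis by simp
qed

text \<open>The hypotheses are invariant under replacing \<open>f\<close> by \<open>- f\<close>,
  which supplies the negative values of \<open>l\<close>.\<close>

lemma mgf:
  assumes l: "l \<noteq> 0"
  shows "(\<integral>\<^sup>+\<omega>. exp (l * (g \<omega> - expectation g)) \<partial>M) \<le> ennreal (exp (l\<^sup>2 * card L * c\<^sup>2 / 8))"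
proof (cases "l > 0")
  case False
  interpret neg: bounded_differences M N U L "\<lambda>x. - f x" K c
    using indep fin ne meas bd diff by unfold_locales (auto simp: abs_minus_commute)
  have "neg.g = (\<lambda>\<omega>. - g \<omega>)" by (simp add: neg.g_def g_def fun_eq_iff)
  with neg.mgf_pos[of "-l"] False l show ?thesis by (simp add: algebra_simps)
qed (rule mgf_pos)

lemma concentration_L1:
  assumes c: "c > 0"
  shows "expectation (\<lambda>\<omega>. \<bar>g \<omega> - expectation g\<bar>) \<le> 4 * sqrt (card L) * c"
proof -
  define m where "m = expectation g"
  \<comment> \<open>This scale makes the exponent 1/8; then
    \<open>|x| \<le> exp x + exp (- x)\<close> integrates to at most
    \<open>2 exp (1/8) \<le> 4\<close>.\<close>
  define l where "l = 1 / (sqrt (card L) * c)"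
  have cL: "0 < real (card L)" using fin ne by (simp add: card_gt_0_iff)
  have l: "l > 0" using c cL by (simp add: l_def)
  have l8: "l\<^sup>2 * card L * c\<^sup>2 / 8 = 1 / 8" using c cL by (simp add: l_def power_divide power_mult_distrib)
  have int: "integrable M (\<lambda>\<omega>. \<bar>g \<omega> - m\<bar>)"
    using g_bd by (intro integrable_const_bound[of _ "K + \<bar>m\<bar>"]) (auto intro!: AE_I2 simp: abs_le_iff, fastforce+)
  have "ennreal (l * expectation (\<lambda>\<omega>. \<bar>g \<omega> - m\<bar>)) = (\<integral>\<^sup>+\<omega>. ennreal (l * \<bar>g \<omega> - m\<bar>) \<partial>M)"
    using int l by (subst nn_integral_eq_integral) auto
  also have "\<dots> \<le> (\<integral>\<^sup>+\<omega>. ennreal (exp (l * (g \<omega> - m))) + ennreal (exp (- l * (g \<omega> - m))) \<partial>M)"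
  proof (intro nn_integral_mono)
    fix \<omega>
    define x where "x = l * (g \<omega> - m)"
    have "y \<le> exp y" for y :: real using exp_ge_add_one_self[of y] by linarith
    from this[of x] this[of "- x"] have "\<bar>x\<bar> \<le> exp x + exp (- x)"
      using exp_gt_zero[of x] exp_gt_zero[of "- x"] by linarith
    moreover have "\<bar>x\<bar> = l * \<bar>g \<omega> - m\<bar>" using l by (simp add: x_def abs_mult)
    ultimately have "l * \<bar>g \<omega> - m\<bar> \<le> exp (l * (g \<omega> - m)) + exp (- l * (g \<omega> - m))"
      by (simp add: x_def)
    then show "ennreal (l * \<bar>g \<omega> - m\<bar>) \<le> ennreal (exp (l * (g \<omega> - m))) + ennreal (exp (- l * (g \<omega> - m)))"
      by (simp add: ennreal_plus[symmetric] del: ennreal_plus)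
  qed
  also have "\<dots> \<le> ennreal (exp (1/8)) + ennreal (exp (1/8))"
    using mgf[of l] mgf[of "-l"] l l8 by (subst nn_integral_add) (auto intro!: add_mono simp: m_def)
  also have "\<dots> \<le> ennreal 4"
  proof -
    have "exp (1/8::real) \<le> 1 + 1/8 + (1/8)\<^sup>2" by (rule exp_bound) auto
    then have "exp (1/8::real) + exp (1/8) \<le> 4" by (simp add: power2_eq_square)
    then have "ennreal (exp (1/8) + exp (1/8)) \<le> ennreal 4" by (rule ennreal_leI)
    then show ?thesis by (simp only: ennreal_plus exp_ge_zero)
  qed
  finally have "l * expectation (\<lambda>\<omega>. \<bar>g \<omega> - m\<bar>) \<le> 4" by (subst (asm) ennreal_le_iff) auto
  then show ?thesis using c cL by (simp add: l_def m_def field_simps)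
qed

lemma concentration_tail:
  assumes c: "c > 0" and d: "\<delta> > 0"
  shows "prob {\<omega> \<in> space M. \<delta> \<le> \<bar>g \<omega> - expectation g\<bar>} \<le> 2 * exp (- 2 * \<delta>\<^sup>2 / (card L * c\<^sup>2))"
proof -
  define m where "m = expectation g"
  have cL: "0 < real (card L)" using fin ne by (simp add: card_gt_0_iff)
  define v where "v = card L * c\<^sup>2"
  have v: "v > 0" using cL c by (simp add: v_def)
  \<comment> \<open>The minimiser of \<open>- l \<delta> + l^2 v / 8\<close> in the Chernoff bound,
    with minimum \<open>- 2 \<delta>^2 / v\<close>.\<close>
  define l where "l = 4 * \<delta> / v"
  have l: "l > 0" using v d by (simp add: l_def)
  have ex: "l\<^sup>2 * card L * c\<^sup>2 / 8 = 2 * \<delta>\<^sup>2 / v"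
  proof -
    have "l\<^sup>2 * card L * c\<^sup>2 / 8 = l\<^sup>2 * v / 8" by (simp add: v_def)
    also have "\<dots> = 2 * \<delta>\<^sup>2 / v" using v by (simp add: l_def power2_eq_square field_simps)
    finally show ?thesis .
  qed
  have one: "emeasure M {\<omega> \<in> space M. \<delta> \<le> s * (g \<omega> - m)} \<le> ennreal (exp (- 2 * \<delta>\<^sup>2 / v))" if s: "s = 1 \<or> s = -1" for s
  proof -
    have "emeasure M {\<omega> \<in> space M. \<delta> \<le> s * (g \<omega> - m)} = emeasure M ({\<omega> \<in> space M. 1 \<le> ennreal (exp (- l * \<delta>)) * ennreal (exp (l * s * (g \<omega> - m)))} )"
    proof (intro arg_cong[where f="emeasure M"] Collect_cong conj_cong refl)
      fix \<omega>
      have "1 \<le> ennreal (exp (- l * \<delta>)) * ennreal (exp (l * s * (g \<omega> - m))) \<longleftrightarrow> 0 \<le> l * (s * (g \<omega> - m) - \<delta>)"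
        by (simp add: ennreal_mult[symmetric] exp_add[symmetric] algebra_simps)
      also have "\<dots> \<longleftrightarrow> \<delta> \<le> s * (g \<omega> - m)" using l by (simp add: zero_le_mult_iff)
      finally show "(\<delta> \<le> s * (g \<omega> - m)) = (1 \<le> ennreal (exp (- l * \<delta>)) * ennreal (exp (l * s * (g \<omega> - m))))" by simp
    qed
    also have "\<dots> \<le> ennreal (exp (- l * \<delta>)) * (\<integral>\<^sup>+\<omega>. ennreal (exp (l * s * (g \<omega> - m))) * indicator (space M) \<omega> \<partial>M)"
      by (intro nn_integral_Markov_inequality) measurable
    also have "(\<integral>\<^sup>+\<omega>. ennreal (exp (l * s * (g \<omega> - m))) * indicator (space M) \<omega> \<partial>M) = (\<integral>\<^sup>+\<omega>. ennreal (exp (l * s * (g \<omega> - m))) \<partial>M)"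
      by (intro nn_integral_cong) auto
    also have "\<dots> \<le> ennreal (exp (2 * \<delta>\<^sup>2 / v))"
      using mgf[of "l * s"] l s ex by (auto simp: m_def power_mult_distrib)
    also have "ennreal (exp (- l * \<delta>)) * \<dots> = ennreal (exp (- 2 * \<delta>\<^sup>2 / v))"
      using v by (simp add: ennreal_mult[symmetric] exp_add[symmetric] l_def power2_eq_square field_simps)
    finally show ?thesis by (simp add: mult_left_mono)
  qed
  have "emeasure M {\<omega> \<in> space M. \<delta> \<le> \<bar>g \<omega> - m\<bar>} \<le>
     emeasure M ({\<omega> \<in> space M. \<delta> \<le> 1 * (g \<omega> - m)} \<union> {\<omega> \<in> space M. \<delta> \<le> (-1) * (g \<omega> - m)})"
    by (intro emeasure_mono) auto
  also have "\<dots> \<le> emeasure M {\<omega> \<in> space M. \<delta> \<le> 1 * (g \<omega> - m)} + emeasure M {\<omega> \<in> space M. \<delta> \<le> (-1) * (g \<omega> - m)}"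
    by (intro emeasure_subadditive) measurable
  also have "\<dots> \<le> ennreal (exp (- 2 * \<delta>\<^sup>2 / v)) + ennreal (exp (- 2 * \<delta>\<^sup>2 / v))"
    by (intro add_mono one) auto
  also have "\<dots> = ennreal (2 * exp (- 2 * \<delta>\<^sup>2 / v))" by (simp flip: ennreal_plus)
  finally show ?thesis by (simp add: emeasure_eq_measure m_def v_def)
qed

end

section \<open>Gaussian quadratic forms and determinants\<close>

lemma det_measurable:
  assumes c: "\<And>\<omega>. S \<omega> \<in> carrier_mat n n"
    and m: "\<And>i j. i < n \<Longrightarrow> j < n \<Longrightarrow> (\<lambda>\<omega>. S \<omega> $$ (i,j)) \<in> borel_measurable M"
  shows "(\<lambda>\<omega>. Determinant.det (S \<omega> :: real mat)) \<in> borel_measurable M"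
  unfolding det_def'[OF c]
  by (intro borel_measurable_sum borel_measurable_times borel_measurable_prod borel_measurable_const m)
    (auto simp: permutes_in_image[THEN iffD2, of _ "{0..<n}", simplified])

lemma det_tendsto:
  assumes c: "\<And>k. S k \<in> carrier_mat n n" "S0 \<in> carrier_mat n n"
    and m: "\<And>i j. i < n \<Longrightarrow> j < n \<Longrightarrow> ((\<lambda>k. S k $$ (i,j)) \<longlongrightarrow> S0 $$ (i,j)) F"
  shows "((\<lambda>k. Determinant.det (S k :: real mat)) \<longlongrightarrow> Determinant.det S0) F"
  unfolding det_def'[OF c(1)] det_def'[OF c(2)]
  by (intro tendsto_sum tendsto_mult tendsto_prod tendsto_const m)
    (auto simp: permutes_in_image[THEN iffD2, of _ "{0..<n}", simplified])

lemma mat_delete_entry: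
  assumes "S \<in> carrier_mat n n" "i' < n - 1" "j' < n - 1"
  shows "mat_delete S i j $$ (i', j') = S $$ (if i' < i then i' else Suc i', if j' < j then j' else Suc j')"
  using assms by (simp add: mat_delete_def)

lemma minv_entry:
  assumes "S \<in> carrier_mat n n" "i < n" "j < n"
  shows "minv S $$ (i,j) = 1 / Determinant.det S * ((-1) ^ (j + i) * Determinant.det (mat_delete S j i))"
  using assms by (simp add: minv_def adj_mat_def cofactor_def)

lemma minv_measurable:
  assumes c: "\<And>\<omega>. S \<omega> \<in> carrier_mat n n"
    and m: "\<And>i j. i < n \<Longrightarrow> j < n \<Longrightarrow> (\<lambda>\<omega>. S \<omega> $$ (i,j)) \<in> borel_measurable M"
    and ij: "i < n" "j < n"
  shows "(\<lambda>\<omega>. minv (S \<omega>) $$ (i,j)) \<in> borel_measurable M"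
  unfolding minv_entry[OF c ij]
proof (intro borel_measurable_times borel_measurable_divide borel_measurable_const)
  show "(\<lambda>\<omega>. Determinant.det (S \<omega>)) \<in> borel_measurable M" by (rule det_measurable[OF c m])
  show "(\<lambda>\<omega>. Determinant.det (mat_delete (S \<omega>) j i)) \<in> borel_measurable M"
    by (rule det_measurable[OF mat_delete_carrier[OF c]]) (auto simp: mat_delete_entry[OF c] intro!: m)
qed

lemma minv_tendsto:
  assumes c: "\<And>k. S k \<in> carrier_mat n n" "S0 \<in> carrier_mat n n"
    and m: "\<And>i j. i < n \<Longrightarrow> j < n \<Longrightarrow> ((\<lambda>k. S k $$ (i,j)) \<longlongrightarrow> S0 $$ (i,j)) F"
    and d: "Determinant.det S0 \<noteq> 0" and ij: "i < n" "j < n"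
  shows "((\<lambda>k. minv (S k) $$ (i,j)) \<longlongrightarrow> minv S0 $$ (i,j)) F"
  unfolding minv_entry[OF c(1) ij] minv_entry[OF c(2) ij]
proof (intro tendsto_mult tendsto_divide tendsto_const d)
  show "((\<lambda>k. Determinant.det (S k)) \<longlongrightarrow> Determinant.det S0) F" by (rule det_tendsto[OF c m])
  show "((\<lambda>k. Determinant.det (mat_delete (S k) j i)) \<longlongrightarrow> Determinant.det (mat_delete S0 j i)) F"
    by (rule det_tendsto[OF mat_delete_carrier[OF c(1)] mat_delete_carrier[OF c(2)]])
      (auto simp: mat_delete_entry[OF c(1)] mat_delete_entry[OF c(2)] intro!: m)
qed

text \<open>Fubini for the product law of \<open>A\<close> and \<open>B\<close>: a bound with the
  first variable frozen survives averaging. Nonnegative integrals avoid any prior integrability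
  claim.\<close>

lemma (in prob_space) nn_integral_indep_var_le:
  assumes ind: "indep_var S A T B" and F: "F \<in> borel_measurable (S \<Otimes>\<^sub>M T)"
    and le: "\<And>x. x \<in> space S \<Longrightarrow> (\<integral>\<^sup>+\<omega>. F (x, B \<omega>) \<partial>M) \<le> C"
  shows "(\<integral>\<^sup>+\<omega>. F (A \<omega>, B \<omega>) \<partial>M) \<le> C"
proof -
  from ind have A[measurable]: "A \<in> M \<rightarrow>\<^sub>M S" and B[measurable]: "B \<in> M \<rightarrow>\<^sub>M T"
    and eq: "distr M S A \<Otimes>\<^sub>M distr M T B = distr M (S \<Otimes>\<^sub>M T) (\<lambda>x. (A x, B x))"
    unfolding indep_var_distribution_eq by auto
  interpret dA: prob_space "distr M S A" by (rule prob_space_distr) simp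
  interpret dB: prob_space "distr M T B" by (rule prob_space_distr) simp
  have "(\<integral>\<^sup>+\<omega>. F (A \<omega>, B \<omega>) \<partial>M) = (\<integral>\<^sup>+z. F z \<partial>distr M (S \<Otimes>\<^sub>M T) (\<lambda>x. (A x, B x)))"
    using F by (subst nn_integral_distr) auto
  also have "\<dots> = (\<integral>\<^sup>+x. \<integral>\<^sup>+y. F (x, y) \<partial>distr M T B \<partial>distr M S A)"
    unfolding eq[symmetric] using F by (subst dB.nn_integral_fst[symmetric]) auto
  also have "\<dots> = (\<integral>\<^sup>+x. \<integral>\<^sup>+\<omega>. F (x, B \<omega>) \<partial>M \<partial>distr M S A)"
  proof (intro nn_integral_cong)
    fix x assume "x \<in> space (distr M S A)"
    then have "(\<lambda>y. F (x, y)) \<in> borel_measurable T" using F by simp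
    then show "(\<integral>\<^sup>+y. F (x, y) \<partial>distr M T B) = (\<integral>\<^sup>+\<omega>. F (x, B \<omega>) \<partial>M)"
      by (intro nn_integral_distr) auto
  qed
  also have "\<dots> \<le> (\<integral>\<^sup>+x. C \<partial>distr M S A)"
    using le by (intro nn_integral_mono) simp
  also have "\<dots> = C" using dA.emeasure_space_1 by simp
  finally show ?thesis .
qed

text \<open>The probabilists' Hermite polynomials of degree 0, 1 and 2, the only degrees that
  occur.\<close>

definition hermite :: "nat \<Rightarrow> real \<Rightarrow> real" where
  "hermite k x = (if k = 0 then 1 else if k = 1 then x else x\<^sup>2 - 1)"

lemma hermite_meas[measurable]: "hermite k \<in> borel_measurable borel"
  unfolding hermite_def[abs_def] by measurable

context prob_space
begin

section \<open>Gaussian moments and quadratic forms\<close>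

lemma std_normal_power:
  assumes Z: "distributed M lborel Z std_normal_density"
  shows "integrable M (\<lambda>\<omega>. Z \<omega> ^ k)" "expectation (\<lambda>\<omega>. Z \<omega> ^ k) = (\<integral>x. std_normal_density x * x ^ k \<partial>lborel)"
  using distributed_integrable[OF Z, of "\<lambda>x. x ^ k"] distributed_integral[OF Z, of "\<lambda>x. x ^ k"]
    integrable_std_normal_moment[of k] by auto

lemma std_normal_moments:
  assumes Z: "distributed M lborel Z std_normal_density"
  shows "integrable M Z" "integrable M (\<lambda>\<omega>. (Z \<omega>)\<^sup>2)" "integrable M (\<lambda>\<omega>. (Z \<omega>) ^ 3)" "integrable M (\<lambda>\<omega>. (Z \<omega>) ^ 4)"
    "expectation Z = 0" "expectation (\<lambda>\<omega>. (Z \<omega>)\<^sup>2) = 1" "expectation (\<lambda>\<omega>. (Z \<omega>) ^ 3) = 0" "expectation (\<lambda>\<omega>. (Z \<omega>) ^ 4) = 3"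
proof -
  note p = std_normal_power[OF Z]
  show "integrable M Z" using p(1)[of 1] by simp
  show "integrable M (\<lambda>\<omega>. (Z \<omega>)\<^sup>2)" "integrable M (\<lambda>\<omega>. (Z \<omega>) ^ 3)" "integrable M (\<lambda>\<omega>. (Z \<omega>) ^ 4)" by (rule p)+
  show "expectation Z = 0" using p(2)[of 1] integral_std_normal_moment_odd[of 0] by simp
  show "expectation (\<lambda>\<omega>. (Z \<omega>)\<^sup>2) = 1" using p(2)[of 2] integral_std_normal_moment_even[of 1] by simp
  show "expectation (\<lambda>\<omega>. (Z \<omega>) ^ 3) = 0" using p(2)[of 3] integral_std_normal_moment_odd[of 1] by (simp add: eval_nat_numeral)
  show "expectation (\<lambda>\<omega>. (Z \<omega>) ^ 4) = 3" using p(2)[of 4] integral_std_normal_moment_even[of 2] by (simp add: fact_numeral)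
qed

text \<open>Products of two polynomials of degree at most 2 involve only the moments of orders one
  to four, which are 0, 1, 0, 3.\<close>

lemma hermite_orthogonal:
  assumes Z: "distributed M lborel Z std_normal_density" and k: "k \<le> 2" "l \<le> 2"
  shows "integrable M (\<lambda>\<omega>. hermite k (Z \<omega>) * hermite l (Z \<omega>))"
    "expectation (\<lambda>\<omega>. hermite k (Z \<omega>) * hermite l (Z \<omega>)) = (if k = l then fact k else 0)"
proof -
  note m = std_normal_moments[OF Z]
  have e: "(x\<^sup>2 - 1)\<^sup>2 = x ^ 4 - 2 * x\<^sup>2 + 1" "(x\<^sup>2 - 1) * (x\<^sup>2 - 1) = x ^ 4 - 2 * x\<^sup>2 + 1" "x * (x\<^sup>2 - 1) = x ^ 3 - x" "(x\<^sup>2 - 1) * x = x ^ 3 - x" "x * x = x\<^sup>2" for x :: real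
    by (simp_all add: power2_eq_square eval_nat_numeral algebra_simps)
  have kl: "k \<in> {0, 1, 2}" "l \<in> {0, 1, 2}" using k by auto
  show "integrable M (\<lambda>\<omega>. hermite k (Z \<omega>) * hermite l (Z \<omega>))"
    using kl m unfolding hermite_def by (auto simp: e)
  show "expectation (\<lambda>\<omega>. hermite k (Z \<omega>) * hermite l (Z \<omega>)) = (if k = l then fact k else 0)"
    using kl m unfolding hermite_def by (auto simp: e prob_space)
qed

text \<open>The centred products are products of Hermite polynomials and hence orthogonal.\<close>

lemma gaussian_quadratic_form:
  fixes Z :: "'v \<Rightarrow> 'a \<Rightarrow> real" and R :: "'v \<Rightarrow> 'v \<Rightarrow> real"
  assumes V: "finite V" and ind: "indep_vars (\<lambda>_. borel) Z V"
    and N: "\<And>v. v \<in> V \<Longrightarrow> distributed M lborel (Z v) std_normal_density"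
  defines "Q \<equiv> \<lambda>\<omega>. \<Sum>u\<in>V. \<Sum>v\<in>V. R u v * (Z u \<omega> * Z v \<omega> - (if u = v then 1 else 0))"
  shows "(\<integral>\<^sup>+\<omega>. ennreal ((Q \<omega>)\<^sup>2) \<partial>M) \<le> ennreal (2 * (\<Sum>u\<in>V. \<Sum>v\<in>V. (R u v)\<^sup>2))"
proof -
  \<comment> \<open>\<open>\<alpha> p w\<close> is the multiplicity of \<open>w\<close> in the pair
    \<open>p\<close>. Degree 0 gives the factor 1, so the product over all of \<open>V\<close> in
    \<open>\<psi> p\<close> is the centred product of the two variables of \<open>p\<close>.\<close>
  define \<alpha> :: "'v \<times> 'v \<Rightarrow> 'v \<Rightarrow> nat" where
    "\<alpha> p w = (if w = fst p then 1 else 0) + (if w = snd p then 1 else 0)" for p w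
  define \<psi> where "\<psi> p \<omega> = (\<Prod>w\<in>V. hermite (\<alpha> p w) (Z w \<omega>))" for p \<omega>
  define P where "P = V \<times> V"
  have P: "finite P" using V by (simp add: P_def)
  have \<alpha>2: "\<alpha> p w \<le> 2" for p w by (simp add: \<alpha>_def)
  have \<psi>: "\<psi> p \<omega> = Z (fst p) \<omega> * Z (snd p) \<omega> - (if fst p = snd p then 1 else 0)" if "p \<in> P" for p \<omega>
  proof -
    have p: "fst p \<in> V" "snd p \<in> V" using that by (auto simp: P_def)
    have "\<psi> p \<omega> = (\<Prod>w\<in>{fst p, snd p}. hermite (\<alpha> p w) (Z w \<omega>))"
      unfolding \<psi>_def using V p by (intro prod.mono_neutral_right) (auto simp: \<alpha>_def hermite_def)
    then show ?thesis by (cases "fst p = snd p") (auto simp: \<alpha>_def hermite_def power2_eq_square)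
  qed
  have indp: "indep_vars (\<lambda>_. borel) (\<lambda>w \<omega>. hermite (\<alpha> p w) (Z w \<omega>) * hermite (\<alpha> q w) (Z w \<omega>)) V" for p q
    by (rule indep_vars_compose2[OF ind, where Y="\<lambda>w x. hermite (\<alpha> p w) x * hermite (\<alpha> q w) x"]) measurable
  have \<psi>\<psi>: "(\<lambda>\<omega>. \<psi> p \<omega> * \<psi> q \<omega>) = (\<lambda>\<omega>. \<Prod>w\<in>V. hermite (\<alpha> p w) (Z w \<omega>) * hermite (\<alpha> q w) (Z w \<omega>))" for p q
    by (simp add: \<psi>_def prod.distrib)
  have int: "integrable M (\<lambda>\<omega>. \<psi> p \<omega> * \<psi> q \<omega>)" for p q
    unfolding \<psi>\<psi> by (rule indep_vars_integrable[OF V indp]) (rule hermite_orthogonal(1)[OF N \<alpha>2 \<alpha>2])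
  \<comment> \<open>Distinct pairs correlate only if they are swaps of each other. On a pair with
    equal entries both indicators are 1 and add up to \<open>2!\<close>, the squared norm of the
    quadratic Hermite polynomial.\<close>
  have E: "expectation (\<lambda>\<omega>. \<psi> p \<omega> * \<psi> q \<omega>) = (if q = p then 1 else 0) + (if q = prod.swap p then 1 else 0)"
    if p: "p \<in> P" and q: "q \<in> P" for p q
  proof -
    have pV: "fst p \<in> V" "snd p \<in> V" "fst q \<in> V" "snd q \<in> V" using p q by (auto simp: P_def)
    have E1: "expectation (\<lambda>\<omega>. \<psi> p \<omega> * \<psi> q \<omega>) = (\<Prod>w\<in>V. expectation (\<lambda>\<omega>. hermite (\<alpha> p w) (Z w \<omega>) * hermite (\<alpha> q w) (Z w \<omega>)))"
      unfolding \<psi>\<psi> by (rule indep_vars_lebesgue_integral[OF V indp]) (rule hermite_orthogonal(1)[OF N \<alpha>2 \<alpha>2])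
    have E2: "(\<Prod>w\<in>V. expectation (\<lambda>\<omega>. hermite (\<alpha> p w) (Z w \<omega>) * hermite (\<alpha> q w) (Z w \<omega>)))
      = (\<Prod>w\<in>V. if \<alpha> p w = \<alpha> q w then fact (\<alpha> p w) else 0)"
      by (rule prod.cong[OF refl]) (rule hermite_orthogonal(2)[OF N \<alpha>2 \<alpha>2])
    have E3: "(\<Prod>w\<in>V. if \<alpha> p w = \<alpha> q w then fact (\<alpha> p w) else 0) = ((if q = p then 1 else 0) + (if q = prod.swap p then 1 else 0) :: real)"
    proof (cases "q = p \<or> q = prod.swap p")
      case True
      have "\<alpha> (prod.swap p) w = \<alpha> p w" for w by (simp add: \<alpha>_def)
      then have "\<alpha> q = \<alpha> p" using True by (metis ext)
      then have "(\<Prod>w\<in>V. if \<alpha> p w = \<alpha> q w then fact (\<alpha> p w) else 0) = (\<Prod>w\<in>V. fact (\<alpha> p w) :: real)" by simp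
      also have "\<dots> = (\<Prod>w\<in>{fst p, snd p}. fact (\<alpha> p w))"
        using V pV by (intro prod.mono_neutral_right) (auto simp: \<alpha>_def)
      also have "\<dots> = (if fst p = snd p then 2 else 1)"
        by (cases "fst p = snd p") (auto simp: \<alpha>_def)
      finally have *: "(\<Prod>w\<in>V. if \<alpha> p w = \<alpha> q w then fact (\<alpha> p w) else 0) = (if fst p = snd p then 2 else 1 :: real)" .
      have "q = p \<and> q = prod.swap p \<longleftrightarrow> fst p = snd p" using True by (cases p; cases q) auto
      then show ?thesis unfolding * using True by auto
    next
      case False
      have "\<exists>w\<in>V. \<alpha> p w \<noteq> \<alpha> q w"
      proof (rule ccontr)
        assume "\<not> ?thesis"
        then have eq: "\<alpha> p w = \<alpha> q w" if "w \<in> V" for w using that by auto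
        from eq[OF pV(1)] eq[OF pV(2)] eq[OF pV(3)] eq[OF pV(4)] False show False
          by (cases p; cases q) (auto simp: \<alpha>_def split: if_splits)
      qed
      then have "(\<Prod>w\<in>V. if \<alpha> p w = \<alpha> q w then fact (\<alpha> p w) else 0) = (0::real)"
        using V by (auto simp: prod_zero_iff)
      then show ?thesis using False by simp
    qed
    show ?thesis unfolding E1 E2 E3 ..
  qed
  define r where "r p = R (fst p) (snd p)" for p
  have Q: "Q \<omega> = (\<Sum>p\<in>P. r p * \<psi> p \<omega>)" for \<omega>
    unfolding Q_def P_def r_def by (simp add: sum.cartesian_product case_prod_beta) (intro sum.cong refl, simp add: \<psi> P_def)
  have Q2: "(Q \<omega>)\<^sup>2 = (\<Sum>p\<in>P. \<Sum>q\<in>P. r p * r q * (\<psi> p \<omega> * \<psi> q \<omega>))" for \<omega>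
    unfolding Q power2_eq_square sum_product by (intro sum.cong refl) (simp add: mult_ac)
  have intQ: "integrable M (\<lambda>\<omega>. (Q \<omega>)\<^sup>2)"
    unfolding Q2 by (intro Bochner_Integration.integrable_sum integrable_mult_right int)
  have "expectation (\<lambda>\<omega>. (Q \<omega>)\<^sup>2) = (\<Sum>p\<in>P. \<Sum>q\<in>P. r p * r q * expectation (\<lambda>\<omega>. \<psi> p \<omega> * \<psi> q \<omega>))"
    unfolding Q2 using int by (simp add: Bochner_Integration.integral_sum)
  also have "\<dots> = (\<Sum>p\<in>P. \<Sum>q\<in>P. (if q = p then r p * r q else 0) + (if q = prod.swap p then r p * r q else 0))"
    by (intro sum.cong refl) (simp add: E algebra_simps)
  also have "\<dots> = (\<Sum>p\<in>P. r p * r p + r p * r (prod.swap p))"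
  proof (intro sum.cong refl)
    fix p assume "p \<in> P"
    then have "prod.swap p \<in> P" by (auto simp: P_def)
    then show "(\<Sum>q\<in>P. (if q = p then r p * r q else 0) + (if q = prod.swap p then r p * r q else 0)) = r p * r p + r p * r (prod.swap p)"
      using P \<open>p \<in> P\<close> by (simp add: sum.distrib)
  qed
  \<comment> \<open>The coefficients may be asymmetric; the cross term with the swapped pair is
    bounded by the mean of the two squares.\<close>
  also have "\<dots> \<le> (\<Sum>p\<in>P. (r p)\<^sup>2 + ((r p)\<^sup>2 + (r (prod.swap p))\<^sup>2) / 2)"
  proof (intro sum_mono)
    fix p
    have "0 \<le> (r p - r (prod.swap p))\<^sup>2" by simp
    then show "r p * r p + r p * r (prod.swap p) \<le> (r p)\<^sup>2 + ((r p)\<^sup>2 + (r (prod.swap p))\<^sup>2) / 2"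
      by (simp add: power2_eq_square algebra_simps)
  qed
  also have "\<dots> = (\<Sum>p\<in>P. (r p)\<^sup>2) + ((\<Sum>p\<in>P. (r p)\<^sup>2) + (\<Sum>p\<in>P. (r (prod.swap p))\<^sup>2)) / 2"
    by (simp only: sum.distrib sum_divide_distrib[symmetric])
  also have "(\<Sum>p\<in>P. (r (prod.swap p))\<^sup>2) = (\<Sum>p\<in>P. (r p)\<^sup>2)"
    by (rule sum.reindex_bij_witness[of _ prod.swap prod.swap]) (auto simp: P_def)
  also have "(\<Sum>p\<in>P. (r p)\<^sup>2) + ((\<Sum>p\<in>P. (r p)\<^sup>2) + (\<Sum>p\<in>P. (r p)\<^sup>2)) / 2 = 2 * (\<Sum>u\<in>V. \<Sum>v\<in>V. (R u v)\<^sup>2)"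
    by (simp add: P_def r_def sum.cartesian_product case_prod_beta)
  finally show ?thesis
    using intQ by (subst nn_integral_eq_integral) (auto intro: ennreal_leI)
qed

text \<open>The pointwise inequality \<open>2 r |Q| \<le> Q^2 + r^2\<close> at
  \<open>r = sqrt s\<close> replaces Cauchy-Schwarz and stays within nonnegative integrals.\<close>

lemma nn_integral_abs_le_sqrt:
  fixes Q :: "'a \<Rightarrow> real"
  assumes [measurable]: "Q \<in> borel_measurable M" and le: "(\<integral>\<^sup>+\<omega>. ennreal ((Q \<omega>)\<^sup>2) \<partial>M) \<le> ennreal s" and s: "0 < s"
  shows "(\<integral>\<^sup>+\<omega>. ennreal \<bar>Q \<omega>\<bar> \<partial>M) \<le> ennreal (sqrt s)"
proof -
  define r where "r = sqrt s"
  have r: "r > 0" "r\<^sup>2 = s" using s by (auto simp: r_def)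
  have "(\<integral>\<^sup>+\<omega>. ennreal \<bar>Q \<omega>\<bar> \<partial>M) \<le> (\<integral>\<^sup>+\<omega>. ennreal (1 / (2 * r)) * ennreal ((Q \<omega>)\<^sup>2) + ennreal (r / 2) \<partial>M)"
  proof (intro nn_integral_mono)
    fix \<omega>
    have "0 \<le> (\<bar>Q \<omega>\<bar> - r)\<^sup>2" by simp
    then have "\<bar>Q \<omega>\<bar> \<le> (1 / (2 * r)) * (Q \<omega>)\<^sup>2 + r / 2"
      using r(1) by (simp add: power2_diff field_simps power2_eq_square)
    then show "ennreal \<bar>Q \<omega>\<bar> \<le> ennreal (1 / (2 * r)) * ennreal ((Q \<omega>)\<^sup>2) + ennreal (r / 2)"
      using r(1) by (simp add: ennreal_mult[symmetric] ennreal_plus[symmetric] del: ennreal_plus)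
  qed
  also have "\<dots> = ennreal (1 / (2 * r)) * (\<integral>\<^sup>+\<omega>. ennreal ((Q \<omega>)\<^sup>2) \<partial>M) + ennreal (r / 2)"
    by (simp add: nn_integral_add nn_integral_cmult emeasure_space_1)
  also have "\<dots> \<le> ennreal (1 / (2 * r)) * ennreal s + ennreal (r / 2)"
    by (intro add_mono mult_left_mono le) auto
  also have "\<dots> = ennreal r"
    using r by (simp add: ennreal_mult[symmetric] ennreal_plus[symmetric] r(2)[symmetric] power2_eq_square del: ennreal_plus)
  finally show ?thesis by (simp add: r_def)
qed

section \<open>Almost sure invertibility\<close>

lemma distributed_lborel_singleton:
  assumes Z: "distributed M lborel Z f"
  shows "emeasure M {\<omega> \<in> space M. Z \<omega> = c} = 0"
proof -
  have "emeasure M (Z -` {c} \<inter> space M) = (\<integral>\<^sup>+x. f x * indicator {c} x \<partial>lborel)"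
    using Z by (rule distributed_emeasure) simp
  also have "\<dots> = 0"
    by (intro nn_integral_null_set finite_imp_null_set_lborel) simp
  finally show ?thesis by (simp add: vimage_def Int_def conj_commute)
qed

text \<open>A leading minor is affine in its corner entry, with the preceding minor as slope.\<close>

lemma det_gaussian_nonzero:
  fixes Z :: "nat \<times> nat \<Rightarrow> 'a \<Rightarrow> real"
  assumes ind: "indep_vars (\<lambda>_. borel) Z ({..<n} \<times> {..<n})"
    and N: "\<And>v. v \<in> {..<n} \<times> {..<n} \<Longrightarrow> distributed M lborel (Z v) std_normal_density"
  shows "k \<le> n \<Longrightarrow> AE \<omega> in M. Determinant.det (mat k k (\<lambda>p. Z p \<omega>)) \<noteq> 0"
proof (induction k)
  case 0
  then show ?case by (simp add: det_dim_zero)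
next
  case (Suc k)
  then have IH: "AE \<omega> in M. Determinant.det (mat k k (\<lambda>p. Z p \<omega>)) \<noteq> 0" and k: "k < n" by simp_all
  define J where "J = {..k} \<times> {..k} - {(k, k)}"
  define S where "S x b = mat (Suc k) (Suc k) (\<lambda>p. if p = (k, k) then b else x p)" for x :: "nat \<times> nat \<Rightarrow> real" and b :: real
  define D where "D x = Determinant.det (mat k k x)" for x :: "nat \<times> nat \<Rightarrow> real"
  have S_c: "S x b \<in> carrier_mat (Suc k) (Suc k)" for x b by (simp add: S_def)
  have det_diff: "Determinant.det (S x b) - Determinant.det (S x b') = (b - b') * D x" for x b b'
  proof -
    have cof: "cofactor (S x b) k j = cofactor (S x b') k j" if "j < Suc k" for j
    proof -
      have "mat_delete (S x b) k j = mat_delete (S x b') k j"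
        by (intro eq_matI) (auto simp: S_def mat_delete_def)
      then show ?thesis by (simp add: cofactor_def)
    qed
    have "Determinant.det (S x b) - Determinant.det (S x b')
       = (\<Sum>j<Suc k. (S x b $$ (k,j) - S x b' $$ (k,j)) * cofactor (S x b) k j)"
      using laplace_expansion_row[OF S_c, of k x b] laplace_expansion_row[OF S_c, of k x b'] cof
      by (simp add: left_diff_distrib sum_subtractf)
    also have "\<dots> = (\<Sum>j\<in>{k}. (S x b $$ (k,j) - S x b' $$ (k,j)) * cofactor (S x b) k j)"
      by (intro sum.mono_neutral_right) (auto simp: S_def)
    also have "\<dots> = (b - b') * cofactor (S x b) k k" by (simp add: S_def)
    also have "mat_delete (S x b) k k = mat k k x"
      by (intro eq_matI) (auto simp: S_def mat_delete_def)
    then have "cofactor (S x b) k k = D x" by (simp add: cofactor_def D_def)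
    finally show ?thesis .
  qed
  have indv: "indep_var (PiM J (\<lambda>_. borel)) (\<lambda>\<omega>. \<lambda>i\<in>J. Z i \<omega>) (PiM {(k,k)} (\<lambda>_. borel)) (\<lambda>\<omega>. \<lambda>i\<in>{(k,k)}. Z i \<omega>)"
    using k by (intro indep_var_restrict[OF ind]) (auto simp: J_def)
  \<comment> \<open>The indicator of the event that the new minor vanishes although the preceding
    one does not, as a function of the other entries and of the corner entry, which are
    independent.\<close>
  define F where "F z = (indicator {z. D (fst z) \<noteq> 0 \<and> Determinant.det (S (fst z) (snd z (k,k))) = 0} z :: ennreal)"
    for z :: "(nat \<times> nat \<Rightarrow> real) \<times> (nat \<times> nat \<Rightarrow> real)"
  let ?PP = "PiM J (\<lambda>_. borel) \<Otimes>\<^sub>M PiM {(k,k)} (\<lambda>_. borel)"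
  have comp: "(\<lambda>z. fst z p) \<in> borel_measurable ?PP" if "p \<in> J" for p
    using that by (intro measurable_compose[OF measurable_fst measurable_component_singleton]) auto
  have comp2: "(\<lambda>z. snd z (k,k)) \<in> borel_measurable ?PP"
    by (intro measurable_compose[OF measurable_snd measurable_component_singleton]) auto
  have m1[measurable]: "(\<lambda>z. D (fst z)) \<in> borel_measurable ?PP"
    unfolding D_def by (rule det_measurable[where n=k]) (auto simp: J_def intro!: comp)
  have m2[measurable]: "(\<lambda>z. Determinant.det (S (fst z) (snd z (k,k)))) \<in> borel_measurable ?PP"
  proof (rule det_measurable[where n="Suc k"])
    fix i j assume ij: "i < Suc k" "j < Suc k"
    show "(\<lambda>z. S (fst z) (snd z (k,k)) $$ (i,j)) \<in> borel_measurable ?PP"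
    proof (cases "(i,j) = (k,k)")
      case False
      then show ?thesis using ij comp[of "(i,j)"] by (auto simp: S_def J_def)
    qed (use comp2 in \<open>simp add: S_def\<close>)
  qed (rule S_c)
  have F_meas: "(\<lambda>z. F z :: ennreal) \<in> borel_measurable ?PP"
  proof -
    have "F = (\<lambda>z. if D (fst z) \<noteq> 0 \<and> Determinant.det (S (fst z) (snd z (k,k))) = 0 then 1 else 0)"
      by (auto simp: F_def fun_eq_iff)
    then show ?thesis by (simp only:) measurable
  qed
  have "(\<integral>\<^sup>+\<omega>. F (\<lambda>i\<in>J. Z i \<omega>, \<lambda>i\<in>{(k,k)}. Z i \<omega>) \<partial>M) \<le> 0"
  proof (rule nn_integral_indep_var_le[OF indv F_meas])
    fix x :: "nat \<times> nat \<Rightarrow> real"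
    \<comment> \<open>The only zero of the affine function when its slope \<open>D x\<close> is
      nonzero; a Gaussian variable takes this value with probability 0.\<close>
    define c where "c = - Determinant.det (S x 0) / D x"
    have Zkk: "distributed M lborel (Z (k,k)) std_normal_density" using k by (intro N) auto
    then have [measurable]: "Z (k,k) \<in> borel_measurable M" by (auto simp: distributed_def)
    have "(\<integral>\<^sup>+\<omega>. F (x, \<lambda>i\<in>{(k,k)}. Z i \<omega>) \<partial>M) \<le> (\<integral>\<^sup>+\<omega>. indicator {\<omega> \<in> space M. Z (k,k) \<omega> = c} \<omega> \<partial>M)"
    proof (intro nn_integral_mono)
      fix \<omega> assume \<omega>: "\<omega> \<in> space M"
      have "Z (k,k) \<omega> = c" if "D x \<noteq> 0" "Determinant.det (S x (Z (k,k) \<omega>)) = 0"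
        using det_diff[of x "Z (k,k) \<omega>" 0] that by (simp add: c_def field_simps)
      then show "F (x, \<lambda>i\<in>{(k,k)}. Z i \<omega>) \<le> indicator {\<omega> \<in> space M. Z (k,k) \<omega> = c} \<omega>"
        using \<omega> by (auto simp: F_def split: split_indicator)
    qed
    also have "\<dots> = 0" using distributed_lborel_singleton[OF Zkk, of c] by simp
    finally show "(\<integral>\<^sup>+\<omega>. F (x, \<lambda>i\<in>{(k,k)}. Z i \<omega>) \<partial>M) \<le> 0" .
  qed
  moreover have Zm: "Z p \<in> borel_measurable M" if "p \<in> {..<n} \<times> {..<n}" for p
    using ind that by (auto simp: indep_vars_def)
  have "(\<lambda>\<omega>. (\<lambda>i\<in>J. Z i \<omega>, \<lambda>i\<in>{(k,k)}. Z i \<omega>)) \<in> M \<rightarrow>\<^sub>M ?PP"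
    using k by (intro measurable_Pair measurable_restrict Zm) (auto simp: J_def)
  from measurable_compose[OF this F_meas]
  have "(\<lambda>\<omega>. F (\<lambda>i\<in>J. Z i \<omega>, \<lambda>i\<in>{(k,k)}. Z i \<omega>)) \<in> borel_measurable M" .
  ultimately have "AE \<omega> in M. F (\<lambda>i\<in>J. Z i \<omega>, \<lambda>i\<in>{(k,k)}. Z i \<omega>) = 0"
    by (simp add: nn_integral_0_iff_AE)
  with IH show ?case
  proof eventually_elim
    case (elim \<omega>)
    have "mat k k (\<lambda>i\<in>J. Z i \<omega>) = mat k k (\<lambda>p. Z p \<omega>)" by (intro eq_matI) (auto simp: J_def)
    moreover have "S (\<lambda>i\<in>J. Z i \<omega>) (Z (k,k) \<omega>) = mat (Suc k) (Suc k) (\<lambda>p. Z p \<omega>)"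
      by (intro eq_matI) (auto simp: J_def S_def less_Suc_eq_le)
    ultimately show ?case using elim by (auto simp: F_def D_def split: split_indicator_asm)
  qed
qed

end

section \<open>Traces of resolvents of Gram matrices\<close>

text \<open>The column set \<open>J\<close> varies while the scale \<open>c\<close> stays fixed, so
  that adding or leaving out a column is exactly a rank-one update.\<close>

definition gram :: "nat \<Rightarrow> nat set \<Rightarrow> real \<Rightarrow> (nat \<Rightarrow> nat \<Rightarrow> real) \<Rightarrow> real mat" where
  "gram n J c Z = mat n n (\<lambda>(i,k). c * (\<Sum>j\<in>J. Z i j * Z k j))"

definition scol :: "nat \<Rightarrow> real \<Rightarrow> (nat \<Rightarrow> nat \<Rightarrow> real) \<Rightarrow> nat \<Rightarrow> real vec" where
  "scol n c Z j = vec n (\<lambda>i. sqrt c * Z i j)"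

lemma gram_carrier[simp]: "gram n J c Z \<in> carrier_mat n n" by (simp add: gram_def)
lemma scol_carrier[simp]: "scol n c Z j \<in> carrier_vec n" by (simp add: scol_def)

lemma gram_empty: "gram n {} c Z = 0\<^sub>m n n" by (intro eq_matI) (auto simp: gram_def)

lemma gram_insert:
  assumes "finite J" "j \<notin> J" "0 \<le> c"
  shows "gram n (insert j J) c Z = gram n J c Z + outer (scol n c Z j)"
proof (intro eq_matI)
  fix i k assume ik: "i < dim_row (gram n J c Z + outer (scol n c Z j))" "k < dim_col (gram n J c Z + outer (scol n c Z j))"
  then have "i < n" "k < n" by (auto simp: outer_def scol_def)
  moreover have "sqrt c * Z i j * (sqrt c * Z k j) = c * (Z i j * Z k j)"
  proof -
    have "sqrt c * Z i j * (sqrt c * Z k j) = (sqrt c * sqrt c) * (Z i j * Z k j)" by (simp only: mult_ac)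
    then show ?thesis using assms(3) by simp
  qed
  ultimately show "gram n (insert j J) c Z $$ (i, k) = (gram n J c Z + outer (scol n c Z j)) $$ (i, k)"
    using assms(1,2) abs_of_nonneg[OF assms(3)] by (simp add: gram_def outer_def scol_def distrib_left)
qed (auto simp: outer_def scol_def gram_def)

lemma gram_cong:
  "(\<And>i j. i < n \<Longrightarrow> j \<in> J \<Longrightarrow> Z i j = Z' i j) \<Longrightarrow> gram n J c Z = gram n J c Z'"
  unfolding gram_def by (intro eq_matI) (auto intro!: sum.cong)

lemma psd_zero: "psd n (0\<^sub>m n n)"
  unfolding psd_def by (auto intro!: symmI simp: scalar_prod_def)

lemma psd_gram: assumes "finite J" "0 \<le> c" shows "psd n (gram n J c Z)"
  using assms(1) by induction (auto simp: gram_empty psd_zero gram_insert assms(2) intro!: psd_add psd_outer)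

lemma mtrace_outer_mult:
  assumes "u \<in> carrier_vec n" "S \<in> carrier_mat n n"
  shows "mtrace (outer u * S) = u \<bullet> (S *\<^sub>v u)"
proof -
  have "mtrace (outer u * S) = (\<Sum>i<n. \<Sum>k<n. u $ i * u $ k * S $$ (k, i))"
    using assms by (subst mtrace_mult[of _ n]) (auto simp: outer_def)
  also have "\<dots> = (\<Sum>k<n. \<Sum>i<n. u $ i * u $ k * S $$ (k, i))" by (rule sum.swap)
  also have "\<dots> = u \<bullet> (S *\<^sub>v u)"
    using assms by (auto simp: scalar_prod_def sum_distrib_left lessThan_atLeast0 mult_ac intro!: sum.cong)
  finally show ?thesis .
qed

lemma mtrace_gram_mult:
  assumes J: "finite J" and c: "0 \<le> c" and S: "S \<in> carrier_mat n n"
  shows "mtrace (gram n J c Z * S) = (\<Sum>j\<in>J. scol n c Z j \<bullet> (S *\<^sub>v scol n c Z j))"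
  using J
proof induction
  case empty
  then show ?case using S by (simp add: gram_empty mtrace_def)
next
  case (insert j J)
  have "mtrace (gram n (insert j J) c Z * S) = mtrace (gram n J c Z * S + outer (scol n c Z j) * S)"
    using insert c S by (simp add: gram_insert add_mult_distrib_mat[of _ n n _ _ n])
  also have "\<dots> = mtrace (gram n J c Z * S) + mtrace (outer (scol n c Z j) * S)"
    using S by (intro mtrace_add[of _ n]) auto
  finally show ?case using insert S by (simp add: mtrace_outer_mult[of _ n])
qed

lemma qf_minv_nonneg:
  assumes "pd n M" "u \<in> carrier_vec n" shows "0 \<le> u \<bullet> (minv M *\<^sub>v u)"
  using minv_outer_vec(3)[OF assms(1,2,2)] .

lemma mtrace_minv_nonneg:
  assumes "pd n M" shows "0 \<le> mtrace (minv M)"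
proof -
  have eq: "minv M $$ (i,i) = unit_vec n i \<bullet> (minv M *\<^sub>v unit_vec n i)" if "i < n" for i
  proof -
    note R = minv_carrier[OF pdD[OF assms]]
    have "unit_vec n i \<bullet> (minv M *\<^sub>v unit_vec n i) = col (minv M) i $ i"
      unfolding mat_mult_unit[OF R that] by (rule scalar_prod_left_unit[OF col_carrier_vec[OF that R] that])
    also have "\<dots> = minv M $$ (i,i)" using that carrier_matD[OF R] by (intro index_col) simp_all
    finally show ?thesis ..
  qed
  have "0 \<le> minv M $$ (i,i)" if "i < n" for i
    unfolding eq[OF that] by (rule qf_minv_nonneg[OF assms]) simp
  then show ?thesis using carrier_matD[OF minv_carrier[OF pdD[OF assms]]]
    unfolding mtrace_def by (intro sum_nonneg) simp
qed

text \<open>Since \<open>(B + S) minv (B + S)\<close> is the identity, the two traces add up to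
  \<open>n\<close>. This moves a perturbation of \<open>B\<close> out of the numerator.\<close>

lemma mtrace_complement:
  assumes B: "B \<in> carrier_mat n n" and S: "S \<in> carrier_mat n n" and pd: "pd n (B + S)"
  shows "mtrace (B * minv (B + S)) = real n - mtrace (S * minv (B + S))"
proof -
  note R = minv_carrier[OF pdD[OF pd]]
  have "mtrace (B * minv (B + S)) + mtrace (S * minv (B + S)) = mtrace ((B + S) * minv (B + S))"
    using B S R by (simp add: add_mult_distrib_mat[of _ n n _ _ n] mtrace_add[of _ n])
  also have "\<dots> = real n" using minv_right[OF pdD[OF pd] pd_det[OF pd]] by (simp add: mtrace_one)
  finally show ?thesis by simp
qed

lemma mtrace_shift_one:
  assumes "R \<in> carrier_mat n n" shows "mtrace ((t \<cdot>\<^sub>m 1\<^sub>m n) * R) = t * mtrace R"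
  using assms by (simp add: mult_smult_assoc_mat[of _ n n _ n] mtrace_smult[of _ n])

text \<open>
  The shift \<open>e > 0\<close> keeps every matrix invertible, so that the bounded differences hold everywhere and
  not only almost surely; it is sent to 0 at the end.
\<close>

locale shifted_gram =
  fixes n p m :: nat and t e :: real
  assumes npm: "0 < n" "0 < p" "0 < m" and t: "0 < t" and e: "0 < e"
begin

definition GA :: "(nat \<Rightarrow> nat \<Rightarrow> real) \<Rightarrow> real mat" where "GA x = gram n {..<p} (1 / p) x"
definition GB :: "(nat \<Rightarrow> nat \<Rightarrow> real) \<Rightarrow> real mat" where "GB y = gram n {..<m} (1 / m) y"
abbreviation "GBO y j \<equiv> gram n ({..<m} - {j}) (1 / real m) y"
definition stat :: "real mat \<Rightarrow> real mat \<Rightarrow> real" where "stat B W = mtrace (B * minv (B + t \<cdot>\<^sub>m W)) / n"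

definition he :: "(nat \<Rightarrow> nat \<Rightarrow> real) \<Rightarrow> (nat \<Rightarrow> nat \<Rightarrow> real) \<Rightarrow> real" where
  "he x y = stat (GB y) (GA x + e \<cdot>\<^sub>m 1\<^sub>m n)"
definition hI :: "(nat \<Rightarrow> nat \<Rightarrow> real) \<Rightarrow> real" where "hI y = stat (GB y) (1\<^sub>m n)"

section \<open>Range and bounded differences of the statistics\<close>

lemma psdAB: "psd n (GA x)" "psd n (GB y)" unfolding GA_def GB_def by (auto intro!: psd_gram)
lemma cAB[simp]: "GA x \<in> carrier_mat n n" "GB y \<in> carrier_mat n n" by (simp_all add: GA_def GB_def)

lemma pdA: "pd n (GA x + e \<cdot>\<^sub>m 1\<^sub>m n)"
  using e by (intro psd_add_pd psdAB pd_smult pd_one)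

lemma pd_sum: "pd n W \<Longrightarrow> psd n B \<Longrightarrow> pd n (B + t \<cdot>\<^sub>m W)"
  using t by (intro psd_add_pd pd_smult)

lemma stat_le_1_of:
  assumes W: "pd n W" and B: "psd n B" and nn: "0 \<le> mtrace (B * minv (B + t \<cdot>\<^sub>m W))" "0 \<le> mtrace (W * minv (B + t \<cdot>\<^sub>m W))"
  shows "0 \<le> stat B W" "stat B W \<le> 1"
proof -
  note pd = pd_sum[OF W B]
  have "mtrace (B * minv (B + t \<cdot>\<^sub>m W)) = real n - mtrace ((t \<cdot>\<^sub>m W) * minv (B + t \<cdot>\<^sub>m W))"
    using psdD[OF B] pdD[OF W] pd by (intro mtrace_complement) auto
  also have "mtrace ((t \<cdot>\<^sub>m W) * minv (B + t \<cdot>\<^sub>m W)) = t * mtrace (W * minv (B + t \<cdot>\<^sub>m W))"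
    using pdD[OF W] minv_carrier[OF pdD[OF pd]] by (simp add: mult_smult_assoc_mat[of _ n n _ n] mtrace_smult[of _ n])
  finally have "mtrace (B * minv (B + t \<cdot>\<^sub>m W)) \<le> real n" using nn(2) t by simp
  then show "0 \<le> stat B W" "stat B W \<le> 1" using nn npm by (auto simp: stat_def)
qed

lemma GB_nonneg: "pd n M \<Longrightarrow> 0 \<le> mtrace (GB y * minv M)"
  unfolding GB_def by (subst mtrace_gram_mult) (auto intro!: sum_nonneg qf_minv_nonneg dest: pdD)
lemma GA_nonneg: "pd n M \<Longrightarrow> 0 \<le> mtrace (GA y * minv M)"
  unfolding GA_def by (subst mtrace_gram_mult) (auto intro!: sum_nonneg qf_minv_nonneg dest: pdD)

lemma hI_range: "0 \<le> hI y" "hI y \<le> 1"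
proof -
  note M = pd_sum[OF pd_one psdAB(2), of y]
  have "0 \<le> mtrace (1\<^sub>m n * minv (GB y + t \<cdot>\<^sub>m 1\<^sub>m n))"
    using mtrace_minv_nonneg[OF M] by (simp add: left_mult_one_mat[OF minv_carrier[OF pdD[OF M]]])
  from stat_le_1_of[OF pd_one psdAB(2) GB_nonneg[OF M] this]
  show "0 \<le> hI y" "hI y \<le> 1" by (auto simp: hI_def)
qed

lemma he_range: "0 \<le> he x y" "he x y \<le> 1"
proof -
  note M = pd_sum[OF pdA psdAB(2), of y x]
  note R = minv_carrier[OF pdD[OF M]]
  have "mtrace ((GA x + e \<cdot>\<^sub>m 1\<^sub>m n) * minv (GB y + t \<cdot>\<^sub>m (GA x + e \<cdot>\<^sub>m 1\<^sub>m n)))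
    = mtrace (GA x * minv (GB y + t \<cdot>\<^sub>m (GA x + e \<cdot>\<^sub>m 1\<^sub>m n))) + e * mtrace (minv (GB y + t \<cdot>\<^sub>m (GA x + e \<cdot>\<^sub>m 1\<^sub>m n)))"
    using R by (simp add: add_mult_distrib_mat[of _ n n _ _ n] mtrace_add[of _ n] mtrace_shift_one[of _ n])
  also have "\<dots> \<ge> 0" using GA_nonneg[OF M, of x] mtrace_minv_nonneg[OF M] e by simp
  finally show "0 \<le> he x y" "he x y \<le> 1"
    using stat_le_1_of[OF pdA psdAB(2) GB_nonneg[OF M]] by (auto simp: he_def)
qed

text \<open>Adding either vector lowers the trace of the common base by an amount between 0 and 1,
  so the two results differ by at most 1 before normalisation.\<close>

lemma stat_diff_A:
  assumes B: "psd n B" and A: "pd n A0" and u: "u \<in> carrier_vec n" "u' \<in> carrier_vec n"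
  shows "\<bar>stat B (A0 + outer u) - stat B (A0 + outer u')\<bar> \<le> 1 / n"
proof -
  note Bc = psdD[OF B] and Ac = pdD[OF A]
  note M = pd_sum[OF A B]
  have K: "psd n ((B + t \<cdot>\<^sub>m A0) - B)"
  proof -
    have "(B + t \<cdot>\<^sub>m A0) - B = t \<cdot>\<^sub>m A0" using Bc Ac by (intro eq_matI) auto
    then show ?thesis using psd_smult[OF pd_psd[OF A]] t by simp
  qed
  have eq: "B + t \<cdot>\<^sub>m (A0 + outer u) = (B + t \<cdot>\<^sub>m A0) + outer (sqrt t \<cdot>\<^sub>v u)" if "u \<in> carrier_vec n" for u
    unfolding outer_smult using Bc Ac that t by (intro eq_matI) (auto simp: outer_def algebra_simps)
  note r = mtrace_rank_one[OF M B K, of "sqrt t \<cdot>\<^sub>v u"] mtrace_rank_one[OF M B K, of "sqrt t \<cdot>\<^sub>v u'"]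
  have "\<bar>mtrace (B * minv (B + t \<cdot>\<^sub>m (A0 + outer u))) - mtrace (B * minv (B + t \<cdot>\<^sub>m (A0 + outer u')))\<bar> \<le> 1"
    unfolding eq[OF u(1)] eq[OF u(2)] using r u by (simp add: abs_le_iff)
  then show ?thesis using npm unfolding stat_def diff_divide_distrib[symmetric] abs_divide abs_of_nat
    by (intro divide_right_mono) auto
qed

text \<open>An update of \<open>B\<close> changes both of its occurrences; passing to the
  complementary trace leaves it only inside the inverse, where \<open>mtrace_rank_one\<close>
  applies with \<open>K = t W\<close>.\<close>

lemma stat_diff_B:
  assumes B: "psd n B0" and W: "pd n W" and u: "u \<in> carrier_vec n" "u' \<in> carrier_vec n"
  shows "\<bar>stat (B0 + outer u) W - stat (B0 + outer u') W\<bar> \<le> 1 / n"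
proof -
  note Bc = psdD[OF B] and Wc = pdD[OF W]
  note M = pd_sum[OF W B]
  have S: "psd n (t \<cdot>\<^sub>m W)" using pd_psd[OF W] t by (intro psd_smult) auto
  have K: "psd n ((B0 + t \<cdot>\<^sub>m W) - t \<cdot>\<^sub>m W)"
  proof -
    have "(B0 + t \<cdot>\<^sub>m W) - t \<cdot>\<^sub>m W = B0" using Bc Wc by (intro eq_matI) auto
    then show ?thesis using B by simp
  qed
  have eq: "mtrace ((B0 + outer u) * minv (B0 + outer u + t \<cdot>\<^sub>m W)) = real n - mtrace ((t \<cdot>\<^sub>m W) * minv ((B0 + t \<cdot>\<^sub>m W) + outer u))"
    if u: "u \<in> carrier_vec n" for u
  proof -
    have "B0 + outer u + t \<cdot>\<^sub>m W = (B0 + t \<cdot>\<^sub>m W) + outer u"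
      using Bc Wc u by (intro eq_matI) (auto simp: outer_def)
    moreover have "pd n (B0 + outer u + t \<cdot>\<^sub>m W)" by (intro pd_sum W psd_add B psd_outer u)
    ultimately show ?thesis using mtrace_complement[of "B0 + outer u" n "t \<cdot>\<^sub>m W"] Bc Wc u by simp
  qed
  note r = mtrace_rank_one[OF M S K u(1)] mtrace_rank_one[OF M S K u(2)]
  have "\<bar>mtrace ((B0 + outer u) * minv (B0 + outer u + t \<cdot>\<^sub>m W)) - mtrace ((B0 + outer u') * minv (B0 + outer u' + t \<cdot>\<^sub>m W))\<bar> \<le> 1"
    unfolding eq[OF u(1)] eq[OF u(2)] using r by (simp add: abs_le_iff)
  then show ?thesis using npm unfolding stat_def diff_divide_distrib[symmetric] abs_divide abs_of_nat
    by (intro divide_right_mono) auto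
qed

lemma gram_split:
  assumes "j < N"
  shows "gram n {..<N} (1 / real N) z = gram n ({..<N} - {j}) (1 / real N) z + outer (scol n (1 / real N) z j)"
  using gram_insert[of "{..<N} - {j}" j "1 / real N" n z] assms by (simp add: insert_absorb)

lemma stat_diff_GB:
  assumes j: "j < m" and eq: "\<And>i k. k \<noteq> j \<Longrightarrow> y i k = y' i k" and W: "pd n W"
  shows "\<bar>stat (GB y) W - stat (GB y') W\<bar> \<le> 1 / n"
proof -
  have h: "GBO y j = GBO y' j" by (rule gram_cong) (use eq in auto)
  show ?thesis unfolding GB_def gram_split[OF j, of y] gram_split[OF j, of y'] h
    by (intro stat_diff_B psd_gram W) auto
qed

lemma he_diff_x:
  assumes j: "j < p" and eq: "\<And>i k. k \<noteq> j \<Longrightarrow> x i k = x' i k"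
  shows "\<bar>he x y - he x' y\<bar> \<le> 1 / n"
proof -
  let ?A0 = "gram n ({..<p} - {j}) (1 / p) x"
  have A0: "gram n ({..<p} - {j}) (1 / p) x' = ?A0" by (rule gram_cong) (use eq in auto)
  have split: "GA z + e \<cdot>\<^sub>m 1\<^sub>m n = (gram n ({..<p} - {j}) (1 / p) z + e \<cdot>\<^sub>m 1\<^sub>m n) + outer (scol n (1 / p) z j)" for z
    unfolding GA_def gram_split[OF j, of z] by (intro eq_matI) (auto simp: gram_def outer_def scol_def)
  have "pd n (?A0 + e \<cdot>\<^sub>m 1\<^sub>m n)" using e by (intro psd_add_pd psd_gram pd_smult pd_one) auto
  then show ?thesis unfolding he_def split A0 by (intro stat_diff_A psdAB) auto
qed

lemma he_diff_y:
  assumes j: "j < m" and eq: "\<And>i k. k \<noteq> j \<Longrightarrow> y i k = y' i k"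
  shows "\<bar>he x y - he x y'\<bar> \<le> 1 / n"
  unfolding he_def by (rule stat_diff_GB[OF j eq pdA])

lemma hI_diff:
  assumes j: "j < m" and eq: "\<And>i k. k \<noteq> j \<Longrightarrow> y i k = y' i k"
  shows "\<bar>hI y - hI y'\<bar> \<le> 1 / n"
  unfolding hI_def by (rule stat_diff_GB[OF j eq pd_one])

lemma he_cong:
  assumes "\<And>i j. i < n \<Longrightarrow> j < p \<Longrightarrow> x i j = x' i j" "\<And>i j. i < n \<Longrightarrow> j < m \<Longrightarrow> y i j = y' i j"
  shows "he x y = he x' y'"
  using gram_cong[of n "{..<p}" x x' "1 / real p"] gram_cong[of n "{..<m}" y y' "1 / real m"] assms by (simp add: he_def GA_def GB_def)

lemma hI_cong:
  assumes "\<And>i j. i < n \<Longrightarrow> j < m \<Longrightarrow> y i j = y' i j"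
  shows "hI y = hI y'"
  using gram_cong[of n "{..<m}" y y' "1 / real m"] assms by (simp add: hI_def GB_def)

section \<open>Measurability of the statistics\<close>

lemma gram_meas:
  assumes "\<And>i j. i < n \<Longrightarrow> j \<in> J \<Longrightarrow> (\<lambda>\<omega>. z \<omega> i j) \<in> borel_measurable N" "i < n" "k < n"
  shows "(\<lambda>\<omega>. gram n J c (z \<omega>) $$ (i, k)) \<in> borel_measurable N"
  using assms by (simp add: gram_def)

lemma stat_meas:
  assumes c: "\<And>\<omega>. B \<omega> \<in> carrier_mat n n" "\<And>\<omega>. W \<omega> \<in> carrier_mat n n"
    and m: "\<And>i k. i < n \<Longrightarrow> k < n \<Longrightarrow> (\<lambda>\<omega>. B \<omega> $$ (i, k)) \<in> borel_measurable N"
      "\<And>i k. i < n \<Longrightarrow> k < n \<Longrightarrow> (\<lambda>\<omega>. W \<omega> $$ (i, k)) \<in> borel_measurable N"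
  shows "(\<lambda>\<omega>. stat (B \<omega>) (W \<omega>)) \<in> borel_measurable N"
proof -
  have S: "B \<omega> + t \<cdot>\<^sub>m W \<omega> \<in> carrier_mat n n" for \<omega> using c by simp
  have Sm: "(\<lambda>\<omega>. (B \<omega> + t \<cdot>\<^sub>m W \<omega>) $$ (i, k)) \<in> borel_measurable N" if "i < n" "k < n" for i k
  proof -
    have "(B \<omega> + t \<cdot>\<^sub>m W \<omega>) $$ (i, k) = B \<omega> $$ (i,k) + t * W \<omega> $$ (i,k)" for \<omega>
      using that c[of \<omega>] by auto
    then show ?thesis using m that by simp
  qed
  have "stat (B \<omega>) (W \<omega>) = (\<Sum>i<n. \<Sum>k<n. B \<omega> $$ (i,k) * minv (B \<omega> + t \<cdot>\<^sub>m W \<omega>) $$ (k,i)) / n" for \<omega>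
    unfolding stat_def by (subst mtrace_mult[OF c(1) minv_carrier[OF S]]) simp
  then show ?thesis by (simp only:) (intro borel_measurable_divide borel_measurable_const borel_measurable_sum borel_measurable_times m minv_measurable[OF S Sm], auto)
qed

lemma GA_meas:
  assumes "\<And>i j. i < n \<Longrightarrow> j < p \<Longrightarrow> (\<lambda>\<omega>. z \<omega> i j) \<in> borel_measurable N" "i < n" "k < n"
  shows "(\<lambda>\<omega>. GA (z \<omega>) $$ (i, k)) \<in> borel_measurable N"
  unfolding GA_def by (rule gram_meas) (use assms in auto)

lemma GA_minus_one_meas:
  assumes "\<And>i j. i < n \<Longrightarrow> j < p \<Longrightarrow> (\<lambda>\<omega>. z \<omega> i j) \<in> borel_measurable N" and ik: "i < n" "k < n"
  shows "(\<lambda>\<omega>. (GA (z \<omega>) - 1\<^sub>m n) $$ (i, k)) \<in> borel_measurable N"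
proof -
  have "(GA x - 1\<^sub>m n) $$ (i,k) = GA x $$ (i,k) - (if i = k then 1 else 0)" for x using ik by simp
  then show ?thesis using GA_meas[OF assms(1) ik] by simp
qed

lemma GB_meas:
  assumes "\<And>i j. i < n \<Longrightarrow> j < m \<Longrightarrow> (\<lambda>\<omega>. z \<omega> i j) \<in> borel_measurable N" "i < n" "k < n"
  shows "(\<lambda>\<omega>. GB (z \<omega>) $$ (i, k)) \<in> borel_measurable N"
  unfolding GB_def by (rule gram_meas) (use assms in auto)

lemma he_meas:
  assumes "\<And>i j. i < n \<Longrightarrow> j < p \<Longrightarrow> (\<lambda>\<omega>. x \<omega> i j) \<in> borel_measurable N"
    "\<And>i j. i < n \<Longrightarrow> j < m \<Longrightarrow> (\<lambda>\<omega>. y \<omega> i j) \<in> borel_measurable N"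
  shows "(\<lambda>\<omega>. he (x \<omega>) (y \<omega>)) \<in> borel_measurable N"
  unfolding he_def
proof (rule stat_meas)
  fix i k assume ik: "i < n" "k < n"
  show "(\<lambda>\<omega>. GB (y \<omega>) $$ (i, k)) \<in> borel_measurable N" by (rule GB_meas[OF assms(2) ik])
  have "(GA (x \<omega>) + e \<cdot>\<^sub>m 1\<^sub>m n) $$ (i,k) = GA (x \<omega>) $$ (i,k) + (if i = k then e else 0)" for \<omega>
    using ik by simp
  then show "(\<lambda>\<omega>. (GA (x \<omega>) + e \<cdot>\<^sub>m 1\<^sub>m n) $$ (i, k)) \<in> borel_measurable N"
    using GA_meas[OF assms(1) ik] by simp
qed auto

lemma hI_meas:
  assumes "\<And>i j. i < n \<Longrightarrow> j < m \<Longrightarrow> (\<lambda>\<omega>. y \<omega> i j) \<in> borel_measurable N"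
  shows "(\<lambda>\<omega>. hI (y \<omega>)) \<in> borel_measurable N"
  unfolding hI_def by (rule stat_meas) (auto intro: GB_meas[OF assms])


section \<open>Leave-one-out resolvents\<close>

definition loo :: "(nat \<Rightarrow> nat \<Rightarrow> real) \<Rightarrow> nat \<Rightarrow> real mat" where
  "loo y j = minv (GBO y j + t \<cdot>\<^sub>m 1\<^sub>m n)"

text \<open>The fluctuation of the quadratic form of a scaled Gaussian column around its mean
  \<open>mtrace R / m\<close>, as \<open>qdev_eq\<close> shows.\<close>

definition qdev :: "real mat \<Rightarrow> (nat \<Rightarrow> real) \<Rightarrow> real" where
  "qdev R z = (\<Sum>i<n. \<Sum>k<n. R $$ (i,k) / m * (z i * z k - (if i = k then 1 else 0)))"

lemma loo_pd: "pd n (GBO y j + t \<cdot>\<^sub>m 1\<^sub>m n)"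
  using t by (intro psd_add_pd psd_gram pd_smult pd_one) auto

lemma loo_carrier: "loo y j \<in> carrier_mat n n"
  unfolding loo_def by (rule minv_carrier[OF pdD[OF loo_pd]])

text \<open>The resolvent is bounded by \<open>1/t\<close> and the identity has squared norm
  \<open>n\<close>; the bound is uniform in the data, as conditioning on the other columns
  requires.\<close>

lemma fro2_loo: "fro2 (loo y j) \<le> n / t\<^sup>2"
proof -
  let ?S = "GBO y j + t \<cdot>\<^sub>m 1\<^sub>m n"
  have "fro2 (minv ?S * 1\<^sub>m n) \<le> fro2 (1\<^sub>m n) / t\<^sup>2"
  proof (rule fro2_minv_mult_le[OF loo_pd _ t])
    fix v :: "real vec" assume v: "v \<in> carrier_vec n"
    have "v \<bullet> (?S *\<^sub>v v) = v \<bullet> (GBO y j *\<^sub>v v) + t * (v \<bullet> v)"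
      using v by (simp add: qf_add[of _ n] qf_smult[of _ n])
    moreover have "0 \<le> v \<bullet> (GBO y j *\<^sub>v v)"
      by (rule psd_ge[OF psd_gram v]) auto
    ultimately show "t * (v \<bullet> v) \<le> v \<bullet> (?S *\<^sub>v v)" by simp
  qed simp
  moreover have "fro2 (1\<^sub>m n) = n"
  proof -
    have "fro2 (1\<^sub>m n) = (\<Sum>i<n. \<Sum>k<n. if k = i then 1 else 0)"
      unfolding fro2_def by (intro sum.cong) auto
    then show ?thesis by simp
  qed
  moreover have "minv ?S * 1\<^sub>m n = loo y j"
    using right_mult_one_mat[OF loo_carrier[of y j]] by (simp add: loo_def)
  ultimately show ?thesis by simp
qed

lemma loo_meas:
  assumes "\<And>i k. i < n \<Longrightarrow> k < m \<Longrightarrow> k \<noteq> j \<Longrightarrow> (\<lambda>\<omega>. y \<omega> i k) \<in> borel_measurable N" and ik: "i < n" "k < n"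
  shows "(\<lambda>\<omega>. loo (y \<omega>) j $$ (i, k)) \<in> borel_measurable N"
  unfolding loo_def
proof (rule minv_measurable[OF pdD[OF loo_pd] _ ik])
  fix i k assume ik: "i < n" "k < n"
  have "(GBO y j + t \<cdot>\<^sub>m 1\<^sub>m n) $$ (i,k) = GBO y j $$ (i,k) + (if i = k then t else 0)" for y
    using ik by (simp add: gram_def)
  moreover have "(\<lambda>\<omega>. GBO (y \<omega>) j $$ (i,k)) \<in> borel_measurable N"
    by (rule gram_meas[OF _ ik]) (use assms in auto)
  ultimately show "(\<lambda>\<omega>. (GBO (y \<omega>) j + t \<cdot>\<^sub>m 1\<^sub>m n) $$ (i,k)) \<in> borel_measurable N" by simp
qed

lemma qdev_eq:
  assumes "R \<in> carrier_mat n n"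
  shows "qdev R (\<lambda>i. y i j) = scol n (1 / m) y j \<bullet> (R *\<^sub>v scol n (1 / m) y j) - mtrace R / m"
proof -
  have s: "sqrt (1 / m) * a * (r * (sqrt (1 / m) * b)) = r / m * (a * b)" for a r b :: real
  proof -
    have "sqrt (1 / m) * a * (r * (sqrt (1 / m) * b)) = (sqrt (1 / m) * sqrt (1 / m)) * (r * (a * b))" by (simp only: mult_ac)
    then show ?thesis by simp
  qed
  have "scol n (1 / m) y j \<bullet> (R *\<^sub>v scol n (1 / m) y j) = (\<Sum>i<n. \<Sum>k<n. sqrt (1 / m) * y i j * (R $$ (i,k) * (sqrt (1 / m) * y k j)))"
    using assms by (auto simp: scalar_prod_def scol_def lessThan_atLeast0 sum_distrib_left intro!: sum.cong)
  also have "\<dots> = (\<Sum>i<n. \<Sum>k<n. R $$ (i,k) / m * (y i j * y k j))" unfolding s ..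
  finally have 1: "scol n (1 / m) y j \<bullet> (R *\<^sub>v scol n (1 / m) y j) = \<dots>" .
  have 2: "mtrace R / m = (\<Sum>i<n. \<Sum>k<n. R $$ (i,k) / m * (if i = k then 1 else 0))"
  proof -
    have "(\<Sum>k<n. R $$ (i,k) / m * (if i = k then 1 else 0)) = R $$ (i,i) / m" if "i < n" for i
    proof -
      have "(\<Sum>k<n. R $$ (i,k) / m * (if i = k then 1 else 0)) = (\<Sum>k<n. if i = k then R $$ (i,k) / m else 0)"
        by (intro sum.cong) auto
      then show ?thesis using that by simp
    qed
    then show ?thesis using assms by (simp add: mtrace_def sum_divide_distrib)
  qed
  show ?thesis unfolding 1 2 qdev_def by (simp add: right_diff_distrib sum_subtractf)
qed

text \<open>
  By the Sherman-Morrison formula the trace is \<open>\<Sum> q/(1 + q)\<close> over the columns, where \<open>q\<close> is the quadratic form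
  of the column and of the resolvent \<^const>\<open>loo\<close> without it. These are independent, so \<open>q\<close> is close
  to a normalised trace, and \<open>\<kappa>\<close> is its mean.
\<close>

lemma hI_leave_one_out:
  assumes \<kappa>: "0 \<le> \<kappa>"
  shows "\<bar>hI y - m / n * (\<kappa> / (1 + \<kappa>))\<bar>
    \<le> (\<Sum>j<m. \<bar>qdev (loo y j) (\<lambda>i. y i j)\<bar>) / n + 1 / (n * t) + m / n * \<bar>n / (m * t) * (1 - hI y) - \<kappa>\<bar>"
proof -
  define R where "R = minv (GB y + t \<cdot>\<^sub>m 1\<^sub>m n)"
  have pdM: "pd n (GB y + t \<cdot>\<^sub>m 1\<^sub>m n)" by (rule pd_sum[OF pd_one psdAB(2)])
  have Rc: "R \<in> carrier_mat n n" unfolding R_def by (rule minv_carrier[OF pdD[OF pdM]])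
  have hR: "n * hI y = n - t * mtrace R"
    using mtrace_complement[of "GB y" n "t \<cdot>\<^sub>m 1\<^sub>m n"] pdM npm Rc
    by (simp add: hI_def stat_def R_def mtrace_shift_one)
  define q where "q j = scol n (1 / m) y j \<bullet> (loo y j *\<^sub>v scol n (1 / m) y j)" for j
  have q0: "0 \<le> q j" for j unfolding q_def loo_def by (rule qf_minv_nonneg[OF loo_pd]) simp
  have split: "GB y + t \<cdot>\<^sub>m 1\<^sub>m n = (GBO y j + t \<cdot>\<^sub>m 1\<^sub>m n) + outer (scol n (1 / m) y j)" if "j < m" for j
    unfolding GB_def gram_split[OF that, of y] by (intro eq_matI) (auto simp: gram_def outer_def scol_def)
  have "n * hI y = mtrace (GB y * R)" using npm by (simp add: hI_def stat_def R_def)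
  also have "\<dots> = (\<Sum>j<m. scol n (1 / m) y j \<bullet> (R *\<^sub>v scol n (1 / m) y j))"
    unfolding GB_def using Rc by (intro mtrace_gram_mult) auto
  also have "\<dots> = (\<Sum>j<m. q j / (1 + q j))"
  proof (intro sum.cong refl)
    fix j assume "j \<in> {..<m}"
    then have j: "j < m" by simp
    show "scol n (1 / m) y j \<bullet> (R *\<^sub>v scol n (1 / m) y j) = q j / (1 + q j)"
      unfolding R_def split[OF j] q_def loo_def by (rule qf_minv_outer[OF loo_pd]) simp
  qed
  finally have hq: "n * hI y = (\<Sum>j<m. q j / (1 + q j))" .
  \<comment> \<open>\<open>x / (1 + x)\<close> is 1-Lipschitz on the nonnegative reals, so it
    remains to bound the deviation of each \<open>q j\<close> from \<open>\<kappa>\<close>.\<close>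
  have lip: "\<bar>a / (1 + a) - b / (1 + b)\<bar> \<le> \<bar>a - b\<bar>" if "0 \<le> a" "0 \<le> b" for a b :: real
  proof -
    have eq: "a / (1 + a) - b / (1 + b) = (a - b) / ((1 + a) * (1 + b))" using that by (simp add: field_simps)
    define D where "D = (1 + a) * (1 + b)"
    have D: "1 \<le> D" unfolding D_def using that mult_mono[of 1 "1 + a" 1 "1 + b"] by simp
    have "\<bar>(a - b) / D\<bar> = \<bar>a - b\<bar> / D" using D by (simp add: abs_divide)
    also have "\<dots> \<le> \<bar>a - b\<bar> / 1" using D by (intro divide_left_mono) auto
    finally have "\<bar>(a - b) / D\<bar> \<le> \<bar>a - b\<bar>" by simp
    then show ?thesis unfolding eq D_def .
  qed
  \<comment> \<open>Three deviations: the Gaussian fluctuation of \<open>q j\<close>, the change of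
    the trace when one column is removed (at most \<open>1/t\<close> by the rank-one bound), and the
    distance of \<open>mtrace R / m = n / (m t) (1 - hI y)\<close> from
    \<open>\<kappa>\<close>.\<close>
  have bj: "\<bar>q j - \<kappa>\<bar> \<le> \<bar>qdev (loo y j) (\<lambda>i. y i j)\<bar> + 1 / (m * t) + \<bar>n / (m * t) * (1 - hI y) - \<kappa>\<bar>" if j: "j < m" for j
  proof -
    have K: "psd n (t \<cdot>\<^sub>m 1\<^sub>m n)" using t by (intro psd_smult pd_psd pd_one) auto
    have MK: "psd n ((GBO y j + t \<cdot>\<^sub>m 1\<^sub>m n) - t \<cdot>\<^sub>m 1\<^sub>m n)"
    proof -
      have "(GBO y j + t \<cdot>\<^sub>m 1\<^sub>m n) - t \<cdot>\<^sub>m 1\<^sub>m n = GBO y j"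
        by (intro eq_matI) (auto simp: gram_def)
      then show ?thesis by (simp add: psd_gram)
    qed
    have "t * mtrace R \<le> t * mtrace (loo y j)" "t * mtrace (loo y j) \<le> t * mtrace R + 1"
      using mtrace_rank_one[OF loo_pd K MK, of "scol n (1 / m) y j"] loo_carrier[of y j] Rc
      by (simp_all add: R_def split[OF j] loo_def mtrace_shift_one)
    then have "\<bar>t * mtrace (loo y j) - t * mtrace R\<bar> \<le> 1" by (simp add: abs_le_iff)
    then have "\<bar>(t * mtrace (loo y j) - t * mtrace R) / (m * t)\<bar> \<le> 1 / (m * t)"
      using t npm unfolding abs_divide by (simp add: divide_right_mono)
    moreover have "(t * mtrace (loo y j) - t * mtrace R) / (m * t) = mtrace (loo y j) / m - mtrace R / m"
      using t npm by (simp add: field_simps)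
    moreover have "mtrace R / m = n / (m * t) * (1 - hI y)"
    proof -
      have "n * (1 - hI y) = t * mtrace R" using hR by (simp add: algebra_simps)
      moreover have "n / (m * t) * (1 - hI y) = (n * (1 - hI y)) / (m * t)" by simp
      ultimately have "n / (m * t) * (1 - hI y) = t * mtrace R / (m * t)" by presburger
      then show ?thesis using t by simp
    qed
    moreover have "q j = qdev (loo y j) (\<lambda>i. y i j) + mtrace (loo y j) / m"
      unfolding q_def qdev_eq[OF loo_carrier] by simp
    moreover have "\<bar>q' - \<kappa>\<bar> \<le> \<bar>v\<bar> + d + \<bar>r - \<kappa>\<bar>" if "\<bar>x\<bar> \<le> d" "x = a - b" "b = r" "q' = v + a" for q' v a b d r x :: real
      using that by linarith
    ultimately show ?thesis by blast
  qed
  have "n * hI y - m * (\<kappa> / (1 + \<kappa>)) = (\<Sum>j<m. q j / (1 + q j) - \<kappa> / (1 + \<kappa>))"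
    unfolding hq by (simp add: sum_subtractf)
  then have "\<bar>n * hI y - m * (\<kappa> / (1 + \<kappa>))\<bar> \<le> (\<Sum>j<m. \<bar>q j / (1 + q j) - \<kappa> / (1 + \<kappa>)\<bar>)"
    by (simp add: sum_abs)
  also have "\<dots> \<le> (\<Sum>j<m. \<bar>qdev (loo y j) (\<lambda>i. y i j)\<bar> + 1 / (m * t) + \<bar>n / (m * t) * (1 - hI y) - \<kappa>\<bar>)"
    by (intro sum_mono order.trans[OF lip[OF q0 \<kappa>] bj]) simp
  also have "\<dots> = (\<Sum>j<m. \<bar>qdev (loo y j) (\<lambda>i. y i j)\<bar>) + 1 / t + m * \<bar>n / (m * t) * (1 - hI y) - \<kappa>\<bar>"
    using npm by (simp add: sum.distrib)
  finally have "\<bar>n * hI y - m * (\<kappa> / (1 + \<kappa>))\<bar> / n \<le> \<dots> / n" by (simp add: divide_right_mono)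
  moreover have "\<bar>n * hI y - m * (\<kappa> / (1 + \<kappa>))\<bar> / n = \<bar>hI y - m / n * (\<kappa> / (1 + \<kappa>))\<bar>"
  proof -
    have "hI y - m / n * (\<kappa> / (1 + \<kappa>)) = (n * hI y - m * (\<kappa> / (1 + \<kappa>))) / n"
      using npm by (simp add: diff_divide_distrib)
    then show ?thesis by (simp add: abs_divide)
  qed
  ultimately show ?thesis by (simp add: add_divide_distrib mult.commute)
qed

text \<open>\<open>mtrace_shift_le\<close> contains the square root of the squared norm;
  \<open>2 sqrt z \<le> z / s + s\<close> linearises it, so that a first moment of
  \<open>fro2\<close> is enough later. The parameter \<open>s\<close> stays free for
  optimisation.\<close>

lemma he_hI_le:
  assumes s: "0 < s"
  shows "\<bar>he x y - hI y\<bar> \<le> (4 + 1 / s) * (2 * fro2 (GA x - 1\<^sub>m n) / n + 2 * e\<^sup>2) + s"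
proof -
  let ?A = "GA x + e \<cdot>\<^sub>m 1\<^sub>m n"
  define \<phi> where "\<phi> = fro2 (?A - 1\<^sub>m n)"
  have \<phi>0: "0 \<le> \<phi>" by (simp add: \<phi>_def fro2_nonneg)
  have fe: "\<phi> \<le> 2 * fro2 (GA x - 1\<^sub>m n) + 2 * e\<^sup>2 * n"
  proof -
    have "\<phi> = (\<Sum>i<n. \<Sum>k<n. ((GA x - 1\<^sub>m n) $$ (i,k) + (if k = i then e else 0))\<^sup>2)"
      unfolding \<phi>_def fro2_def by (auto intro!: sum.cong simp: diff_add_eq)
    also have "\<dots> \<le> (\<Sum>i<n. \<Sum>k<n. 2 * ((GA x - 1\<^sub>m n) $$ (i,k))\<^sup>2 + 2 * (if k = i then e\<^sup>2 else 0))"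
    proof (intro sum_mono)
      fix i k
      have "(a + b)\<^sup>2 \<le> 2 * a\<^sup>2 + 2 * b\<^sup>2" for a b :: real
        using zero_le_power2[of "a - b"] by (simp add: power2_eq_square algebra_simps)
      from this[of "(GA x - 1\<^sub>m n) $$ (i,k)" "if k = i then e else 0"]
      show "((GA x - 1\<^sub>m n) $$ (i,k) + (if k = i then e else 0))\<^sup>2 \<le> 2 * ((GA x - 1\<^sub>m n) $$ (i,k))\<^sup>2 + 2 * (if k = i then e\<^sup>2 else 0)"
        by (auto split: if_splits)
    qed
    also have "\<dots> = 2 * fro2 (GA x - 1\<^sub>m n) + 2 * e\<^sup>2 * n"
      by (simp add: fro2_def sum.distrib sum_distrib_left[symmetric])
    finally show ?thesis .
  qed
  have "\<bar>he x y - hI y\<bar> \<le> (4 * \<phi> + 2 * sqrt n * sqrt \<phi>) / n"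
    using mtrace_shift_le[OF psdAB(2) t pdA, of y x] unfolding he_def hI_def stat_def diff_divide_distrib[symmetric] abs_divide \<phi>_def
    by (simp add: divide_right_mono)
  also have "\<dots> = 4 * (\<phi> / n) + 2 * sqrt (\<phi> / n)"
  proof -
    have "sqrt n * sqrt \<phi> / n = sqrt \<phi> / sqrt n" using npm by (simp add: field_simps)
    then show ?thesis by (simp add: add_divide_distrib real_sqrt_divide)
  qed
  also have "2 * sqrt (\<phi> / n) \<le> 1 / s * (\<phi> / n) + s"
  proof -
    have "0 \<le> (sqrt (\<phi> / n) - s)\<^sup>2" by simp
    then have "2 * sqrt (\<phi> / n) * s \<le> (\<phi> / n) + s * s"
      using \<phi>0 by (simp add: power2_diff power2_eq_square[of s] algebra_simps)
    then have "2 * sqrt (\<phi> / n) * s / s \<le> ((\<phi> / n) + s * s) / s" using s by (intro divide_right_mono) auto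
    also have "((\<phi> / n) + s * s) / s = 1 / s * (\<phi> / n) + s" using s by (simp add: add_divide_distrib)
    finally show ?thesis using s by simp
  qed
  also have "4 * (\<phi> / n) + (1 / s * (\<phi> / n) + s) = (4 + 1 / s) * (\<phi> / n) + s" by (simp add: algebra_simps)
  also have "\<dots> \<le> (4 + 1 / s) * (2 * fro2 (GA x - 1\<^sub>m n) / n + 2 * e\<^sup>2) + s"
  proof -
    have "\<phi> / n \<le> (2 * fro2 (GA x - 1\<^sub>m n) + 2 * e\<^sup>2 * n) / n" using fe by (rule divide_right_mono) simp
    also have "\<dots> = 2 * fro2 (GA x - 1\<^sub>m n) / n + 2 * e\<^sup>2" using npm by (simp add: add_divide_distrib)
    finally show ?thesis using s by (intro add_right_mono mult_left_mono) auto
  qed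
  finally show ?thesis by simp
qed

end

section \<open>Concentration and the fixed point equation for Gaussian matrices\<close>

text \<open>Each variable is viewed as the restriction to a singleton block; injectivity makes the
  blocks disjoint.\<close>

lemma (in prob_space) indep_vars_inj_reindex:
  assumes ind: "indep_vars (\<lambda>_. N) Z I" and h: "inj_on h L" "h ` L \<subseteq> I"
  shows "indep_vars (\<lambda>_. N) (\<lambda>l. Z (h l)) L"
proof -
  have "indep_vars (\<lambda>l. PiM {h l} (\<lambda>_. N)) (\<lambda>l \<omega>. restrict (\<lambda>v. Z v \<omega>) {h l}) L"
    by (rule indep_vars_restrict[OF ind]) (use h in \<open>auto simp: disjoint_family_on_def inj_on_def\<close>)
  then have "indep_vars (\<lambda>_. N) (\<lambda>l \<omega>. (\<lambda>x. x (h l)) (restrict (\<lambda>v. Z v \<omega>) {h l})) L"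
    by (rule indep_vars_compose2) (rule measurable_component_singleton, simp)
  then show ?thesis by simp
qed

locale gaussian_pair = prob_space M + shifted_gram n p m t e
  for M :: "'a measure" and n p m :: nat and t e :: real +
  fixes X Y :: "nat \<Rightarrow> nat \<Rightarrow> 'a \<Rightarrow> real"
  assumes NX: "\<And>i j. i < n \<Longrightarrow> j < p \<Longrightarrow> distributed M lborel (X i j) std_normal_density"
    and NY: "\<And>i j. i < n \<Longrightarrow> j < m \<Longrightarrow> distributed M lborel (Y i j) std_normal_density"
    and ind: "indep_vars (\<lambda>_. borel) (case_sum (\<lambda>(i,j). X i j) (\<lambda>(i,j). Y i j))
       (Inl ` ({..<n} \<times> {..<p}) \<union> Inr ` ({..<n} \<times> {..<m}))"
begin

abbreviation "XX \<omega> \<equiv> \<lambda>i j. X i j \<omega>"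
abbreviation "YY \<omega> \<equiv> \<lambda>i j. Y i j \<omega>"
abbreviation "ZZ \<equiv> case_sum (\<lambda>(i,j). X i j) (\<lambda>(i,j). Y i j)"

lemma rvX: "i < n \<Longrightarrow> j < p \<Longrightarrow> X i j \<in> borel_measurable M"
  using NX[of i j] by (auto simp: distributed_def)
lemma rvY: "i < n \<Longrightarrow> j < m \<Longrightarrow> Y i j \<in> borel_measurable M"
  using NY[of i j] by (auto simp: distributed_def)

section \<open>Columns as independent coordinates\<close>

definition cols :: "(nat + nat) set" where "cols = Inl ` {..<p} \<union> Inr ` {..<m}"
definition col_ix :: "nat + nat \<Rightarrow> ((nat \<times> nat) + (nat \<times> nat)) set" where
  "col_ix = case_sum (\<lambda>j. (\<lambda>i. Inl (i, j)) ` {..<n}) (\<lambda>j. (\<lambda>i. Inr (i, j)) ` {..<n})"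

abbreviation "col_space \<equiv> PiM cols (\<lambda>l. PiM (col_ix l) (\<lambda>_. borel :: real measure))"

lemma card_cols: "card cols = p + m" "finite cols" "cols \<noteq> {}"
proof -
  show "card cols = p + m" unfolding cols_def by (subst card_Un_disjoint) (auto simp: card_image)
  show "finite cols" "cols \<noteq> {}" using npm by (auto simp: cols_def)
qed

lemma indep_cols:
  "indep_vars (\<lambda>l. PiM (col_ix l) (\<lambda>_. borel)) (\<lambda>l \<omega>. restrict (\<lambda>v. ZZ v \<omega>) (col_ix l)) cols"
  by (rule indep_vars_restrict[OF ind]) (auto simp: cols_def col_ix_def disjoint_family_on_def)

definition colfun :: "((nat \<Rightarrow> nat \<Rightarrow> real) \<Rightarrow> (nat \<Rightarrow> nat \<Rightarrow> real) \<Rightarrow> real)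
    \<Rightarrow> (nat + nat \<Rightarrow> (nat \<times> nat) + (nat \<times> nat) \<Rightarrow> real) \<Rightarrow> real" where
  "colfun F z = F (\<lambda>i j. z (Inl j) (Inl (i, j))) (\<lambda>i j. z (Inr j) (Inr (i, j)))"

text \<open>The coordinates are the \<open>p + m\<close> whole columns and not the single entries:
  exchanging a column is a rank-one matter, so the increments are still \<open>1/n\<close>.
  \<open>Inl\<close> and \<open>Inr\<close> separate the columns of the two matrices.\<close>

lemma bounded_differences_cols:
  assumes F_meas: "(\<lambda>z. colfun F z) \<in> borel_measurable col_space"
    and bd: "\<And>x y. 0 \<le> F x y" "\<And>x y. F x y \<le> 1"
    and dx: "\<And>j x x' y. j < p \<Longrightarrow> (\<And>i k. k \<noteq> j \<Longrightarrow> x i k = x' i k) \<Longrightarrow> \<bar>F x y - F x' y\<bar> \<le> 1 / n"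
    and dy: "\<And>j x y y'. j < m \<Longrightarrow> (\<And>i k. k \<noteq> j \<Longrightarrow> y i k = y' i k) \<Longrightarrow> \<bar>F x y - F x y'\<bar> \<le> 1 / n"
  shows "bounded_differences M (\<lambda>l. PiM (col_ix l) (\<lambda>_. borel)) (\<lambda>l \<omega>. restrict (\<lambda>v. ZZ v \<omega>) (col_ix l)) cols (colfun F) 1 (1 / n)"
proof unfold_locales
  show "indep_vars (\<lambda>l. PiM (col_ix l) (\<lambda>_. borel)) (\<lambda>l \<omega>. restrict (\<lambda>v. ZZ v \<omega>) (col_ix l)) cols" by (rule indep_cols)
  show "\<bar>colfun F x\<bar> \<le> 1" for x using bd by (simp add: colfun_def)
  show "\<bar>colfun F x - colfun F (x(l := z))\<bar> \<le> 1 / n" if "l \<in> cols" for x l z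
  proof (cases l)
    case (Inl j)
    then show ?thesis using that dx[of j "\<lambda>i j. x (Inl j) (Inl (i, j))" "\<lambda>i ja. (x(Inl j := z)) (Inl ja) (Inl (i, ja))"]
      by (auto simp: colfun_def cols_def)
  next
    case (Inr j)
    then show ?thesis using that dy[of j "\<lambda>i j. x (Inr j) (Inr (i, j))" "\<lambda>i ja. (x(Inr j := z)) (Inr ja) (Inr (i, ja))"]
      by (auto simp: colfun_def cols_def)
  qed
qed (use card_cols F_meas in auto)

lemma component_meas:
  assumes "l \<in> cols" "v \<in> col_ix l"
  shows "(\<lambda>z. z l v :: real) \<in> borel_measurable col_space"
proof -
  have "(\<lambda>z. z l) \<in> PiM cols (\<lambda>l. PiM (col_ix l) (\<lambda>_. borel :: real measure)) \<rightarrow>\<^sub>M PiM (col_ix l) (\<lambda>_. borel)"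
    by (rule measurable_component_singleton[OF assms(1)])
  moreover have "(\<lambda>x. x v) \<in> PiM (col_ix l) (\<lambda>_. borel :: real measure) \<rightarrow>\<^sub>M borel"
    by (rule measurable_component_singleton[OF assms(2)])
  ultimately show ?thesis by (rule measurable_compose)
qed

lemma colfun_he_meas: "(\<lambda>z. colfun he z) \<in> borel_measurable col_space"
  unfolding colfun_def by (intro he_meas component_meas) (auto simp: cols_def col_ix_def)

lemma colfun_hI_meas: "(\<lambda>z. colfun (\<lambda>x. hI) z) \<in> borel_measurable col_space"
  unfolding colfun_def by (intro hI_meas component_meas) (auto simp: cols_def col_ix_def)

sublocale bHe: bounded_differences M "\<lambda>l. PiM (col_ix l) (\<lambda>_. borel)" "\<lambda>l \<omega>. restrict (\<lambda>v. ZZ v \<omega>) (col_ix l)" cols "colfun he" 1 "1 / n"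
  by (rule bounded_differences_cols[OF colfun_he_meas]) (use he_range he_diff_x he_diff_y in auto)

sublocale bHI: bounded_differences M "\<lambda>l. PiM (col_ix l) (\<lambda>_. borel)" "\<lambda>l \<omega>. restrict (\<lambda>v. ZZ v \<omega>) (col_ix l)" cols "colfun (\<lambda>x. hI)" 1 "1 / n"
  by (rule bounded_differences_cols[OF colfun_hI_meas]) (use hI_range hI_diff in auto)

lemma bHe_g: "bHe.g = (\<lambda>\<omega>. he (XX \<omega>) (YY \<omega>))"
proof (rule ext)
  show "bHe.g \<omega> = he (XX \<omega>) (YY \<omega>)" for \<omega>
    unfolding bHe.g_def colfun_def by (rule he_cong) (auto simp: cols_def col_ix_def)
qed

lemma bHI_g: "bHI.g = (\<lambda>\<omega>. hI (YY \<omega>))"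
proof (rule ext)
  show "bHI.g \<omega> = hI (YY \<omega>)" for \<omega>
    unfolding bHI.g_def colfun_def by (rule hI_cong) (auto simp: cols_def col_ix_def)
qed

lemma he_rv: "(\<lambda>\<omega>. he (XX \<omega>) (YY \<omega>)) \<in> borel_measurable M"
  using bHe.g_meas by (simp add: bHe_g)
lemma hI_rv: "(\<lambda>\<omega>. hI (YY \<omega>)) \<in> borel_measurable M"
  using bHI.g_meas by (simp add: bHI_g)

lemma he_int: "integrable M (\<lambda>\<omega>. he (XX \<omega>) (YY \<omega>))"
  using he_range he_rv by (intro integrable_const_bound[of _ 1]) auto
lemma hI_int: "integrable M (\<lambda>\<omega>. hI (YY \<omega>))"
  using hI_range hI_rv by (intro integrable_const_bound[of _ 1]) auto

lemma he_tail:
  assumes "0 < \<delta>"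
  shows "prob {\<omega> \<in> space M. \<delta> \<le> \<bar>he (XX \<omega>) (YY \<omega>) - expectation (\<lambda>\<omega>. he (XX \<omega>) (YY \<omega>))\<bar>}
    \<le> 2 * exp (- 2 * \<delta>\<^sup>2 / ((p + m) * (1 / n)\<^sup>2))"
  using bHe.concentration_tail[OF _ assms] npm unfolding bHe_g card_cols by simp

text \<open>\<open>hI\<close> is treated as a function of all columns, constant in those of the
  first matrix; therefore \<open>p\<close> enters the bound.\<close>

lemma hI_L1:
  "expectation (\<lambda>\<omega>. \<bar>hI (YY \<omega>) - expectation (\<lambda>\<omega>. hI (YY \<omega>))\<bar>) \<le> 4 * sqrt (p + m) * (1 / n)"
  using bHI.concentration_L1 npm unfolding bHI_g card_cols by simp

section \<open>Gaussian error terms and the equation for the mean\<close>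

lemma indY: "indep_vars (\<lambda>_. borel) (\<lambda>i. Y i j) {..<n}" if "j < m"
  using indep_vars_inj_reindex[OF ind, of "\<lambda>i. Inr (i, j)" "{..<n}"] that by (auto simp: inj_on_def)

lemma indX: "indep_vars (\<lambda>_. borel) (\<lambda>(i, j). X i j) ({..<n} \<times> {..<p})"
  using indep_vars_inj_reindex[OF ind, of Inl "{..<n} \<times> {..<p}"] by (simp add: case_prod_beta')

lemma indYY: "indep_vars (\<lambda>_. borel) (\<lambda>(i, j). Y i j) ({..<n} \<times> {..<m})"
  using indep_vars_inj_reindex[OF ind, of Inr "{..<n} \<times> {..<m}"] by (simp add: case_prod_beta')

text \<open>The second moment of the quadratic form is at most \<open>2 fro2 R / m^2\<close>, hence
  at most \<open>2 n / (m t)^2\<close>; its root bounds the first absolute moment.\<close>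

lemma qdev_fixed:
  assumes j: "j < m" and R: "R \<in> carrier_mat n n" "fro2 R \<le> n / t\<^sup>2"
  shows "(\<integral>\<^sup>+\<omega>. ennreal \<bar>qdev R (\<lambda>i. Y i j \<omega>)\<bar> \<partial>M) \<le> ennreal (sqrt (2 * n) / (m * t))"
proof -
  define s where "s = 2 * n / (m * t)\<^sup>2"
  have s: "0 < s" using npm t by (simp add: s_def)
  have sq: "sqrt s = sqrt (2 * n) / (m * t)" using t by (simp add: s_def real_sqrt_divide)
  have qm: "(\<lambda>\<omega>. qdev R (\<lambda>i. Y i j \<omega>)) \<in> borel_measurable M"
    unfolding qdev_def
    by (intro borel_measurable_sum borel_measurable_times borel_measurable_diff borel_measurable_const rvY j) auto
  have "(\<integral>\<^sup>+\<omega>. ennreal ((qdev R (\<lambda>i. Y i j \<omega>))\<^sup>2) \<partial>M) \<le> ennreal (2 * (\<Sum>i<n. \<Sum>k<n. (R $$ (i,k) / m)\<^sup>2))"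
    unfolding qdev_def by (rule gaussian_quadratic_form[OF _ indY[OF j]]) (use NY j in auto)
  also have "\<dots> \<le> ennreal s"
  proof (rule ennreal_leI)
    have "(\<Sum>i<n. \<Sum>k<n. (R $$ (i,k) / m)\<^sup>2) = fro2 R / m\<^sup>2"
      using R(1) by (simp add: fro2_def power_divide sum_divide_distrib)
    also have "\<dots> \<le> n / t\<^sup>2 / m\<^sup>2" using R(2) by (rule divide_right_mono) simp
    finally have "(\<Sum>i<n. \<Sum>k<n. (R $$ (i,k) / m)\<^sup>2) \<le> n / t\<^sup>2 / m\<^sup>2" .
    moreover have "2 * (n / t\<^sup>2 / m\<^sup>2) = s" by (simp add: s_def power_mult_distrib)
    ultimately show "2 * (\<Sum>i<n. \<Sum>k<n. (R $$ (i,k) / m)\<^sup>2) \<le> s" by linarith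
  qed
  finally show ?thesis using nn_integral_abs_le_sqrt[OF qm _ s] sq by simp
qed

lemma qdev_L1:
  assumes j: "j < m"
  shows "(\<integral>\<^sup>+\<omega>. ennreal \<bar>qdev (loo (YY \<omega>) j) (\<lambda>i. Y i j \<omega>)\<bar> \<partial>M) \<le> ennreal (sqrt (2 * n) / (m * t))"
proof -
  define JA where "JA = (Inr ` ({..<n} \<times> ({..<m} - {j})) :: ((nat \<times> nat) + (nat \<times> nat)) set)"
  define JB where "JB = (Inr ` ({..<n} \<times> {j}) :: ((nat \<times> nat) + (nat \<times> nat)) set)"
  have iv: "indep_var (PiM JA (\<lambda>_. borel)) (\<lambda>\<omega>. restrict (\<lambda>v. ZZ v \<omega>) JA) (PiM JB (\<lambda>_. borel)) (\<lambda>\<omega>. restrict (\<lambda>v. ZZ v \<omega>) JB)"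
    by (rule indep_var_restrict[OF ind]) (use j in \<open>auto simp: JA_def JB_def\<close>)
  let ?P = "PiM JA (\<lambda>_. borel) \<Otimes>\<^sub>M PiM JB (\<lambda>_. borel) :: ((((nat \<times> nat) + (nat \<times> nat)) \<Rightarrow> real) \<times> (((nat \<times> nat) + (nat \<times> nat)) \<Rightarrow> real)) measure"
  define F where "F z = ennreal \<bar>qdev (loo (\<lambda>i k. fst z (Inr (i, k))) j) (\<lambda>i. snd z (Inr (i, j)))\<bar>"
    for z :: "(((nat \<times> nat) + (nat \<times> nat)) \<Rightarrow> real) \<times> (((nat \<times> nat) + (nat \<times> nat)) \<Rightarrow> real)"
  have c1: "(\<lambda>z. fst z v) \<in> borel_measurable ?P" if "v \<in> JA" for v
    using that by (intro measurable_compose[OF measurable_fst measurable_component_singleton])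
  have c2: "(\<lambda>z. snd z v) \<in> borel_measurable ?P" if "v \<in> JB" for v
    using that by (intro measurable_compose[OF measurable_snd measurable_component_singleton])
  have looM: "(\<lambda>z. loo (\<lambda>i k. fst z (Inr (i, k))) j $$ (i, k)) \<in> borel_measurable ?P" if ik: "i < n" "k < n" for i k
    by (rule loo_meas[OF _ ik]) (auto intro!: c1 simp: JA_def)
  have qm: "(\<lambda>z. qdev (loo (\<lambda>i k. fst z (Inr (i, k))) j) (\<lambda>i. snd z (Inr (i, j)))) \<in> borel_measurable ?P"
    unfolding qdev_def
    by (intro borel_measurable_sum borel_measurable_times borel_measurable_diff borel_measurable_divide borel_measurable_const looM c2)
      (auto simp: JB_def)
  have Fm: "F \<in> borel_measurable ?P" unfolding F_def[abs_def] using qm by simp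
  have "(\<integral>\<^sup>+\<omega>. F (restrict (\<lambda>v. ZZ v \<omega>) JA, restrict (\<lambda>v. ZZ v \<omega>) JB) \<partial>M) \<le> ennreal (sqrt (2 * n) / (m * t))"
  proof (rule nn_integral_indep_var_le[OF iv Fm])
    fix x :: "((nat \<times> nat) + (nat \<times> nat)) \<Rightarrow> real"
    have "F (x, restrict (\<lambda>v. ZZ v \<omega>) JB) = ennreal \<bar>qdev (loo (\<lambda>i k. x (Inr (i, k))) j) (\<lambda>i. Y i j \<omega>)\<bar>" for \<omega>
    proof -
      have "qdev R (\<lambda>i. restrict (\<lambda>v. ZZ v \<omega>) JB (Inr (i, j))) = qdev R (\<lambda>i. Y i j \<omega>)" for R
        unfolding qdev_def by (intro sum.cong refl) (auto simp: JB_def)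
      then show ?thesis by (simp add: F_def)
    qed
    then show "(\<integral>\<^sup>+\<omega>. F (x, restrict (\<lambda>v. ZZ v \<omega>) JB) \<partial>M) \<le> ennreal (sqrt (2 * n) / (m * t))"
      using qdev_fixed[OF j loo_carrier fro2_loo] by simp
  qed
  moreover have "F (restrict (\<lambda>v. ZZ v \<omega>) JA, restrict (\<lambda>v. ZZ v \<omega>) JB) = ennreal \<bar>qdev (loo (YY \<omega>) j) (\<lambda>i. Y i j \<omega>)\<bar>" for \<omega>
  proof -
    have "loo (\<lambda>i k. restrict (\<lambda>v. ZZ v \<omega>) JA (Inr (i, k))) j = loo (YY \<omega>) j"
      unfolding loo_def by (rule arg_cong[where f="\<lambda>S. minv (S + t \<cdot>\<^sub>m 1\<^sub>m n)"], rule gram_cong) (auto simp: JA_def)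
    moreover have "qdev R (\<lambda>i. restrict (\<lambda>v. ZZ v \<omega>) JB (Inr (i, j))) = qdev R (\<lambda>i. Y i j \<omega>)" for R
      unfolding qdev_def by (intro sum.cong refl) (auto simp: JB_def)
    ultimately show ?thesis by (simp add: F_def)
  qed
  ultimately show ?thesis by simp
qed

text \<open>The pointwise leave-one-out estimate is integrated with the deterministic value
  \<open>\<kappa> = n / m \<gamma>\<close>. The three errors come from the Gaussian forms, the
  removal of a column and the concentration of \<open>hI\<close>.\<close>

lemma EhI_equation:
  defines "G \<equiv> expectation (\<lambda>\<omega>. hI (YY \<omega>))"
  defines "\<gamma> \<equiv> (1 - G) / t"
  shows "\<bar>G - \<gamma> / (1 + n / m * \<gamma>)\<bar> \<le> (sqrt (2 * n) / n + 1 / n + 4 * sqrt (p + m) / n) / t" "0 \<le> G" "G \<le> 1"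
proof -
  show G0: "0 \<le> G" unfolding G_def using hI_range by (intro integral_nonneg_AE) auto
  show G1: "G \<le> 1" unfolding G_def
    using integral_mono[OF hI_int, of "\<lambda>_. 1"] hI_range by (simp add: prob_space)
  define \<kappa> where "\<kappa> = n / m * \<gamma>"
  have \<kappa>: "0 \<le> \<kappa>" using G1 t by (simp add: \<kappa>_def \<gamma>_def)
  have mk: "m / n * (\<kappa> / (1 + \<kappa>)) = \<gamma> / (1 + n / m * \<gamma>)" unfolding \<kappa>_def using npm by simp
  define D where "D \<omega> = (\<Sum>j<m. \<bar>qdev (loo (YY \<omega>) j) (\<lambda>i. Y i j \<omega>)\<bar>)" for \<omega>
  define E1 where "E1 = expectation (\<lambda>\<omega>. \<bar>hI (YY \<omega>) - G\<bar>)"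
  have pt: "\<bar>hI (YY \<omega>) - \<gamma> / (1 + n / m * \<gamma>)\<bar> \<le> 1 / n * D \<omega> + (1 / (n * t) + 1 / t * \<bar>hI (YY \<omega>) - G\<bar>)" for \<omega>
  proof -
    have "n / (m * t) * (1 - hI (YY \<omega>)) - \<kappa> = n / (m * t) * (G - hI (YY \<omega>))"
    proof -
      have k: "\<kappa> = n / (m * t) * (1 - G)" by (simp add: \<kappa>_def \<gamma>_def)
      show ?thesis unfolding k right_diff_distrib[symmetric] by simp
    qed
    then have "m / n * \<bar>n / (m * t) * (1 - hI (YY \<omega>)) - \<kappa>\<bar> = m / n * (n / (m * t)) * \<bar>hI (YY \<omega>) - G\<bar>"
      using t by (simp add: abs_mult abs_minus_commute)
    also have "m / n * (n / (m * t)) = 1 / t" using npm by simp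
    finally show ?thesis using hI_leave_one_out[OF \<kappa>, of "YY \<omega>"] unfolding mk D_def by (simp add: add.assoc)
  qed
  have int1: "integrable M (\<lambda>\<omega>. \<bar>hI (YY \<omega>) - \<gamma> / (1 + n / m * \<gamma>)\<bar>)" using hI_int by simp
  have int2: "integrable M (\<lambda>\<omega>. \<bar>hI (YY \<omega>) - G\<bar>)" using hI_int by simp
  have looM: "(\<lambda>\<omega>. loo (YY \<omega>) j $$ (i, k)) \<in> borel_measurable M" if ik: "i < n" "k < n" for i k j
    by (rule loo_meas[OF _ ik]) (rule rvY)
  have qm[measurable]: "(\<lambda>\<omega>. qdev (loo (YY \<omega>) j) (\<lambda>i. Y i j \<omega>)) \<in> borel_measurable M" if "j < m" for j
    unfolding qdev_def
    by (intro borel_measurable_sum borel_measurable_times borel_measurable_diff borel_measurable_divide borel_measurable_const looM rvY that)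
      auto
  have Dm[measurable]: "D \<in> borel_measurable M" unfolding D_def[abs_def] using qm by (intro borel_measurable_sum borel_measurable_abs) auto
  have D0: "0 \<le> D \<omega>" for \<omega> by (simp add: D_def sum_nonneg)
  have Dint: "(\<integral>\<^sup>+\<omega>. ennreal (D \<omega>) \<partial>M) \<le> ennreal (sqrt (2 * n) / t)"
  proof -
    have "(\<integral>\<^sup>+\<omega>. ennreal (D \<omega>) \<partial>M) = (\<Sum>j<m. \<integral>\<^sup>+\<omega>. ennreal \<bar>qdev (loo (YY \<omega>) j) (\<lambda>i. Y i j \<omega>)\<bar> \<partial>M)"
      unfolding D_def by (subst nn_integral_sum[symmetric]) (auto simp: sum_ennreal)
    also have "\<dots> \<le> (\<Sum>j<m. ennreal (sqrt (2 * n) / (m * t)))" by (intro sum_mono qdev_L1) auto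
    also have "\<dots> = ennreal (\<Sum>j<m. sqrt (2 * n) / (m * t))" using t by (intro sum_ennreal) auto
    also have "(\<Sum>j<m. sqrt (2 * n) / (m * t)) = sqrt (2 * n) / t" using npm by simp
    finally show ?thesis .
  qed
  have E1: "0 \<le> E1" unfolding E1_def by (intro integral_nonneg_AE) auto
  have "ennreal (expectation (\<lambda>\<omega>. \<bar>hI (YY \<omega>) - \<gamma> / (1 + n / m * \<gamma>)\<bar>)) = (\<integral>\<^sup>+\<omega>. ennreal \<bar>hI (YY \<omega>) - \<gamma> / (1 + n / m * \<gamma>)\<bar> \<partial>M)"
    using int1 by (intro nn_integral_eq_integral[symmetric]) auto
  also have "\<dots> \<le> (\<integral>\<^sup>+\<omega>. ennreal (1 / n) * ennreal (D \<omega>) + (ennreal (1 / (n * t)) + ennreal (1 / t) * ennreal \<bar>hI (YY \<omega>) - G\<bar>) \<partial>M)"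
    using pt t D0 by (intro nn_integral_mono) (simp add: ennreal_mult[symmetric] ennreal_plus[symmetric] del: ennreal_plus)
  also have "\<dots> = ennreal (1 / n) * (\<integral>\<^sup>+\<omega>. ennreal (D \<omega>) \<partial>M) + (ennreal (1 / (n * t)) + ennreal (1 / t) * (\<integral>\<^sup>+\<omega>. ennreal \<bar>hI (YY \<omega>) - G\<bar> \<partial>M))"
    using hI_rv by (simp add: nn_integral_add nn_integral_cmult emeasure_space_1)
  also have "(\<integral>\<^sup>+\<omega>. ennreal \<bar>hI (YY \<omega>) - G\<bar> \<partial>M) = ennreal E1"
    unfolding E1_def using int2 by (intro nn_integral_eq_integral) auto
  also have "ennreal (1 / n) * (\<integral>\<^sup>+\<omega>. ennreal (D \<omega>) \<partial>M) + (ennreal (1 / (n * t)) + ennreal (1 / t) * ennreal E1)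
     \<le> ennreal (1 / n) * ennreal (sqrt (2 * n) / t) + (ennreal (1 / (n * t)) + ennreal (1 / t) * ennreal E1)"
    by (intro add_mono mult_left_mono Dint) auto
  also have "\<dots> = ennreal (1 / n * (sqrt (2 * n) / t) + (1 / (n * t) + 1 / t * E1))"
    using t E1 by (simp add: ennreal_mult[symmetric] ennreal_plus[symmetric] del: ennreal_plus)
  finally have "expectation (\<lambda>\<omega>. \<bar>hI (YY \<omega>) - \<gamma> / (1 + n / m * \<gamma>)\<bar>) \<le> 1 / n * (sqrt (2 * n) / t) + (1 / (n * t) + 1 / t * E1)"
    using t E1 by (subst (asm) ennreal_le_iff) auto
  also have "\<dots> \<le> 1 / n * (sqrt (2 * n) / t) + (1 / (n * t) + 1 / t * (4 * sqrt (p + m) * (1 / n)))"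
    using hI_L1 t unfolding E1_def G_def by (intro add_left_mono mult_left_mono) auto
  also have "\<dots> = (sqrt (2 * n) / n + 1 / n + 4 * sqrt (p + m) / n) / t"
    using t npm by (simp add: field_simps)
  finally have "expectation (\<lambda>\<omega>. \<bar>hI (YY \<omega>) - \<gamma> / (1 + n / m * \<gamma>)\<bar>) \<le> (sqrt (2 * n) / n + 1 / n + 4 * sqrt (p + m) / n) / t" .
  moreover have "\<bar>G - \<gamma> / (1 + n / m * \<gamma>)\<bar> \<le> expectation (\<lambda>\<omega>. \<bar>hI (YY \<omega>) - \<gamma> / (1 + n / m * \<gamma>)\<bar>)"
  proof -
    have "G - \<gamma> / (1 + n / m * \<gamma>) = expectation (\<lambda>\<omega>. hI (YY \<omega>) - \<gamma> / (1 + n / m * \<gamma>))"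
      unfolding G_def using hI_int by (simp add: prob_space)
    then show ?thesis using integral_abs_bound by metis
  qed
  ultimately show "\<bar>G - \<gamma> / (1 + n / m * \<gamma>)\<bar> \<le> (sqrt (2 * n) / n + 1 / n + 4 * sqrt (p + m) / n) / t" by linarith
qed

text \<open>Each entry of \<open>A - I\<close> is a centred Gaussian quadratic form with
  \<open>p\<close> coefficients equal to \<open>1/p\<close>, hence has second moment at most
  \<open>2/p\<close>; there are \<open>n^2\<close> entries.\<close>

lemma fro2_GA_expectation:
  "(\<integral>\<^sup>+\<omega>. ennreal (fro2 (GA (XX \<omega>) - 1\<^sub>m n)) \<partial>M) \<le> ennreal (2 * (real n)\<^sup>2 / p)"
proof -
  let ?V = "{..<n} \<times> {..<p}"
  \<comment> \<open>The coefficients live on pairs of positions in rows \<open>i\<close> and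
    \<open>k\<close> of a common column, so the double sum runs over columns only.\<close>
  have diag_sum: "(\<Sum>u\<in>?V. \<Sum>v\<in>?V. if fst u = i \<and> fst v = k \<and> snd u = snd v then f u v else 0) = (\<Sum>j<p. f (i, j) (k, j))"
    if "i < n" "k < n" for i k and f :: "nat \<times> nat \<Rightarrow> nat \<times> nat \<Rightarrow> real"
  proof -
    have "(\<Sum>v\<in>?V. if fst u = i \<and> fst v = k \<and> snd u = snd v then f u v else 0) = (if fst u = i then f u (k, snd u) else 0)"
      if "u \<in> ?V" for u
    proof -
      have "(\<Sum>v\<in>?V. if fst u = i \<and> fst v = k \<and> snd u = snd v then f u v else 0)
        = (\<Sum>v\<in>?V. if v = (k, snd u) then (if fst u = i then f u (k, snd u) else 0) else 0)"
        by (intro sum.cong refl) (auto simp: prod_eq_iff)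
      also have "\<dots> = (if fst u = i then f u (k, snd u) else 0)"
        using that \<open>k < n\<close> by (subst sum.delta) auto
      finally show ?thesis .
    qed
    then have "(\<Sum>u\<in>?V. \<Sum>v\<in>?V. if fst u = i \<and> fst v = k \<and> snd u = snd v then f u v else 0)
      = (\<Sum>u\<in>?V. if fst u = i then f u (k, snd u) else 0)" by (intro sum.cong refl)
    also have "\<dots> = (\<Sum>u\<in>Pair i ` {..<p}. f u (k, snd u))"
      using that by (intro sum.mono_neutral_cong_right) auto
    also have "\<dots> = (\<Sum>j<p. f (i, j) (k, j))" by (subst sum.reindex) (auto simp: inj_on_def)
    finally show ?thesis .
  qed
  have entry: "(\<integral>\<^sup>+\<omega>. ennreal (((GA (XX \<omega>) - 1\<^sub>m n) $$ (i,k))\<^sup>2) \<partial>M) \<le> ennreal (2 / p)" if ik: "i < n" "k < n" for i k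
  proof -
    define R where "R u v = (if fst u = i \<and> fst v = k \<and> snd u = snd v then 1 / real p else 0)" for u v :: "nat \<times> nat"
    have "(\<integral>\<^sup>+\<omega>. ennreal ((\<Sum>u\<in>?V. \<Sum>v\<in>?V. R u v * ((case u of (i, j) \<Rightarrow> X i j) \<omega> * (case v of (i, j) \<Rightarrow> X i j) \<omega> - (if u = v then 1 else 0)))\<^sup>2) \<partial>M)
      \<le> ennreal (2 * (\<Sum>u\<in>?V. \<Sum>v\<in>?V. (R u v)\<^sup>2))"
      by (rule gaussian_quadratic_form[OF _ indX]) (auto intro: NX)
    moreover have "(\<Sum>u\<in>?V. \<Sum>v\<in>?V. (R u v)\<^sup>2) = 1 / p"
    proof -
      have "(\<Sum>u\<in>?V. \<Sum>v\<in>?V. (R u v)\<^sup>2) = (\<Sum>u\<in>?V. \<Sum>v\<in>?V. if fst u = i \<and> fst v = k \<and> snd u = snd v then (1 / real p)\<^sup>2 else 0)"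
        by (intro sum.cong refl) (auto simp: R_def)
      also have "\<dots> = p * (1 / p)\<^sup>2" unfolding diag_sum[OF ik] by simp
      finally show ?thesis using npm by (simp add: power2_eq_square)
    qed
    moreover have "(\<Sum>u\<in>?V. \<Sum>v\<in>?V. R u v * ((case u of (i, j) \<Rightarrow> X i j) \<omega> * (case v of (i, j) \<Rightarrow> X i j) \<omega> - (if u = v then 1 else 0)))
      = (GA (XX \<omega>) - 1\<^sub>m n) $$ (i,k)" for \<omega>
    proof -
      have "(\<Sum>u\<in>?V. \<Sum>v\<in>?V. R u v * ((case u of (i, j) \<Rightarrow> X i j) \<omega> * (case v of (i, j) \<Rightarrow> X i j) \<omega> - (if u = v then 1 else 0)))
        = (\<Sum>u\<in>?V. \<Sum>v\<in>?V. if fst u = i \<and> fst v = k \<and> snd u = snd v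
             then 1 / p * ((case u of (i, j) \<Rightarrow> X i j) \<omega> * (case v of (i, j) \<Rightarrow> X i j) \<omega> - (if u = v then 1 else 0)) else 0)"
        by (intro sum.cong refl) (auto simp: R_def)
      also have "\<dots> = (\<Sum>j<p. 1 / p * (X i j \<omega> * X k j \<omega> - (if i = k then 1 else 0)))"
        unfolding diag_sum[OF ik] by simp
      also have "\<dots> = 1 / p * (\<Sum>j<p. X i j \<omega> * X k j \<omega>) - (if i = k then 1 else 0)"
        using npm by (simp add: sum_divide_distrib sum_subtractf right_diff_distrib)
      also have "\<dots> = (GA (XX \<omega>) - 1\<^sub>m n) $$ (i,k)" using ik by (simp add: GA_def gram_def)
      finally show ?thesis .
    qed
    ultimately show ?thesis by simp
  qed
  have em: "(\<lambda>\<omega>. (GA (XX \<omega>) - 1\<^sub>m n) $$ (i,k)) \<in> borel_measurable M" if ik: "i < n" "k < n" for i k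
    by (rule GA_minus_one_meas[OF _ ik]) (rule rvX)
  have "(\<integral>\<^sup>+\<omega>. ennreal (fro2 (GA (XX \<omega>) - 1\<^sub>m n)) \<partial>M) = (\<integral>\<^sup>+\<omega>. (\<Sum>i<n. \<Sum>k<n. ennreal (((GA (XX \<omega>) - 1\<^sub>m n) $$ (i,k))\<^sup>2)) \<partial>M)"
    by (intro nn_integral_cong) (simp add: fro2_def sum_ennreal sum_nonneg)
  also have "\<dots> = (\<Sum>i<n. \<Sum>k<n. \<integral>\<^sup>+\<omega>. ennreal (((GA (XX \<omega>) - 1\<^sub>m n) $$ (i,k))\<^sup>2) \<partial>M)"
  proof -
    have m: "(\<lambda>\<omega>. ennreal (((GA (XX \<omega>) - 1\<^sub>m n) $$ (i,k))\<^sup>2)) \<in> borel_measurable M" if "i < n" "k < n" for i k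
      using em[OF that] by (intro measurable_compose[OF _ measurable_ennreal] borel_measurable_power)
    let ?e = "\<lambda>i k \<omega>. ennreal (((GA (XX \<omega>) - 1\<^sub>m n) $$ (i,k))\<^sup>2)"
    have "(\<integral>\<^sup>+\<omega>. (\<Sum>i<n. \<Sum>k<n. ?e i k \<omega>) \<partial>M) = (\<Sum>i<n. \<integral>\<^sup>+\<omega>. (\<Sum>k<n. ?e i k \<omega>) \<partial>M)"
      by (rule nn_integral_sum, rule borel_measurable_sum, rule m) simp_all
    also have "\<dots> = (\<Sum>i<n. \<Sum>k<n. \<integral>\<^sup>+\<omega>. ?e i k \<omega> \<partial>M)"
      by (rule sum.cong[OF refl], rule nn_integral_sum, rule m) simp_all
    finally show ?thesis .
  qed
  also have "\<dots> \<le> (\<Sum>i<n. \<Sum>k<n. ennreal (2 / p))" by (intro sum_mono entry) auto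
  also have "\<dots> = ennreal (\<Sum>i<n. \<Sum>k<n. 2 / p)" by (simp add: sum_ennreal sum_nonneg del: sum_constant)
  also have "(\<Sum>i<n. \<Sum>k<n. 2 / real p) = 2 * (real n)\<^sup>2 / p" by (simp add: power2_eq_square)
  finally show ?thesis .
qed

text \<open>\<open>d\<close> bounds the expectation of \<open>fro2 (A + e I - I) / n\<close>: twice
  \<open>2 n / p\<close> from the fluctuations plus \<open>2 e^2\<close> from the shift.\<close>

lemma he_hI_expectation:
  defines "d \<equiv> 4 * n / p + 2 * e\<^sup>2"
  shows "\<bar>expectation (\<lambda>\<omega>. he (XX \<omega>) (YY \<omega>)) - expectation (\<lambda>\<omega>. hI (YY \<omega>))\<bar> \<le> 4 * d + 2 * sqrt d"
proof -
  have d: "0 < d" using e by (simp add: d_def add_nonneg_pos)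
  \<comment> \<open>This choice balances \<open>d / s\<close> against \<open>s\<close> in
    \<open>he_hI_le\<close>.\<close>
  define s where "s = sqrt d"
  have s: "0 < s" "s * s = d" using d by (auto simp: s_def)
  define c where "c = 4 + 1 / s"
  have c: "0 < c" using s by (simp add: c_def add_pos_pos)
  let ?f = "\<lambda>\<omega>. fro2 (GA (XX \<omega>) - 1\<^sub>m n)"
  have fm: "?f \<in> borel_measurable M"
  proof -
    have em: "(\<lambda>\<omega>. (GA (XX \<omega>) - 1\<^sub>m n) $$ (i,k)) \<in> borel_measurable M" if ik: "i < n" "k < n" for i k
      by (rule GA_minus_one_meas[OF _ ik]) (rule rvX)
    have "?f = (\<lambda>\<omega>. \<Sum>i<n. \<Sum>k<n. ((GA (XX \<omega>) - 1\<^sub>m n) $$ (i,k))\<^sup>2)" by (simp add: fro2_def)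
    then show ?thesis by (simp only:) (intro borel_measurable_sum borel_measurable_power em, auto)
  qed
  have int: "integrable M (\<lambda>\<omega>. \<bar>he (XX \<omega>) (YY \<omega>) - hI (YY \<omega>)\<bar>)" using he_int hI_int by simp
  have "ennreal (expectation (\<lambda>\<omega>. \<bar>he (XX \<omega>) (YY \<omega>) - hI (YY \<omega>)\<bar>)) = (\<integral>\<^sup>+\<omega>. ennreal \<bar>he (XX \<omega>) (YY \<omega>) - hI (YY \<omega>)\<bar> \<partial>M)"
    using int by (intro nn_integral_eq_integral[symmetric]) auto
  also have "\<dots> \<le> (\<integral>\<^sup>+\<omega>. ennreal (c * 2 / n) * ennreal (?f \<omega>) + ennreal (c * (2 * e\<^sup>2) + s) \<partial>M)"
  proof (intro nn_integral_mono)
    fix \<omega>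
    have "\<bar>he (XX \<omega>) (YY \<omega>) - hI (YY \<omega>)\<bar> \<le> c * 2 / n * ?f \<omega> + (c * (2 * e\<^sup>2) + s)"
      using he_hI_le[OF s(1), of "XX \<omega>" "YY \<omega>"] unfolding c_def[symmetric] by (simp add: algebra_simps)
    then show "ennreal \<bar>he (XX \<omega>) (YY \<omega>) - hI (YY \<omega>)\<bar> \<le> ennreal (c * 2 / n) * ennreal (?f \<omega>) + ennreal (c * (2 * e\<^sup>2) + s)"
      using c s fro2_nonneg by (simp add: ennreal_mult[symmetric] ennreal_plus[symmetric] del: ennreal_plus)
  qed
  also have "\<dots> = ennreal (c * 2 / n) * (\<integral>\<^sup>+\<omega>. ennreal (?f \<omega>) \<partial>M) + ennreal (c * (2 * e\<^sup>2) + s)"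
    using fm by (simp add: nn_integral_add nn_integral_cmult emeasure_space_1)
  also have "\<dots> \<le> ennreal (c * 2 / n) * ennreal (2 * (real n)\<^sup>2 / p) + ennreal (c * (2 * e\<^sup>2) + s)"
    by (intro add_mono mult_left_mono fro2_GA_expectation) auto
  also have "\<dots> = ennreal (c * 2 / n * (2 * (real n)\<^sup>2 / p) + (c * (2 * e\<^sup>2) + s))"
    using c s by (simp add: ennreal_mult[symmetric] ennreal_plus[symmetric] del: ennreal_plus)
  also have "c * 2 / n * (2 * (real n)\<^sup>2 / p) + (c * (2 * e\<^sup>2) + s) = c * d + s"
    using npm by (simp add: d_def power2_eq_square algebra_simps)
  also have "c * d + s = 4 * d + 2 * s"
  proof -
    have "d / s = s" using s by (metis nonzero_mult_div_cancel_left less_irrefl)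
    then show ?thesis by (simp add: c_def algebra_simps)
  qed
  finally have "expectation (\<lambda>\<omega>. \<bar>he (XX \<omega>) (YY \<omega>) - hI (YY \<omega>)\<bar>) \<le> 4 * d + 2 * s"
    using d s by (subst (asm) ennreal_le_iff) auto
  moreover have "\<bar>expectation (\<lambda>\<omega>. he (XX \<omega>) (YY \<omega>)) - expectation (\<lambda>\<omega>. hI (YY \<omega>))\<bar> \<le> expectation (\<lambda>\<omega>. \<bar>he (XX \<omega>) (YY \<omega>) - hI (YY \<omega>)\<bar>)"
    using integral_abs_bound[of M "\<lambda>\<omega>. he (XX \<omega>) (YY \<omega>) - hI (YY \<omega>)"] he_int hI_int by simp
  ultimately show ?thesis by (simp add: s_def)
qed

text \<open>The square block of the first \<open>n\<close> columns is almost surely invertible, so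
  its transpose annihilates no nonzero \<open>v\<close>, and at least one square in the form
  \<open>v \<bullet> B v\<close>, which is \<open>1/m\<close> times the sum of the
  \<open>(w j)^2\<close>, is positive.\<close>

lemma GB_pd: "n \<le> m \<Longrightarrow> AE \<omega> in M. pd n (GB (YY \<omega>))"
proof -
  assume nm: "n \<le> m"
  have "indep_vars (\<lambda>_. borel) (\<lambda>(i, j). Y i j) ({..<n} \<times> {..<n})"
    by (rule indep_vars_subset[OF indYY]) (use nm in auto)
  from det_gaussian_nonzero[OF this, of n]
  have "AE \<omega> in M. Determinant.det (mat n n (\<lambda>q. (case q of (i, j) \<Rightarrow> Y i j) \<omega>)) \<noteq> 0"
    using NY nm by auto
  then show ?thesis
  proof eventually_elim
    case (elim \<omega>)
    define S where "S = mat n n (\<lambda>q. (case q of (i, j) \<Rightarrow> Y i j) \<omega>)"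
    have Sc: "S \<in> carrier_mat n n" "transpose_mat S \<in> carrier_mat n n" by (auto simp: S_def)
    have dT: "Determinant.det (transpose_mat S) \<noteq> 0" using elim det_transpose[OF Sc(1)] by (simp add: S_def)
    show ?case unfolding pd_def
    proof (intro conjI ballI impI psd_symm[OF psdAB(2)])
      fix v :: "real vec" assume v: "v \<in> carrier_vec n" "v \<noteq> 0\<^sub>v n"
      define z where "z = transpose_mat S *\<^sub>v v"
      have "z \<noteq> 0\<^sub>v n" using dT det_0_iff_vec_prod_zero_field[OF Sc(2)] v by (auto simp: z_def)
      then obtain j where j: "j < n" "z $ j \<noteq> 0" using Sc v by (metis z_def eq_vecI dim_mult_mat_vec carrier_matD(1) index_zero_vec)
      have zj: "z $ j = (\<Sum>i<n. Y i j \<omega> * v $ i)"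
        using j v by (simp add: z_def S_def scalar_prod_def lessThan_atLeast0)
      define w where "w j = (\<Sum>i<n. Y i j \<omega> * v $ i)" for j
      have "v \<bullet> (GB (YY \<omega>) *\<^sub>v v) = (\<Sum>i<n. \<Sum>k<n. v $ i * (1 / m * (\<Sum>j<m. Y i j \<omega> * Y k j \<omega>) * v $ k))"
        using v by (auto simp: GB_def gram_def scalar_prod_def lessThan_atLeast0 sum_distrib_left intro!: sum.cong)
      also have "\<dots> = (\<Sum>i<n. \<Sum>k<n. \<Sum>j<m. 1 / m * ((Y i j \<omega> * v $ i) * (Y k j \<omega> * v $ k)))"
        by (intro sum.cong refl) (simp add: sum_distrib_left sum_distrib_right mult_ac)
      also have "\<dots> = (\<Sum>i<n. \<Sum>j<m. \<Sum>k<n. 1 / m * ((Y i j \<omega> * v $ i) * (Y k j \<omega> * v $ k)))"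
        by (intro sum.cong refl sum.swap)
      also have "\<dots> = (\<Sum>j<m. \<Sum>i<n. \<Sum>k<n. 1 / m * ((Y i j \<omega> * v $ i) * (Y k j \<omega> * v $ k)))"
        by (rule sum.swap)
      also have "\<dots> = (\<Sum>j<m. 1 / m * (w j)\<^sup>2)"
        unfolding w_def power2_eq_square sum_product by (intro sum.cong refl) (simp add: sum_distrib_left)
      finally have eq: "v \<bullet> (GB (YY \<omega>) *\<^sub>v v) = (\<Sum>j<m. 1 / m * (w j)\<^sup>2)" .
      show "0 < v \<bullet> (GB (YY \<omega>) *\<^sub>v v)" unfolding eq
        by (rule sum_pos2[of _ j]) (use j nm npm zj in \<open>auto simp: w_def\<close>)
    qed
  qed
qed

end

section \<open>Almost sure convergence\<close>

text \<open>Fatou's lemma for indicators: a strict inequality for the limit holds eventually along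
  the sequence. This transports a tail bound that is uniform in the shift to the unshifted
  statistic.\<close>

lemma (in prob_space) prob_limit_le:
  fixes f :: "nat \<Rightarrow> 'a \<Rightarrow> real" and f0 :: "'a \<Rightarrow> real"
  assumes [measurable]: "\<And>k. f k \<in> borel_measurable M" "f0 \<in> borel_measurable M"
    and lim: "AE \<omega> in M. (\<lambda>k. f k \<omega>) \<longlonglongrightarrow> f0 \<omega>"
    and le: "\<And>k. prob {\<omega> \<in> space M. a \<le> \<bar>f k \<omega> - \<tau>\<bar>} \<le> q"
  shows "prob {\<omega> \<in> space M. a < \<bar>f0 \<omega> - \<tau>\<bar>} \<le> q"
proof -
  have q: "0 \<le> q" using le[of 0] measure_nonneg order.trans by blast
  let ?I = "\<lambda>k. indicator {\<omega> \<in> space M. a \<le> \<bar>f k \<omega> - \<tau>\<bar>} :: 'a \<Rightarrow> ennreal"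
  have "emeasure M {\<omega> \<in> space M. a < \<bar>f0 \<omega> - \<tau>\<bar>} = (\<integral>\<^sup>+\<omega>. indicator {\<omega> \<in> space M. a < \<bar>f0 \<omega> - \<tau>\<bar>} \<omega> \<partial>M)" by simp
  also have "\<dots> \<le> (\<integral>\<^sup>+\<omega>. liminf (\<lambda>k. ?I k \<omega>) \<partial>M)"
  proof (rule nn_integral_mono_AE)
    show "AE \<omega> in M. indicator {\<omega> \<in> space M. a < \<bar>f0 \<omega> - \<tau>\<bar>} \<omega> \<le> liminf (\<lambda>k. ?I k \<omega>)"
      using lim AE_space
    proof eventually_elim
      case (elim \<omega>)
      show ?case
      proof (cases "a < \<bar>f0 \<omega> - \<tau>\<bar>")
        case True
        have "(\<lambda>k. \<bar>f k \<omega> - \<tau>\<bar>) \<longlonglongrightarrow> \<bar>f0 \<omega> - \<tau>\<bar>" using elim by (intro tendsto_intros)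
        then have "eventually (\<lambda>k. a < \<bar>f k \<omega> - \<tau>\<bar>) sequentially" using True by (rule order_tendstoD(1))
        then have "eventually (\<lambda>k. 1 \<le> ?I k \<omega>) sequentially"
          by eventually_elim (use elim in auto)
        then have "1 \<le> liminf (\<lambda>k. ?I k \<omega>)" by (rule Liminf_bounded)
        then show ?thesis by (auto split: split_indicator)
      qed auto
    qed
  qed
  also have "\<dots> \<le> liminf (\<lambda>k. \<integral>\<^sup>+\<omega>. ?I k \<omega> \<partial>M)" by (rule nn_integral_liminf) measurable
  also have "\<dots> \<le> liminf (\<lambda>k. ennreal q)"
  proof (intro Liminf_mono always_eventually allI)
    fix k
    have "(\<integral>\<^sup>+\<omega>. ?I k \<omega> \<partial>M) = ennreal (prob {\<omega> \<in> space M. a \<le> \<bar>f k \<omega> - \<tau>\<bar>})"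
      by (simp add: emeasure_eq_measure)
    also have "\<dots> \<le> ennreal q" using le by (rule ennreal_leI)
    finally show "(\<integral>\<^sup>+\<omega>. ?I k \<omega> \<partial>M) \<le> ennreal q" .
  qed
  also have "\<dots> = ennreal q" by (simp add: Liminf_const)
  finally show ?thesis using q by (simp add: emeasure_eq_measure)
qed

text \<open>The quadratic equation rearranges to \<open>H (t + y (1 - H)) = 1 - H\<close>, the fixed
  point form. Writing the radicand as \<open>(t + 1 - y)^2 + 4 y t\<close> shows that it is
  nonnegative and that \<open>H \<le> 1\<close>.\<close>

lemma H_lim_props:
  assumes y: "0 < y" "y \<le> 1" and t: "0 < t"
  defines "H \<equiv> H_lim y t" and "\<gamma> \<equiv> (1 - H_lim y t) / t"
  shows "0 \<le> \<gamma>" "H = \<gamma> / (1 + y * \<gamma>)"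
proof -
  define D where "D = (t + y + 1)\<^sup>2 - 4 * y"
  have D: "D = (t + 1 - y)\<^sup>2 + 4 * y * t" by (simp add: D_def power2_eq_square algebra_simps)
  have D0: "0 \<le> D" unfolding D using y t by simp
  have H: "H = ((t + y + 1) - sqrt D) / (2 * y)" by (simp add: H_def H_lim_def D_def)
  have "sqrt ((t + 1 - y)\<^sup>2) \<le> sqrt D" unfolding D using y t by (intro real_sqrt_le_mono) simp
  then have "t + 1 - y \<le> sqrt D" by simp
  then have "H \<le> 1" unfolding H using y by (simp add: pos_divide_le_eq)
  then show g: "0 \<le> \<gamma>" using t by (simp add: \<gamma>_def H_def)
  have "sqrt D = t + y + 1 - 2 * y * H" using y by (simp add: H)
  then have "(t + y + 1 - 2 * y * H)\<^sup>2 = D" using D0 by (metis real_sqrt_pow2)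
  then have "4 * y * (y * H\<^sup>2 - (t + y + 1) * H + 1) = 0" by (simp add: D_def power2_eq_square algebra_simps)
  then have quad: "y * H\<^sup>2 - (t + y + 1) * H + 1 = 0" using y by simp
  have tg: "1 - H = t * \<gamma>" using t by (simp add: \<gamma>_def H_def)
  have "t * (H * (1 + y * \<gamma>)) = H * (t + y * (1 - H))" unfolding tg by (simp add: algebra_simps)
  also have "\<dots> = 1 - H" using quad by (simp add: power2_eq_square algebra_simps)
  finally have "H * (1 + y * \<gamma>) = \<gamma>" using t unfolding tg by simp
  moreover have "0 < 1 + y * \<gamma>" using g y by (simp add: add_pos_nonneg)
  ultimately show "H = \<gamma> / (1 + y * \<gamma>)" by (simp add: eq_divide_eq)
qed

text \<open>
  Both \<open>t \<gamma>\<close> and \<open>\<gamma>/(1 + y \<gamma>)\<close> increase with \<open>\<gamma>\<close>, so the fixed point equation is stable with constant \<open>1/t\<close>.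
\<close>

lemma fixed_point_stability:
  fixes G t y r err :: real
  assumes y: "0 < y" "y \<le> 1" and t: "0 < t" and r: "0 \<le> r" and G: "0 \<le> G" "G \<le> 1"
    and le: "\<bar>G - ((1 - G) / t) / (1 + r * ((1 - G) / t))\<bar> \<le> err"
  shows "\<bar>G - H_lim y t\<bar> \<le> err + (1 / t)\<^sup>2 * \<bar>r - y\<bar>"
proof -
  define \<gamma> where "\<gamma> = (1 - G) / t"
  define \<gamma>0 where "\<gamma>0 = (1 - H_lim y t) / t"
  have g: "0 \<le> \<gamma>" "\<gamma> \<le> 1 / t" using G t by (auto simp: \<gamma>_def divide_right_mono)
  note H = H_lim_props[OF y t, folded \<gamma>0_def]
  have GH: "G = 1 - t * \<gamma>" "H_lim y t = 1 - t * \<gamma>0" using t by (simp_all add: \<gamma>_def \<gamma>0_def)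
  define \<psi> where "\<psi> z = z / (1 + y * z)" for z
  have mono: "\<psi> a \<le> \<psi> b" if "0 \<le> a" "a \<le> b" for a b
  proof -
    have "0 < 1 + y * a" "0 < 1 + y * b" using that y by (auto intro!: add_pos_nonneg)
    then have "\<psi> b - \<psi> a = (b - a) / ((1 + y * b) * (1 + y * a))" unfolding \<psi>_def by (simp add: field_simps)
    also have "\<dots> \<ge> 0" using that \<open>0 < 1 + y * a\<close> \<open>0 < 1 + y * b\<close> by simp
    finally show ?thesis by simp
  qed
  have stab: "t * \<bar>\<gamma> - \<gamma>0\<bar> \<le> \<bar>1 - t * \<gamma> - \<psi> \<gamma>\<bar>"
  proof -
    have z: "1 - t * \<gamma>0 - \<psi> \<gamma>0 = 0" using H(2) GH(2) by (simp add: \<psi>_def)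
    then have eq: "1 - t * \<gamma> - \<psi> \<gamma> = t * (\<gamma>0 - \<gamma>) + (\<psi> \<gamma>0 - \<psi> \<gamma>)" by (simp add: algebra_simps)
    show ?thesis
    proof (cases "\<gamma> \<le> \<gamma>0")
      case True
      then have "0 \<le> \<psi> \<gamma>0 - \<psi> \<gamma>" using mono[OF g(1)] by simp
      then show ?thesis unfolding eq using True t by simp
    next
      case False
      then have "0 \<le> \<psi> \<gamma> - \<psi> \<gamma>0" using mono[OF H(1), of \<gamma>] by simp
      moreover have "t * \<bar>\<gamma> - \<gamma>0\<bar> = - (t * (\<gamma>0 - \<gamma>))" using False by (simp add: algebra_simps)
      ultimately show ?thesis unfolding eq by linarith
    qed
  qed
  \<comment> \<open>Replacing the finite ratio \<open>r\<close> by its limit \<open>y\<close> costs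
    at most \<open>\<gamma>^2 |r - y|\<close>, and \<open>\<gamma> \<le> 1/t\<close>.\<close>
  have diff: "\<bar>\<gamma> / (1 + r * \<gamma>) - \<psi> \<gamma>\<bar> \<le> (1 / t)\<^sup>2 * \<bar>r - y\<bar>"
  proof -
    define P where "P = (1 + r * \<gamma>) * (1 + y * \<gamma>)"
    have p: "1 \<le> 1 + r * \<gamma>" "1 \<le> 1 + y * \<gamma>" using g r y by auto
    have P: "1 \<le> P" unfolding P_def using mult_mono[OF p] p by simp
    have "\<gamma> / (1 + r * \<gamma>) - \<psi> \<gamma> = \<gamma>\<^sup>2 * (y - r) / P"
      using p unfolding \<psi>_def P_def by (simp add: field_simps power2_eq_square)
    then have "\<bar>\<gamma> / (1 + r * \<gamma>) - \<psi> \<gamma>\<bar> = \<gamma>\<^sup>2 * \<bar>r - y\<bar> / P"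
      using P by (simp add: abs_mult abs_divide abs_minus_commute)
    also have "\<dots> \<le> \<gamma>\<^sup>2 * \<bar>r - y\<bar> / 1" using P by (intro divide_left_mono) auto
    also have "\<dots> \<le> (1 / t)\<^sup>2 * \<bar>r - y\<bar>" using g by (simp, intro mult_right_mono power_mono, auto)
    finally show ?thesis .
  qed
  have "\<bar>G - H_lim y t\<bar> = t * \<bar>\<gamma> - \<gamma>0\<bar>"
  proof -
    have "G - H_lim y t = t * (\<gamma>0 - \<gamma>)" by (simp add: GH algebra_simps)
    then show ?thesis using t by (simp add: abs_mult abs_minus_commute)
  qed
  also have "\<dots> \<le> \<bar>G - \<psi> \<gamma>\<bar>" using stab by (simp add: GH)
  also have "\<dots> \<le> \<bar>G - \<gamma> / (1 + r * \<gamma>)\<bar> + \<bar>\<gamma> / (1 + r * \<gamma>) - \<psi> \<gamma>\<bar>" by simp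
  also have "\<dots> \<le> err + (1 / t)\<^sup>2 * \<bar>r - y\<bar>" using le diff by (simp add: \<gamma>_def)
  finally show ?thesis .
qed

text \<open>In absolute value the exponent is at least a constant times
  \<open>n powr (1 - \<nu>)\<close>. From \<open>(1 + x/3)^3 \<le> exp x\<close> comes
  \<open>exp (- x) \<le> 27 / x^3\<close>, and \<open>\<nu> < 1/3\<close> makes the resulting power
  \<open>- 3 (1 - \<nu>)\<close> smaller than -2.\<close>

lemma summable_exp_powr:
  fixes N :: "nat \<Rightarrow> real"
  assumes \<nu>: "\<nu> < 1/3" and c: "0 < c" and C: "0 < C"
    and N: "eventually (\<lambda>n. 0 < N n \<and> N n \<le> C * real n powr (1 + \<nu>)) sequentially"
  shows "summable (\<lambda>n. exp (- c * (real n)\<^sup>2 / N n))"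
proof (rule summable_comparison_test_ev)
  show "summable (\<lambda>n. 27 * (C / c) ^ 3 * real n powr (- 3 * (1 - \<nu>)))"
    using \<nu> by (intro summable_mult) (simp add: summable_real_powr_iff)
  show "eventually (\<lambda>n. norm (exp (- c * (real n)\<^sup>2 / N n)) \<le> 27 * (C / c) ^ 3 * real n powr (- 3 * (1 - \<nu>))) sequentially"
    using N eventually_gt_at_top[of 0]
  proof eventually_elim
    case (elim n)
    define x where "x = c / C * real n powr (1 - \<nu>)"
    have x: "0 < x" using c C elim by (simp add: x_def)
    have "c * (real n)\<^sup>2 / (C * real n powr (1 + \<nu>)) \<le> c * (real n)\<^sup>2 / N n"
      using elim c by (intro divide_left_mono) (auto intro!: mult_pos_pos C)
    also have "c * (real n)\<^sup>2 / (C * real n powr (1 + \<nu>)) = x"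
    proof -
      have sq: "(real n)\<^sup>2 = real n powr 2" using elim by simp
      have "(real n)\<^sup>2 / real n powr (1 + \<nu>) = real n powr (2 - (1 + \<nu>))"
        unfolding sq by (simp only: powr_diff)
      also have "2 - (1 + \<nu>) = 1 - \<nu>" by simp
      finally have "c / C * ((real n)\<^sup>2 / real n powr (1 + \<nu>)) = x" unfolding x_def by simp
      then show ?thesis by simp
    qed
    finally have "exp (- c * (real n)\<^sup>2 / N n) \<le> exp (- x)" by simp
    also have "\<dots> \<le> 27 / x ^ 3"
    proof -
      have "(x / 3) ^ 3 \<le> (1 + x / 3) ^ 3" using x by (intro power_mono) auto
      also have "\<dots> \<le> exp x" using exp_ge_one_plus_x_over_n_power_n[of 3 x] x by simp
      finally have "x ^ 3 / 27 \<le> exp x" by (simp add: power_divide)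
      then show ?thesis using x by (simp add: exp_minus field_simps)
    qed
    also have "\<dots> = 27 * (C / c) ^ 3 * real n powr (- 3 * (1 - \<nu>))"
    proof -
      have "(real n powr (1 - \<nu>)) ^ 3 = real n powr (3 * (1 - \<nu>))"
        using elim by (simp add: powr_power mult.commute)
      moreover have "real n powr (- 3 * (1 - \<nu>)) = 1 / real n powr (3 * (1 - \<nu>))"
        using powr_minus_divide[of "real n" "3 * (1 - \<nu>)"] by simp
      ultimately show ?thesis using c C by (simp add: x_def power_mult_distrib power_divide field_simps)
    qed
    finally show ?case by simp
  qed
qed

text \<open>\<open>mat_inverse\<close> is partial; positive definiteness guarantees that it returns
  a value, which is \<open>minv\<close> by uniqueness.\<close>

lemma F_mat_gram:
  assumes pd: "pd n (gram n {..<m} (1 / real m) y)"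
  shows "F_mat n p m x y = gram n {..<p} (1 / real p) x * minv (gram n {..<m} (1 / real m) y)"
proof -
  have g: "(1 / real q) \<cdot>\<^sub>m (mat n q (\<lambda>(i,j). z i j) * transpose_mat (mat n q (\<lambda>(i,j). z i j))) = gram n {..<q} (1 / real q) z" for q and z :: "nat \<Rightarrow> nat \<Rightarrow> real"
    by (intro eq_matI) (auto simp: gram_def scalar_prod_def lessThan_atLeast0 intro!: sum.cong)
  let ?B = "gram n {..<m} (1 / real m) y"
  have c: "?B \<in> carrier_mat n n" by simp
  have "mat_inverse ?B \<noteq> None"
  proof
    assume "mat_inverse ?B = None"
    from mat_inverse(1)[OF c this, of "()"] show False
      using minv_left[OF c pd_det[OF pd]] minv_right[OF c pd_det[OF pd]] minv_carrier[OF c] c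
      by (auto simp: Units_def ring_mat_def)
  qed
  then obtain S where S: "mat_inverse ?B = Some S" by auto
  from mat_inverse(2)[OF c this] have "S = minv ?B" using minv_unique[OF c, of S] by simp
  then show ?thesis unfolding F_mat_def Let_def g S by simp
qed

locale fisher_sequence = prob_space M for M :: "'a measure" +
  fixes n1 n2 :: "nat \<Rightarrow> nat" and X Y :: "nat \<Rightarrow> nat \<Rightarrow> nat \<Rightarrow> 'a \<Rightarrow> real" and y \<nu> :: real
  assumes n1_ge: "\<And>n. n1 n \<ge> n" and n2_ge: "\<And>n. n2 n \<ge> n"
    and NX: "\<And>n i j. i < n \<Longrightarrow> j < n1 n \<Longrightarrow> distributed M lborel (X n i j) std_normal_density"
    and NY: "\<And>n i j. i < n \<Longrightarrow> j < n2 n \<Longrightarrow> distributed M lborel (Y n i j) std_normal_density"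
    and ind: "\<And>n. indep_vars (\<lambda>_. borel) (case_sum (\<lambda>(i,j). X n i j) (\<lambda>(i,j). Y n i j))
               (Inl ` ({..<n} \<times> {..<n1 n}) \<union> Inr ` ({..<n} \<times> {..<n2 n}))"
    and lim1: "(\<lambda>n. real n / real (n1 n)) \<longlonglongrightarrow> 0"
    and lim2: "(\<lambda>n. real n / real (n2 n)) \<longlonglongrightarrow> y"
    and y: "0 < y" "y \<le> 1" and \<nu>: "0 < \<nu>" "\<nu> < 1/3"
    and O: "(\<lambda>n. real (n1 n)) \<in> O(\<lambda>n. real n powr (1 + \<nu>))"
begin

section \<open>The statistics along the sequence\<close>

definition A :: "nat \<Rightarrow> 'a \<Rightarrow> real mat" where "A n \<omega> = gram n {..<n1 n} (1 / real (n1 n)) (\<lambda>i j. X n i j \<omega>)"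
definition B :: "nat \<Rightarrow> 'a \<Rightarrow> real mat" where "B n \<omega> = gram n {..<n2 n} (1 / real (n2 n)) (\<lambda>i j. Y n i j \<omega>)"
definition hh :: "real \<Rightarrow> nat \<Rightarrow> 'a \<Rightarrow> real" where
  "hh t n \<omega> = mtrace (B n \<omega> * minv (B n \<omega> + t \<cdot>\<^sub>m A n \<omega>)) / real n"

abbreviation "reg t e n \<omega> \<equiv> mtrace (B n \<omega> * minv (B n \<omega> + t \<cdot>\<^sub>m (A n \<omega> + e \<cdot>\<^sub>m 1\<^sub>m n))) / real n"

lemma gp:
  assumes "0 < n" "0 < t" "0 < e"
  shows "gaussian_pair M n (n1 n) (n2 n) t e (X n) (Y n)"
  using assms n1_ge[of n] n2_ge[of n] by unfold_locales (auto intro!: NX NY ind)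

lemma carriers[simp]: "A n \<omega> \<in> carrier_mat n n" "B n \<omega> \<in> carrier_mat n n"
  by (simp_all add: A_def B_def)

lemma A_psd: "psd n (A n \<omega>)" unfolding A_def by (rule psd_gram) auto

lemma B_pd: "AE \<omega> in M. \<forall>n. 0 < n \<longrightarrow> pd n (B n \<omega>)"
  unfolding AE_all_countable
proof (intro allI)
  fix n
  show "AE \<omega> in M. 0 < n \<longrightarrow> pd n (B n \<omega>)"
  proof (cases "0 < n")
    case True
    interpret gaussian_pair M n "n1 n" "n2 n" 1 1 "X n" "Y n" by (rule gp[OF True]) auto
    show ?thesis using GB_pd[OF n2_ge] by (simp add: GB_def B_def)
  qed simp
qed

lemma hh_meas: assumes n: "0 < n" and t: "0 < t" shows "hh t n \<in> borel_measurable M"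
proof -
  interpret gaussian_pair M n "n1 n" "n2 n" t 1 "X n" "Y n" by (rule gp[OF n t]) auto
  have "(\<lambda>\<omega>. stat (GB (\<lambda>i j. Y n i j \<omega>)) (GA (\<lambda>i j. X n i j \<omega>))) \<in> borel_measurable M"
    by (rule stat_meas) (auto intro!: GA_meas GB_meas rvX rvY)
  then show ?thesis by (simp add: stat_def GA_def GB_def hh_def[abs_def] A_def B_def)
qed

text \<open>Definiteness of \<open>B\<close> keeps the matrix invertible at shift 0, so the cofactor
  formula for the inverse is continuous there.\<close>

lemma he_tendsto_hh:
  assumes n: "0 < n" and t: "0 < t" and pd: "pd n (B n \<omega>)" and e: "e \<longlonglongrightarrow> 0"
  shows "(\<lambda>k. reg t (e k) n \<omega>) \<longlonglongrightarrow> hh t n \<omega>"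
proof -
  have pd': "pd n (B n \<omega> + t \<cdot>\<^sub>m A n \<omega>)" using t by (intro pd_add_psd pd psd_smult A_psd) auto
  have c: "B n \<omega> + t \<cdot>\<^sub>m (A n \<omega> + s \<cdot>\<^sub>m 1\<^sub>m n) \<in> carrier_mat n n" "B n \<omega> + t \<cdot>\<^sub>m A n \<omega> \<in> carrier_mat n n" for s by simp_all
  have ent: "(\<lambda>k. (B n \<omega> + t \<cdot>\<^sub>m (A n \<omega> + e k \<cdot>\<^sub>m 1\<^sub>m n)) $$ (i,j)) \<longlonglongrightarrow> (B n \<omega> + t \<cdot>\<^sub>m A n \<omega>) $$ (i,j)" if ij: "i < n" "j < n" for i j
  proof -
    have "(B n \<omega> + t \<cdot>\<^sub>m (A n \<omega> + s \<cdot>\<^sub>m 1\<^sub>m n)) $$ (i,j) = B n \<omega> $$ (i,j) + t * (A n \<omega> $$ (i,j) + s * (if i = j then 1 else 0))" for s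
      using ij carrier_matD[OF carriers(1)[of n \<omega>]] carrier_matD[OF carriers(2)[of n \<omega>]] by simp
    moreover have "(\<lambda>k. B n \<omega> $$ (i,j) + t * (A n \<omega> $$ (i,j) + e k * (if i = j then 1 else 0))) \<longlonglongrightarrow>
        B n \<omega> $$ (i,j) + t * (A n \<omega> $$ (i,j) + 0 * (if i = j then 1 else 0))"
      by (intro tendsto_intros e)
    moreover have "(B n \<omega> + t \<cdot>\<^sub>m A n \<omega>) $$ (i,j) = B n \<omega> $$ (i,j) + t * A n \<omega> $$ (i,j)"
      using ij carrier_matD[OF carriers(1)[of n \<omega>]] carrier_matD[OF carriers(2)[of n \<omega>]] by simp
    ultimately show ?thesis by simp
  qed
  have mt: "mtrace (B n \<omega> * minv S) = (\<Sum>i<n. \<Sum>k<n. B n \<omega> $$ (i,k) * minv S $$ (k,i))" if "S \<in> carrier_mat n n" for S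
    by (rule mtrace_mult[OF carriers(2) minv_carrier[OF that]])
  show ?thesis unfolding hh_def mt[OF c(1)] mt[OF c(2)]
    by (intro tendsto_divide tendsto_sum tendsto_mult tendsto_const minv_tendsto[OF c(1) c(2) ent pd_det[OF pd']]) (use n in auto)
qed

section \<open>Almost sure convergence of the transform\<close>

lemma n1_pos: "0 < n \<Longrightarrow> 0 < n1 n" and n2_pos: "0 < n \<Longrightarrow> 0 < n2 n"
  using n1_ge[of n] n2_ge[of n] by auto

text \<open>The positive limit \<open>y\<close> bounds \<open>n2 n\<close> by a multiple of
  \<open>n\<close>, so the growth bound for \<open>n1\<close> carries over to the number of
  columns.\<close>

lemma sum_growth:
  obtains C where "0 < C" "eventually (\<lambda>n. 0 < real (n1 n + n2 n) \<and> real (n1 n + n2 n) \<le> C * real n powr (1 + \<nu>)) sequentially"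
proof -
  from O obtain c where c: "c > 0" "eventually (\<lambda>n. norm (real (n1 n)) \<le> c * norm (real n powr (1 + \<nu>))) sequentially"
    by (rule landau_o.bigE)
  have "eventually (\<lambda>n. y / 2 < real n / real (n2 n)) sequentially"
    using lim2 y by (intro order_tendstoD(1)) auto
  then have "eventually (\<lambda>n. 0 < real (n1 n + n2 n) \<and> real (n1 n + n2 n) \<le> (c + 2 / y) * real n powr (1 + \<nu>)) sequentially"
    using c(2) eventually_gt_at_top[of 0]
  proof eventually_elim
    case (elim n)
    have "real (n2 n) \<le> 2 / y * real n" using elim n2_pos[of n] y by (simp add: field_simps)
    also have "\<dots> \<le> 2 / y * real n powr (1 + \<nu>)"
    proof (intro mult_left_mono)
      have "real n powr 1 \<le> real n powr (1 + \<nu>)" using elim \<nu> by (intro powr_mono) auto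
      then show "real n \<le> real n powr (1 + \<nu>)" by simp
    qed (use y in auto)
    finally show ?case using elim n1_pos[of n] by (simp add: algebra_simps)
  qed
  then show ?thesis using that[of "c + 2 / y"] c y by (simp add: add_pos_pos)
qed

lemma ratio_tendsto: "(\<lambda>n. sqrt (real (n1 n + n2 n)) / real n) \<longlonglongrightarrow> 0"
proof -
  obtain C where C: "0 < C" "eventually (\<lambda>n. 0 < real (n1 n + n2 n) \<and> real (n1 n + n2 n) \<le> C * real n powr (1 + \<nu>)) sequentially"
    by (rule sum_growth)
  have h: "((\<lambda>n. sqrt (C * real n powr (1 + \<nu>)) / real n) \<longlongrightarrow> 0) sequentially"
    using C(1) \<nu> by real_asymp
  have up: "eventually (\<lambda>n. sqrt (real (n1 n + n2 n)) / real n \<le> sqrt (C * real n powr (1 + \<nu>)) / real n) sequentially"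
    using C(2) by eventually_elim (intro divide_right_mono real_sqrt_le_mono, auto)
  have lo: "eventually (\<lambda>n. 0 \<le> sqrt (real (n1 n + n2 n)) / real n) sequentially" by simp
  show ?thesis by (rule tendsto_sandwich[OF lo up tendsto_const h])
qed

text \<open>The range of \<open>n\<close> must not depend on the shift \<open>e\<close>, since
  \<open>e\<close> is sent to 0 at fixed \<open>n\<close> afterwards.\<close>

lemma expectation_he:
  assumes t: "0 < t" and \<delta>: "0 < \<delta>"
  obtains e0 where "0 < e0" "eventually (\<lambda>n. \<forall>e. 0 < e \<and> e \<le> e0 \<longrightarrow>
    \<bar>expectation (\<lambda>\<omega>. reg t e n \<omega>) - H_lim y t\<bar> \<le> \<delta>) sequentially"
proof -
  \<comment> \<open>For \<open>d \<le> \<eta> \<le> 1\<close> one has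
    \<open>d \<le> sqrt d \<le> \<delta>/12\<close>, hence
    \<open>4 d + 2 sqrt d \<le> \<delta>/2\<close>.\<close>
  define \<eta> where "\<eta> = min 1 ((\<delta> / 12)\<^sup>2)"
  have "sqrt \<eta> \<le> sqrt ((\<delta> / 12)\<^sup>2)" by (intro real_sqrt_le_mono) (simp add: \<eta>_def)
  then have \<eta>: "0 < \<eta>" "\<eta> \<le> 1" "sqrt \<eta> \<le> \<delta> / 12" using \<delta> by (auto simp: \<eta>_def)
  \<comment> \<open>With \<open>e \<le> e0\<close> the shift contributes at most
    \<open>\<eta>/2\<close> to \<open>d\<close>; the other half is left for
    \<open>4 n / n1 n\<close>.\<close>
  define e0 where "e0 = sqrt \<eta> / 2"
  define err where "err n = (sqrt (2 * real n) / n + 1 / n + 4 * sqrt (real (n1 n + n2 n)) / n) / t + (1 / t)\<^sup>2 * \<bar>real n / real (n2 n) - y\<bar>" for n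
  have l1: "(\<lambda>n. sqrt (2 * real n) / real n) \<longlonglongrightarrow> 0" by real_asymp
  have l2: "(\<lambda>n. 1 / real n) \<longlonglongrightarrow> 0" by real_asymp
  have l3: "(\<lambda>n. 4 * sqrt (real (n1 n + n2 n)) / real n) \<longlonglongrightarrow> 4 * 0"
    using tendsto_mult_left[OF ratio_tendsto, of 4] by simp
  have "t \<noteq> 0" using t by simp
  then have "err \<longlonglongrightarrow> (0 + 0 + 4 * 0) / t + (1 / t)\<^sup>2 * \<bar>y - y\<bar>"
    unfolding err_def
    by (intro tendsto_add[OF tendsto_divide[OF tendsto_add[OF tendsto_add[OF l1 l2] l3] tendsto_const]
          tendsto_mult[OF tendsto_const tendsto_rabs[OF tendsto_diff[OF lim2 tendsto_const]]]])
  then have "eventually (\<lambda>n. err n < \<delta> / 2) sequentially" using \<delta> by (intro order_tendstoD(2)) auto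
  moreover have "eventually (\<lambda>n. real n / real (n1 n) < \<eta> / 8) sequentially"
    using lim1 \<eta> by (intro order_tendstoD(2)) auto
  ultimately have "eventually (\<lambda>n. \<forall>e. 0 < e \<and> e \<le> e0 \<longrightarrow>
    \<bar>expectation (\<lambda>\<omega>. reg t e n \<omega>) - H_lim y t\<bar> \<le> \<delta>) sequentially"
    using eventually_gt_at_top[of 0]
  proof (eventually_elim, intro allI impI)
    fix n :: nat and e :: real
    assume e1: "err n < \<delta> / 2" and e2: "real n / real (n1 n) < \<eta> / 8" and n: "0 < n" and e: "0 < e \<and> e \<le> e0"
    interpret gaussian_pair M n "n1 n" "n2 n" t e "X n" "Y n" by (rule gp[OF n t]) (use e in auto)
    have he: "he (\<lambda>i j. X n i j \<omega>) (\<lambda>i j. Y n i j \<omega>) = reg t e n \<omega>" for \<omega>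
      by (simp add: he_def stat_def GA_def GB_def A_def B_def)
    define d where "d = 4 * n / n1 n + 2 * e\<^sup>2"
    have "e \<le> e0" "0 \<le> e" using \<open>0 < e \<and> e \<le> e0\<close> by auto
    then have "e\<^sup>2 \<le> e0\<^sup>2" by (rule power_mono)
    then have "e\<^sup>2 \<le> \<eta> / 4" using \<eta> by (simp add: e0_def power_divide)
    moreover have "d = 4 * (real n / real (n1 n)) + 2 * e\<^sup>2" by (simp add: d_def)
    ultimately have d\<eta>: "d \<le> \<eta>" using e2 by linarith
    have d0: "0 \<le> d" by (simp add: d_def)
    have "d \<le> sqrt d"
    proof -
      have "sqrt d \<le> 1" using d\<eta> \<eta> by simp
      then have "sqrt d * sqrt d \<le> sqrt d * 1" using d0 by (intro mult_left_mono) auto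
      then show ?thesis using d0 by simp
    qed
    moreover have "sqrt d \<le> \<delta> / 12" using d\<eta> \<eta>(3) real_sqrt_le_mono order.trans by blast
    ultimately have "4 * d + 2 * sqrt d \<le> \<delta> / 2" by linarith
    then have 1: "\<bar>expectation (\<lambda>\<omega>. he (\<lambda>i j. X n i j \<omega>) (\<lambda>i j. Y n i j \<omega>)) - expectation (\<lambda>\<omega>. hI (\<lambda>i j. Y n i j \<omega>))\<bar> \<le> \<delta> / 2"
      using he_hI_expectation unfolding d_def by linarith
    have "\<bar>expectation (\<lambda>\<omega>. hI (\<lambda>i j. Y n i j \<omega>)) - H_lim y t\<bar> \<le> err n"
      unfolding err_def
      by (rule fixed_point_stability[OF y t _ EhI_equation(2,3)]) (use EhI_equation(1) in \<open>auto simp: add_divide_distrib\<close>)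
    with 1 e1 show "\<bar>expectation (\<lambda>\<omega>. reg t e n \<omega>) - H_lim y t\<bar> \<le> \<delta>"
      unfolding he[symmetric] by linarith
  qed
  then show ?thesis using that[of e0] \<eta> by (simp add: e0_def)
qed

text \<open>Half of \<open>2 \<delta>\<close> is spent on the bias of the mean, half on the
  fluctuation. The resulting bound does not contain the shift, so \<open>prob_limit_le\<close>
  applies.\<close>

lemma hh_tail:
  assumes t: "0 < t" and \<delta>: "0 < \<delta>"
  shows "eventually (\<lambda>n. prob {\<omega> \<in> space M. 2 * \<delta> < \<bar>hh t n \<omega> - H_lim y t\<bar>}
    \<le> 2 * exp (- (2 * \<delta>\<^sup>2) * (real n)\<^sup>2 / real (n1 n + n2 n))) sequentially"
proof -
  obtain e0 where e0: "0 < e0" "eventually (\<lambda>n. \<forall>e. 0 < e \<and> e \<le> e0 \<longrightarrow>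
    \<bar>expectation (\<lambda>\<omega>. reg t e n \<omega>) - H_lim y t\<bar> \<le> \<delta>) sequentially"
    by (rule expectation_he[OF t \<delta>])
  from e0(2) eventually_gt_at_top[of 0] show ?thesis
  proof eventually_elim
    case (elim n)
    then have n: "0 < n" by simp
    define e where "e k = e0 / (real k + 1)" for k
    have ek: "0 < e k" "e k \<le> e0" for k using e0(1) by (auto simp: e_def field_simps)
    have elim0: "e \<longlonglongrightarrow> 0" unfolding e_def by real_asymp
    define f where "f k \<omega> = reg t (e k) n \<omega>" for k \<omega>
    show ?case
    proof (rule prob_limit_le[where f=f])
      show "hh t n \<in> borel_measurable M" by (rule hh_meas[OF n t])
      show "AE \<omega> in M. (\<lambda>k. f k \<omega>) \<longlonglongrightarrow> hh t n \<omega>"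
        using B_pd by eventually_elim (unfold f_def, intro he_tendsto_hh n t elim0, use n in auto)
      fix k
      interpret gaussian_pair M n "n1 n" "n2 n" t "e k" "X n" "Y n" by (rule gp[OF n t ek(1)])
      have he: "he (\<lambda>i j. X n i j \<omega>) (\<lambda>i j. Y n i j \<omega>) = f k \<omega>" for \<omega>
        by (simp add: he_def stat_def GA_def GB_def A_def B_def f_def)
      show fm: "f k \<in> borel_measurable M" using he_rv by (simp add: he)
      have fk: "f k = (\<lambda>\<omega>. reg t (e k) n \<omega>)"
        by (rule ext) (simp only: f_def)
      have E: "\<bar>expectation (f k) - H_lim y t\<bar> \<le> \<delta>"
        unfolding fk by (rule elim(1)[rule_format]) (intro conjI ek)
      have "prob {\<omega> \<in> space M. 2 * \<delta> \<le> \<bar>f k \<omega> - H_lim y t\<bar>} \<le> prob {\<omega> \<in> space M. \<delta> \<le> \<bar>f k \<omega> - expectation (f k)\<bar>}"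
      proof (rule finite_measure_mono)
        show "{\<omega> \<in> space M. 2 * \<delta> \<le> \<bar>f k \<omega> - H_lim y t\<bar>} \<subseteq> {\<omega> \<in> space M. \<delta> \<le> \<bar>f k \<omega> - expectation (f k)\<bar>}"
        proof (intro subsetI CollectI conjI; clarify)
          fix \<omega> assume "2 * \<delta> \<le> \<bar>f k \<omega> - H_lim y t\<bar>"
          then show "\<delta> \<le> \<bar>f k \<omega> - expectation (f k)\<bar>" using E by linarith
        qed
      qed (use fm in measurable)
      also have "\<dots> \<le> 2 * exp (- 2 * \<delta>\<^sup>2 / ((n1 n + n2 n) * (1 / n)\<^sup>2))"
        using he_tail[OF \<delta>] by (simp add: he)
      also have "- 2 * \<delta>\<^sup>2 / ((n1 n + n2 n) * (1 / n)\<^sup>2) = - (2 * \<delta>\<^sup>2) * (real n)\<^sup>2 / real (n1 n + n2 n)"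
        using n by (simp add: power_divide)
      finally show "prob {\<omega> \<in> space M. 2 * \<delta> \<le> \<bar>f k \<omega> - H_lim y t\<bar>} \<le> 2 * exp (- (2 * \<delta>\<^sup>2) * (real n)\<^sup>2 / real (n1 n + n2 n))" .
    qed
  qed
qed

text \<open>Borel-Cantelli for each tolerance, then a sequence of tolerances tending to 0.\<close>

lemma hh_tendsto:
  assumes t: "0 < t"
  shows "AE \<omega> in M. (\<lambda>n. hh t n \<omega>) \<longlonglongrightarrow> H_lim y t"
proof -
  obtain C where C: "0 < C" "eventually (\<lambda>n. 0 < real (n1 n + n2 n) \<and> real (n1 n + n2 n) \<le> C * real n powr (1 + \<nu>)) sequentially"
    by (rule sum_growth)
  have one: "AE \<omega> in M. eventually (\<lambda>n. \<bar>hh t n \<omega> - H_lim y t\<bar> \<le> 2 * \<delta>) sequentially" if \<delta>: "0 < \<delta>" for \<delta>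
  proof -
    \<comment> \<open>The empty set at \<open>n = 0\<close> keeps every event measurable, since
      \<open>hh_meas\<close> assumes positive \<open>n\<close>.\<close>
    define E where "E n = (if 0 < n then {\<omega> \<in> space M. 2 * \<delta> < \<bar>hh t n \<omega> - H_lim y t\<bar>} else {})" for n
    have meas: "E n \<in> sets M" for n unfolding E_def using hh_meas[of n t] t by auto
    have "AE \<omega> in M. eventually (\<lambda>n. \<omega> \<in> space M - E n) sequentially"
    proof (rule borel_cantelli_AE1[OF meas])
      show "emeasure M (E n) < \<infinity>" for n by (simp add: emeasure_eq_measure)
      show "summable (\<lambda>n. prob (E n))"
      proof (rule summable_comparison_test_ev)
        show "summable (\<lambda>n. 2 * exp (- (2 * \<delta>\<^sup>2) * (real n)\<^sup>2 / real (n1 n + n2 n)))"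
          by (intro summable_mult summable_exp_powr[OF \<nu>(2) _ C]) (use \<delta> in auto)
        show "eventually (\<lambda>n. norm (prob (E n)) \<le> 2 * exp (- (2 * \<delta>\<^sup>2) * (real n)\<^sup>2 / real (n1 n + n2 n))) sequentially"
          using hh_tail[OF t \<delta>] eventually_gt_at_top[of 0] by eventually_elim (simp add: E_def)
      qed
    qed
    then show ?thesis
    proof eventually_elim
      case (elim \<omega>)
      then show ?case using eventually_gt_at_top[of 0] by eventually_elim (auto simp: E_def not_less)
    qed
  qed
  have "AE \<omega> in M. \<forall>k::nat. eventually (\<lambda>n. \<bar>hh t n \<omega> - H_lim y t\<bar> \<le> 2 * (1 / (real k + 1))) sequentially"
    unfolding AE_all_countable by (intro allI one) simp
  then show ?thesis
  proof eventually_elim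
    case (elim \<omega>)
    show ?case
    proof (rule tendstoI)
      fix \<epsilon> :: real assume \<epsilon>: "0 < \<epsilon>"
      have "(\<lambda>k. 2 * (1 / (real k + 1))) \<longlonglongrightarrow> 0" by real_asymp
      then have "eventually (\<lambda>k. 2 * (1 / (real k + 1)) < \<epsilon>) sequentially" using \<epsilon> by (rule order_tendstoD(2))
      then obtain k where k: "2 * (1 / (real k + 1)) < \<epsilon>" by (auto simp: eventually_sequentially)
      from elim have "eventually (\<lambda>n. \<bar>hh t n \<omega> - H_lim y t\<bar> \<le> 2 * (1 / (real k + 1))) sequentially" by blast
      then show "eventually (\<lambda>n. dist (hh t n \<omega>) (H_lim y t) < \<epsilon>) sequentially"
        by eventually_elim (use k in \<open>auto simp: dist_real_def\<close>)
    qed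
  qed
qed

section \<open>From the transform to the empirical distribution function\<close>

definition lam :: "'a \<Rightarrow> nat \<Rightarrow> nat \<Rightarrow> real" where
  "lam \<omega> n i = eigs_sorted (F_mat n (n1 n) (n2 n) (\<lambda>i j. X n i j \<omega>) (\<lambda>i j. Y n i j \<omega>)) ! i"

lemma G_lim_eq_integral: "G_lim y \<xi> = (\<integral>x. f_dens y x * (if x \<le> \<xi> then 1 else 0) \<partial>lborel)"
  unfolding G_lim_def set_lebesgue_integral_def by (intro Bochner_Integration.integral_cong) (auto split: split_indicator)

lemma f_dens_pos: "f_dens y x \<noteq> 0 \<Longrightarrow> 0 < x"
  using f_dens_eq_0[OF y, of x] s1_s2_props(5)[OF y] by (meson less_trans not_le zero_less_divide_1_iff)

definition emp :: "'a \<Rightarrow> real \<Rightarrow> nat \<Rightarrow> real" where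
  "emp \<omega> \<xi> n = emp_df n (\<lambda>i. real n / (2 * (real (n1 n) - real n)) * (lam \<omega> n i * (real (n1 n) / real (n2 n)) + 1)) \<xi>"

text \<open>The scaled eigenvalues are \<open>a n\<close> times \<open>lam\<close> plus
  \<open>b n\<close>, so the condition to lie below \<open>\<xi>\<close> becomes
  \<open>lam \<le> c n\<close>, and then \<open>w \<le> c n / (1 + c n)\<close> by monotonicity of
  \<open>p / (1 + p)\<close>. Positivity of \<open>\<xi>\<close> makes \<open>c n\<close> eventually
  positive, where this monotonicity is available.\<close>

lemma emp_limit_pos:
  assumes pd: "\<And>n. 0 < n \<Longrightarrow> pd n (B n \<omega>)"
    and hl: "\<And>m::nat. (\<lambda>n. hh (1 - 1 / (real m + 2)) n \<omega>) \<longlonglongrightarrow> H_lim y (1 - 1 / (real m + 2))"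
    and \<xi>: "0 < \<xi>"
  shows "(\<lambda>n. emp \<omega> \<xi> n) \<longlonglongrightarrow> G_lim y \<xi>"
proof -
  have lamF: "lam \<omega> n i = eigs_sorted (A n \<omega> * minv (B n \<omega>)) ! i" if "0 < n" for n i
    using F_mat_gram[OF pd[OF that, unfolded B_def]] by (simp add: lam_def A_def B_def)
  have lam0: "0 \<le> lam \<omega> n i" if "i < n" for n i
    using that eigs_pencil(2)[OF A_psd pd, of n i \<omega>] lamF[of n i] by simp
  have t: "0 < 1 - 1 / (real m + 2)" for m by simp
  interpret T: transform_limit "lam \<omega>" "f_dens y" "\<lambda>x. 2 * x / y"
  proof
    show "0 \<le> f_dens y x" for x by (rule f_dens_nonneg[OF y])
    show "integrable lborel (f_dens y)" "(\<integral>x. f_dens y x \<partial>lborel) = 1" by (rule f_dens_mass[OF y])+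
    show "0 \<le> 2 * x / y" if "f_dens y x \<noteq> 0" for x using f_dens_pos[OF that] y by simp
    show "(\<lambda>x. 2 * x / y) \<in> borel_measurable borel" by measurable
    fix m :: nat
    have "eventually (\<lambda>n. hh (1 - 1 / (real m + 2)) n \<omega> = (\<Sum>i<n. 1 / (1 + (1 - 1 / (real m + 2)) * lam \<omega> n i)) / real n) sequentially"
      using eventually_gt_at_top[of 0]
    proof eventually_elim
      case (elim n)
      show ?case unfolding hh_def eigs_pencil(3)[OF A_psd pd[OF elim] t, symmetric] by (simp add: lamF[OF elim])
    qed
    with hl[of m] show "(\<lambda>n. (\<Sum>i<n. 1 / (1 + (1 - 1 / (real m + 2)) * lam \<omega> n i)) / real n) \<longlonglongrightarrow>
        (\<integral>x. f_dens y x * (1 / (1 + (1 - 1 / (real m + 2)) * (2 * x / y))) \<partial>lborel)"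
      unfolding f_dens_transform(2)[OF y t] by (rule Lim_transform_eventually)
  qed (rule lam0)
  define a where "a n = real n / (2 * (real (n1 n) - real n)) * (real (n1 n) / real (n2 n))" for n
  define b where "b n = real n / (2 * (real (n1 n) - real n))" for n
  define c where "c n = (\<xi> - b n) / a n" for n
  \<comment> \<open>Where \<open>n1 n = n\<close> the scaling divides by zero; only finitely many
    such \<open>n\<close> occur.\<close>
  have ev1: "eventually (\<lambda>n. 0 < n \<and> n < n1 n) sequentially"
  proof -
    have "eventually (\<lambda>n. real n / real (n1 n) < 1) sequentially" using lim1 by (intro order_tendstoD(2)) auto
    then show ?thesis using eventually_gt_at_top[of 0]
      by eventually_elim (use n1_pos in \<open>auto simp: divide_less_eq split: if_splits\<close>)
  qed
  have a_lim: "a \<longlonglongrightarrow> y / 2"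
  proof -
    have "(\<lambda>n. (real n / real (n2 n)) / (2 * (1 - real n / real (n1 n)))) \<longlonglongrightarrow> y / (2 * (1 - 0))"
      by (intro tendsto_intros lim1 lim2) auto
    moreover have "eventually (\<lambda>n. (real n / real (n2 n)) / (2 * (1 - real n / real (n1 n))) = a n) sequentially"
      using ev1 by eventually_elim (use n2_pos in \<open>simp add: a_def field_simps\<close>)
    ultimately show ?thesis using Lim_transform_eventually by fastforce
  qed
  have b_lim: "b \<longlonglongrightarrow> 0"
  proof -
    have "(\<lambda>n. (real n / real (n1 n)) / (2 * (1 - real n / real (n1 n)))) \<longlonglongrightarrow> 0 / (2 * (1 - 0))"
      by (intro tendsto_intros lim1) auto
    moreover have "eventually (\<lambda>n. (real n / real (n1 n)) / (2 * (1 - real n / real (n1 n))) = b n) sequentially"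
      using ev1 by eventually_elim (simp add: b_def field_simps)
    ultimately show ?thesis using Lim_transform_eventually by fastforce
  qed
  define c0 where "c0 = 2 * \<xi> / y"
  have c0: "0 < c0" using \<xi> y by (simp add: c0_def)
  have c_lim: "c \<longlonglongrightarrow> c0"
  proof -
    have "c \<longlonglongrightarrow> (\<xi> - 0) / (y / 2)" unfolding c_def by (intro tendsto_intros a_lim b_lim) (use y in auto)
    moreover have "(\<xi> - 0) / (y / 2) = c0" by (simp add: c0_def)
    ultimately show ?thesis by (simp only:)
  qed
  have \<kappa>_lim: "(\<lambda>n. c n / (1 + c n)) \<longlonglongrightarrow> c0 / (1 + c0)"
    by (intro tendsto_intros c_lim) (use c0 in auto)
  have frac_le_iff: "p / (1 + p) \<le> q / (1 + q) \<longleftrightarrow> p \<le> q" if "0 \<le> p" "0 \<le> q" for p q :: real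
    using that by (simp add: field_simps)
  have frac_eq_iff: "p / (1 + p) = q / (1 + q) \<longleftrightarrow> p = q" if "0 \<le> p" "0 \<le> q" for p q :: real
    using frac_le_iff[OF that] frac_le_iff[OF that(2,1)] by (metis order.antisym order.refl)
  have W: "T.W x = (2 * x / y) / (1 + 2 * x / y)" if "0 \<le> x" for x
    using that y by (simp add: T.W_def)
  have xc: "2 * x / y \<le> c0 \<longleftrightarrow> x \<le> \<xi>" "2 * x / y = c0 \<longleftrightarrow> x = \<xi>" for x
    using y by (simp_all add: c0_def divide_le_cancel)
  have "(\<lambda>n. (\<Sum>i<n. if T.w n i \<le> c n / (1 + c n) then 1 else 0) / n) \<longlonglongrightarrow>
    (\<integral>x. f_dens y x * (if T.W x \<le> c0 / (1 + c0) then 1 else 0) \<partial>lborel)"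
  proof (rule T.df_limit[OF \<kappa>_lim])
    \<comment> \<open>On the support \<open>W\<close> is injective, so \<open>\<xi>\<close> is the
      only point to be excluded.\<close>
    show "AE x in lborel. f_dens y x \<noteq> 0 \<longrightarrow> T.W x \<noteq> c0 / (1 + c0)"
      using AE_lborel_singleton[of \<xi>]
    proof eventually_elim
      case (elim x)
      show ?case
      proof
        assume "f_dens y x \<noteq> 0"
        then have "0 < x" by (rule f_dens_pos)
        then show "T.W x \<noteq> c0 / (1 + c0)"
          using frac_eq_iff[of "2 * x / y" c0] c0 y xc(2)[of x] elim by (simp add: W)
      qed
    qed
  qed
  also have "(\<integral>x. f_dens y x * (if T.W x \<le> c0 / (1 + c0) then 1 else 0) \<partial>lborel) = G_lim y \<xi>"
    unfolding G_lim_eq_integral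
  proof (intro Bochner_Integration.integral_cong refl)
    fix x
    show "f_dens y x * (if T.W x \<le> c0 / (1 + c0) then 1 else 0) = f_dens y x * (if x \<le> \<xi> then 1 else 0)"
    proof (cases "f_dens y x = 0")
      case False
      then have "0 < x" by (rule f_dens_pos)
      then show ?thesis using frac_le_iff[of "2 * x / y" c0] c0 y xc(1)[of x] by (simp add: W)
    qed simp
  qed
  finally have L: "(\<lambda>n. (\<Sum>i<n. if T.w n i \<le> c n / (1 + c n) then 1 else 0) / n) \<longlonglongrightarrow> G_lim y \<xi>" .
  have "eventually (\<lambda>n. c n > 0) sequentially" using c_lim c0 by (rule order_tendstoD(1))
  then have "eventually (\<lambda>n. (\<Sum>i<n. if T.w n i \<le> c n / (1 + c n) then 1 else 0) / n = emp \<omega> \<xi> n) sequentially"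
    using ev1
  proof eventually_elim
    case (elim n)
    have a: "0 < a n" unfolding a_def using elim n2_pos[of n] by (intro mult_pos_pos divide_pos_pos) auto
    have iff: "T.w n i \<le> c n / (1 + c n) \<longleftrightarrow> real n / (2 * (real (n1 n) - real n)) * (lam \<omega> n i * (real (n1 n) / real (n2 n)) + 1) \<le> \<xi>"
      if i: "i < n" for i
    proof -
      have "T.w n i \<le> c n / (1 + c n) \<longleftrightarrow> lam \<omega> n i \<le> c n"
        unfolding T.w_def using lam0[OF i] elim by (intro frac_le_iff) auto
      also have "\<dots> \<longleftrightarrow> a n * lam \<omega> n i + b n \<le> \<xi>"
        using a by (simp add: c_def le_divide_eq algebra_simps)
      also have "a n * lam \<omega> n i + b n = real n / (2 * (real (n1 n) - real n)) * (lam \<omega> n i * (real (n1 n) / real (n2 n)) + 1)"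
        by (simp add: a_def b_def algebra_simps)
      finally show ?thesis .
    qed
    have "(\<Sum>i<n. if T.w n i \<le> c n / (1 + c n) then 1 else (0::real))
      = (\<Sum>i<n. if real n / (2 * (real (n1 n) - real n)) * (lam \<omega> n i * (real (n1 n) / real (n2 n)) + 1) \<le> \<xi> then 1 else 0)"
      by (intro sum.cong refl) (simp add: iff)
    then show ?case by (simp add: emp_def emp_df_def)
  qed
  with L show ?thesis by (rule Lim_transform_eventually)
qed

text \<open>For \<open>\<xi> \<le> 0\<close> the empirical distribution function is dominated by its
  value at \<open>1 / s2 y\<close>, the left end of the support, where the limit is 0.\<close>

lemma emp_limit:
  assumes pos: "\<And>\<xi>. 0 < \<xi> \<Longrightarrow> (\<lambda>n. emp \<omega> \<xi> n) \<longlonglongrightarrow> G_lim y \<xi>"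
  shows "(\<lambda>n. emp \<omega> \<xi> n) \<longlonglongrightarrow> G_lim y \<xi>"
proof (cases "0 < \<xi>")
  case False
  define \<xi>' where "\<xi>' = 1 / s2 y"
  have \<xi>': "0 < \<xi>'" using s1_s2_props(5)[OF y] by (simp add: \<xi>'_def)
  have G0: "G_lim y z = 0" if "z \<le> \<xi>'" for z
  proof -
    have "(\<lambda>x. f_dens y x * (if x \<le> z then 1 else 0)) = (\<lambda>x. 0)"
      using that f_dens_eq_0[OF y] by (auto simp: \<xi>'_def fun_eq_iff)
    then show ?thesis unfolding G_lim_eq_integral by (simp only: Bochner_Integration.integral_zero)
  qed
  have "(\<lambda>n. emp \<omega> \<xi> n) \<longlonglongrightarrow> 0"
  proof (rule tendsto_sandwich[OF _ _ tendsto_const])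
    show "(\<lambda>n. emp \<omega> \<xi>' n) \<longlonglongrightarrow> 0" using pos[OF \<xi>'] G0[of \<xi>'] by simp
    show "eventually (\<lambda>n. 0 \<le> emp \<omega> \<xi> n) sequentially"
      unfolding emp_def emp_df_def by (intro always_eventually allI mult_nonneg_nonneg sum_nonneg) auto
    show "eventually (\<lambda>n. emp \<omega> \<xi> n \<le> emp \<omega> \<xi>' n) sequentially"
      unfolding emp_def emp_df_def using False \<xi>'
      by (intro always_eventually allI mult_left_mono sum_mono) auto
  qed
  then show ?thesis using G0[of \<xi>] False \<xi>' by simp
qed (rule pos)

text \<open>Only the countably many points \<open>t = 1 - 1/(m + 2)\<close> are used, so one null
  set serves all \<open>\<xi>\<close>.\<close>

lemma emp_converges: "AE \<omega> in M. \<forall>\<xi>. (\<lambda>n. emp \<omega> \<xi> n) \<longlonglongrightarrow> G_lim y \<xi>"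
proof -
  have "AE \<omega> in M. \<forall>m::nat. (\<lambda>n. hh (1 - 1 / (real m + 2)) n \<omega>) \<longlonglongrightarrow> H_lim y (1 - 1 / (real m + 2))"
    unfolding AE_all_countable by (intro allI hh_tendsto) simp
  with B_pd show ?thesis
  proof eventually_elim
    case (elim \<omega>)
    show ?case
    proof
      fix \<xi>
      show "(\<lambda>n. emp \<omega> \<xi> n) \<longlonglongrightarrow> G_lim y \<xi>"
        by (rule emp_limit, rule emp_limit_pos) (use elim in auto)
    qed
  qed
qed

end

theorem theorem4p3:
  fixes M :: "'a measure"
    and n1 n2 :: "nat \<Rightarrow> nat"
    and X Y :: "nat \<Rightarrow> nat \<Rightarrow> nat \<Rightarrow> 'a \<Rightarrow> real"
    and y' :: real
  assumes "prob_space M"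
    and "\<And>n. n1 n \<ge> n" and "\<And>n. n2 n \<ge> n"
    and "\<And>n i j. i < n \<Longrightarrow> j < n1 n \<Longrightarrow> distributed M lborel (X n i j) std_normal_density"
    and "\<And>n i j. i < n \<Longrightarrow> j < n2 n \<Longrightarrow> distributed M lborel (Y n i j) std_normal_density"
    and "\<And>n. prob_space.indep_vars M (\<lambda>_. borel)
               (case_sum (\<lambda>(i,j). X n i j) (\<lambda>(i,j). Y n i j))
               (Inl ` ({..<n} \<times> {..<n1 n}) \<union> Inr ` ({..<n} \<times> {..<n2 n}))"
    and "(\<lambda>n. real n / real (n1 n)) \<longlonglongrightarrow> 0"
    and "(\<lambda>n. real n / real (n2 n)) \<longlonglongrightarrow> y'"
    and "0 < y'" and "y' \<le> 1"
    and "\<exists>\<nu>. 0 < \<nu> \<and> \<nu> < 1/3 \<and> (\<lambda>n. real (n1 n)) \<in> O(\<lambda>n. real n powr (1 + \<nu>))"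
  shows "AE \<omega> in M. \<forall>\<xi>.
           (\<lambda>n. emp_df n
              (\<lambda>i. real n / (2 * (real (n1 n) - real n)) *
                    (eigs_sorted (F_mat n (n1 n) (n2 n) (\<lambda>i j. X n i j \<omega>) (\<lambda>i j. Y n i j \<omega>)) ! i
                       * (real (n1 n) / real (n2 n)) + 1)) \<xi>)
           \<longlonglongrightarrow> G_lim y' \<xi>"
proof -
  interpret prob_space M by fact
  obtain \<nu> where \<nu>: "0 < \<nu>" "\<nu> < 1/3" "(\<lambda>n. real (n1 n)) \<in> O(\<lambda>n. real n powr (1 + \<nu>))"
    using assms(11) by blast
  interpret fisher_sequence M n1 n2 X Y y' \<nu>
    by unfold_locales (use assms \<nu> in auto)
  show ?thesis using emp_converges unfolding emp_def lam_def .
qed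

end
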